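(* Let $S^t$ be a flow with compact forward invariant set $\mathcal D$ and (Milnor) attractor $\mathcal A\subset\mathcal D$ of zero Lebesgue measure carrying an invariant physical probability measure $\mu$, $\mu(\mathcal A)=1$. Let $\mathcal H=\mathcal H_{\mathcal A}\otimes\mathcal H_{\mathcal B}$ be the Hilbert space described in the context, and assume that the restriction of the composition operator to $\mathcal H_{\mathcal B}$ is of scalar type. Consider the composition operator $U^t:\mathcal H\to\mathcal H$, $U^t=U^t|_{\mathcal H_{\mathcal A}}\otimes U^t|_{\mathcal H_{\mathcal B}}$, and let $\sigma(U^t|_{\mathcal H_{\mathcal A}})$, $\sigma(U^t|_{\mathcal H_{\mathcal B}})$ be the spectra of its restrictions, with associated projection-valued spectral measures $P_\omega$ and $P_z$, $z\in\mathbb C$, so that $$U^t|_{\mathcal H_{\mathcal A}}=\int_{\mathbb R}e^{i2\pi\omega t}\,dP_\omega,\qquad U^t|_{\mathcal H_{\mathcal B}}=\int_{\mathbb C}e^{zt}\,dP_z .$$ Then $$\sigma(U^t)=\mathrm{cl}\big(P(\sigma(U^t|_{\mathcal H_{\mathcal A}}),\sigma(U^t|_{\mathcal H_{\mathcal B}}))\big)$$ and $$U^t=\int_{\mathbb C}\int_{\mathbb R}e^{zt}e^{i2\pi\omega t}\,dP_\omega\,dP_z .$$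
   Context: For sets $E_1,E_2\subset\mathbb C$, $P(E_1,E_2)=\{ab: a\in E_1,\ b\in E_2\}$ is the set of products, and $\mathrm{cl}$ denotes closure. $U^tf=f\circ S^t$. $\mathcal H_{\mathcal A}=L^2(\mathcal A,\mu)$, whose elements are also regarded as functions on $\mathcal D$; $U^t$ is unitary on $\mathcal H_{\mathcal A}$. $\tilde{\mathcal H}_{\mathcal B}\subset C(\mathcal D)$ is a Hilbert space of continuous functions $f:\mathcal D\to\mathbb C$ with $\int_{\mathcal D}f\phi\,d\mu=0$ for all $\phi\in\mathcal H_{\mathcal A}$, invariant under $U^t$. $\mathcal H_{\mathcal B}$ is the space obtained by adjoining to $\tilde{\mathcal H}_{\mathcal B}$ the constant function $\mathbf 1$. The tensor product $\tilde{\mathcal H}=\mathcal H_{\mathcal A}\otimes\tilde{\mathcal H}_{\mathcal B}$ is assumed invariant under $U^t$. A bounded operator $T$ is of scalar type (in the sense of Dunford) if $T=\int_{\mathbb C}\lambda\,dP_\lambda$ for a (countably additive, bounded) resolution of the identity $P$. In the double integral, $dP_\omega\,dP_z$ denotes the product spectral measure, with $P_\omega$ acting on the factor $\mathcal H_{\mathcal A}$ and $P_z$ on the factor $\mathcal H_{\mathcal B}$. *)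

theory Defs
  imports "HOL-Probability.Probability_Measure" "HOL-Algebra.Module"
begin

section \<open>Complex Hilbert spaces on explicit carriers\<close>

text \<open>
  The spaces depend on term parameters (a measure, a set), so they are carriers rather than types:
  \<^const>\<open>module\<close> records over the field of complex numbers, extended by an inner product.
  The fields \<open>mult\<close> and \<open>one\<close>, which \<open>module\<close> records inherit from rings, are irrelevant.
\<close>

definition complex_field :: "complex ring" where
  "complex_field = \<lparr>carrier = UNIV, mult = (*), one = 1, zero = 0, add = (+)\<rparr>"

record 'v hilbert = "(complex, 'v) module" +
  cinner :: "'v \<Rightarrow> 'v \<Rightarrow> complex"

definition hnorm :: "('v, 'm) hilbert_scheme \<Rightarrow> 'v \<Rightarrow> real" where
  "hnorm H x = sqrt (Re (cinner H x x))"

definition hlimit :: "('v, 'm) hilbert_scheme \<Rightarrow> (nat \<Rightarrow> 'v) \<Rightarrow> 'v \<Rightarrow> bool" where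
  "hlimit H X l \<longleftrightarrow> (\<lambda>n. hnorm H (X n \<ominus>\<^bsub>H\<^esub> l)) \<longlonglongrightarrow> 0"

text \<open>The inner product is linear in its first argument.\<close>

locale complex_hilbert_space = module complex_field H
  for H :: "('v, 'm) hilbert_scheme" (structure) +
  assumes cinner_add_left:
      "\<lbrakk>x \<in> carrier H; y \<in> carrier H; z \<in> carrier H\<rbrakk>
        \<Longrightarrow> cinner H (x \<oplus> y) z = cinner H x z + cinner H y z"
    and cinner_smult_left:
      "\<lbrakk>x \<in> carrier H; y \<in> carrier H\<rbrakk> \<Longrightarrow> cinner H (c \<odot>\<^bsub>H\<^esub> x) y = c * cinner H x y"
    and cinner_commute:
      "\<lbrakk>x \<in> carrier H; y \<in> carrier H\<rbrakk> \<Longrightarrow> cinner H y x = cnj (cinner H x y)"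
    and cinner_pos:
      "\<lbrakk>x \<in> carrier H; x \<noteq> \<zero>\<rbrakk> \<Longrightarrow> 0 < Re (cinner H x x)"
    and complete:
      "\<lbrakk>\<And>n. X n \<in> carrier H;
        \<And>e. e > 0 \<Longrightarrow> \<exists>N. \<forall>m\<ge>N. \<forall>n\<ge>N. hnorm H (X m \<ominus> X n) < e\<rbrakk>
        \<Longrightarrow> \<exists>l\<in>carrier H. hlimit H X l"

definition closed_subspace :: "('v, 'm) hilbert_scheme \<Rightarrow> 'v set \<Rightarrow> bool" where
  "closed_subspace H W \<longleftrightarrow> submodule W complex_field H \<and>
     (\<forall>X. \<forall>l\<in>carrier H. range X \<subseteq> W \<longrightarrow> hlimit H X l \<longrightarrow> l \<in> W)"

definition closed_span :: "('v, 'm) hilbert_scheme \<Rightarrow> 'v set \<Rightarrow> 'v set" where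
  "closed_span H A = \<Inter>{W. closed_subspace H W \<and> A \<subseteq> W}"

section \<open>Bounded operators and spectral measures\<close>

text \<open>Operators are functions of which only the values on the carrier matter.\<close>

definition bounded_operator :: "('v, 'm) hilbert_scheme \<Rightarrow> ('v \<Rightarrow> 'v) \<Rightarrow> bool" where
  "bounded_operator H T \<longleftrightarrow>
     T \<in> carrier H \<rightarrow> carrier H \<and>
     (\<forall>x\<in>carrier H. \<forall>y\<in>carrier H. T (x \<oplus>\<^bsub>H\<^esub> y) = T x \<oplus>\<^bsub>H\<^esub> T y) \<and>
     (\<forall>c. \<forall>x\<in>carrier H. T (c \<odot>\<^bsub>H\<^esub> x) = c \<odot>\<^bsub>H\<^esub> T x) \<and>
     (\<exists>C. \<forall>x\<in>carrier H. hnorm H (T x) \<le> C * hnorm H x)"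

definition spectrum :: "('v, 'm) hilbert_scheme \<Rightarrow> ('v \<Rightarrow> 'v) \<Rightarrow> complex set" where
  "spectrum H T = {z. \<not> (\<exists>R. bounded_operator H R \<and>
     (\<forall>x\<in>carrier H. R (T x \<ominus>\<^bsub>H\<^esub> z \<odot>\<^bsub>H\<^esub> x) = x \<and> T (R x) \<ominus>\<^bsub>H\<^esub> z \<odot>\<^bsub>H\<^esub> R x = x))}"

text \<open>
  A countably additive bounded resolution of the identity in the sense of Dunford: the values are
  projections that need not be self-adjoint, and countable additivity refers to the strong
  operator topology.
\<close>

definition resolution_of_identity ::
    "('v, 'm) hilbert_scheme \<Rightarrow> 's measure \<Rightarrow> ('s set \<Rightarrow> 'v \<Rightarrow> 'v) \<Rightarrow> bool" where
  "resolution_of_identity H M E \<longleftrightarrow>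
     (\<forall>S\<in>sets M. bounded_operator H (E S)) \<and>
     (\<exists>C. \<forall>S\<in>sets M. \<forall>x\<in>carrier H. hnorm H (E S x) \<le> C * hnorm H x) \<and>
     (\<forall>x\<in>carrier H. E (space M) x = x) \<and>
     (\<forall>S\<in>sets M. \<forall>S'\<in>sets M. \<forall>x\<in>carrier H. E (S \<inter> S') x = E S (E S' x)) \<and>
     (\<forall>S. range S \<subseteq> sets M \<longrightarrow> disjoint_family S \<longrightarrow>
        (\<forall>x\<in>carrier H. hlimit H (\<lambda>n. \<Oplus>\<^bsub>H\<^esub>i\<in>{..<n}. E (S i) x) (E (\<Union>i::nat. S i) x)))"

definition self_adjoint_resolution ::
    "('v, 'm) hilbert_scheme \<Rightarrow> 's measure \<Rightarrow> ('s set \<Rightarrow> 'v \<Rightarrow> 'v) \<Rightarrow> bool" where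
  "self_adjoint_resolution H M E \<longleftrightarrow> resolution_of_identity H M E \<and>
     (\<forall>S\<in>sets M. \<forall>x\<in>carrier H. \<forall>y\<in>carrier H. cinner H (E S x) y = cinner H x (E S y))"

definition simple_spectral_integral ::
    "('v, 'm) hilbert_scheme \<Rightarrow> 's measure \<Rightarrow> ('s set \<Rightarrow> 'v \<Rightarrow> 'v) \<Rightarrow> ('s \<Rightarrow> complex) \<Rightarrow> 'v \<Rightarrow> 'v"
  where "simple_spectral_integral H M E s x =
     (\<Oplus>\<^bsub>H\<^esub>c\<in>s ` space M. c \<odot>\<^bsub>H\<^esub> E (s -` {c} \<inter> space M) x)"

text \<open>
  \<open>T\<close> is the integral of \<open>f\<close> with respect to \<open>E\<close>: \<open>T\<close> is the limit in operator norm of integrals of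
  simple functions that converge to \<open>f\<close> uniformly on a set carrying \<open>E\<close>. As \<open>T\<close> is bounded,
  \<open>f\<close> is required to be \<open>E\<close>-essentially bounded.
\<close>

definition has_spectral_integral ::
    "('v, 'm) hilbert_scheme \<Rightarrow> 's measure \<Rightarrow> ('s set \<Rightarrow> 'v \<Rightarrow> 'v) \<Rightarrow> ('s \<Rightarrow> complex) \<Rightarrow> ('v \<Rightarrow> 'v) \<Rightarrow> bool"
  where "has_spectral_integral H M E f T \<longleftrightarrow>
     f \<in> borel_measurable M \<and> bounded_operator H T \<and>
     (\<exists>N\<in>sets M. (\<forall>x\<in>carrier H. E N x = x) \<and>
       (\<forall>e>0. \<exists>s. simple_function M s \<and> (\<forall>w\<in>N. cmod (f w - s w) \<le> e) \<and>
          (\<forall>x\<in>carrier H. hnorm H (T x \<ominus>\<^bsub>H\<^esub> simple_spectral_integral H M E s x) \<le> e * hnorm H x)))"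

definition scalar_type :: "('v, 'm) hilbert_scheme \<Rightarrow> ('v \<Rightarrow> 'v) \<Rightarrow> bool" where
  "scalar_type H T \<longleftrightarrow>
     (\<exists>E. resolution_of_identity H (borel :: complex measure) E \<and>
          has_spectral_integral H borel E (\<lambda>z. z) T)"

section \<open>Tensor products\<close>

text \<open>
  \<open>H\<close> together with the bilinear map \<open>\<tau>\<close> is the completion of the algebraic tensor product for the
  canonical inner product; this determines \<open>(H, \<tau>)\<close> up to a unitary isomorphism.
\<close>

definition hilbert_tensor_product ::
    "('a, 'm) hilbert_scheme \<Rightarrow> ('b, 'n) hilbert_scheme \<Rightarrow> ('h, 'k) hilbert_scheme \<Rightarrow>
     ('a \<Rightarrow> 'b \<Rightarrow> 'h) \<Rightarrow> bool" where
  "hilbert_tensor_product HA HB H \<tau> \<longleftrightarrow>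
     complex_hilbert_space H \<and>
     (\<forall>f\<in>carrier HA. \<forall>g\<in>carrier HB. \<tau> f g \<in> carrier H) \<and>
     (\<forall>f\<in>carrier HA. \<forall>f'\<in>carrier HA. \<forall>g\<in>carrier HB.
        \<tau> (f \<oplus>\<^bsub>HA\<^esub> f') g = \<tau> f g \<oplus>\<^bsub>H\<^esub> \<tau> f' g) \<and>
     (\<forall>f\<in>carrier HA. \<forall>g\<in>carrier HB. \<forall>g'\<in>carrier HB.
        \<tau> f (g \<oplus>\<^bsub>HB\<^esub> g') = \<tau> f g \<oplus>\<^bsub>H\<^esub> \<tau> f g') \<and>
     (\<forall>c. \<forall>f\<in>carrier HA. \<forall>g\<in>carrier HB.
        \<tau> (c \<odot>\<^bsub>HA\<^esub> f) g = c \<odot>\<^bsub>H\<^esub> \<tau> f g \<and> \<tau> f (c \<odot>\<^bsub>HB\<^esub> g) = c \<odot>\<^bsub>H\<^esub> \<tau> f g) \<and>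
     (\<forall>f\<in>carrier HA. \<forall>f'\<in>carrier HA. \<forall>g\<in>carrier HB. \<forall>g'\<in>carrier HB.
        cinner H (\<tau> f g) (\<tau> f' g') = cinner HA f f' * cinner HB g g') \<and>
     closed_span H {\<tau> f g | f g. f \<in> carrier HA \<and> g \<in> carrier HB} = carrier H"

definition tensor_operator ::
    "('a, 'm) hilbert_scheme \<Rightarrow> ('b, 'n) hilbert_scheme \<Rightarrow> ('h, 'k) hilbert_scheme \<Rightarrow>
     ('a \<Rightarrow> 'b \<Rightarrow> 'h) \<Rightarrow> ('a \<Rightarrow> 'a) \<Rightarrow> ('b \<Rightarrow> 'b) \<Rightarrow> ('h \<Rightarrow> 'h) \<Rightarrow> bool" where
  "tensor_operator HA HB H \<tau> TA TB T \<longleftrightarrow> bounded_operator H T \<and>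
     (\<forall>f\<in>carrier HA. \<forall>g\<in>carrier HB. T (\<tau> f g) = \<tau> (TA f) (TB g))"

definition product_resolution ::
    "('a, 'm) hilbert_scheme \<Rightarrow> ('b, 'n) hilbert_scheme \<Rightarrow> ('h, 'k) hilbert_scheme \<Rightarrow>
     ('a \<Rightarrow> 'b \<Rightarrow> 'h) \<Rightarrow> 's measure \<Rightarrow> 't measure \<Rightarrow>
     ('s set \<Rightarrow> 'a \<Rightarrow> 'a) \<Rightarrow> ('t set \<Rightarrow> 'b \<Rightarrow> 'b) \<Rightarrow> (('s \<times> 't) set \<Rightarrow> 'h \<Rightarrow> 'h) \<Rightarrow> bool" where
  "product_resolution HA HB H \<tau> M N P Q E \<longleftrightarrow>
     resolution_of_identity H (M \<Otimes>\<^sub>M N) E \<and>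
     (\<forall>X\<in>sets M. \<forall>Y\<in>sets N. tensor_operator HA HB H \<tau> (P X) (Q Y) (E (X \<times> Y)))"

definition set_of_products :: "complex set \<Rightarrow> complex set \<Rightarrow> complex set" where
  "set_of_products E1 E2 = {a * b | a b. a \<in> E1 \<and> b \<in> E2}"

section \<open>Flows, attractors and physical measures\<close>

definition is_flow :: "(real \<Rightarrow> 'x::topological_space \<Rightarrow> 'x) \<Rightarrow> bool" where
  "is_flow S \<longleftrightarrow> (\<forall>x. S 0 x = x) \<and> (\<forall>s t x. S (s + t) x = S s (S t x)) \<and>
     continuous_on UNIV (\<lambda>(t, x). S t x)"

definition omega_limit :: "(real \<Rightarrow> 'x::topological_space \<Rightarrow> 'x) \<Rightarrow> 'x \<Rightarrow> 'x set" where
  "omega_limit S x = (\<Inter>T. closure ((\<lambda>t. S t x) ` {T..}))"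

definition realm :: "(real \<Rightarrow> 'x::topological_space \<Rightarrow> 'x) \<Rightarrow> 'x set \<Rightarrow> 'x set \<Rightarrow> 'x set" where
  "realm S D A = {x \<in> D. omega_limit S x \<subseteq> A}"

text \<open>
  Milnor's definition with the compact forward invariant set \<open>D\<close> as phase space. A set of positive
  \<open>emeasure\<close> is in particular measurable.
\<close>

definition milnor_attractor ::
    "(real \<Rightarrow> 'x::euclidean_space \<Rightarrow> 'x) \<Rightarrow> 'x set \<Rightarrow> 'x set \<Rightarrow> bool" where
  "milnor_attractor S D A \<longleftrightarrow> closed A \<and> A \<subseteq> D \<and> emeasure lebesgue (realm S D A) > 0 \<and>
     (\<forall>A'. closed A' \<longrightarrow> A' \<subset> A \<longrightarrow> realm S D A - realm S D A' \<notin> null_sets lebesgue)"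

definition invariant_measure :: "(real \<Rightarrow> 'x::topological_space \<Rightarrow> 'x) \<Rightarrow> 'x measure \<Rightarrow> bool" where
  "invariant_measure S \<mu> \<longleftrightarrow> (\<forall>t. distr \<mu> borel (S t) = \<mu>)"

text \<open>On a set of positive Lebesgue measure, time averages of continuous functions converge to
  space averages.\<close>

definition physical_measure ::
    "(real \<Rightarrow> 'x::euclidean_space \<Rightarrow> 'x) \<Rightarrow> 'x set \<Rightarrow> 'x measure \<Rightarrow> bool" where
  "physical_measure S D \<mu> \<longleftrightarrow>
     emeasure lebesgue {x \<in> D. \<forall>f :: 'x \<Rightarrow> real. continuous_on D f \<longrightarrow>
       ((\<lambda>T. integral {0..T} (\<lambda>s. f (S s x)) / T) \<longlongrightarrow> (LINT y:D|\<mu>. f y)) at_top} > 0"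

section \<open>The function spaces and the composition operators\<close>

definition square_integrable :: "'x measure \<Rightarrow> ('x \<Rightarrow> complex) set" where
  "square_integrable M = {f \<in> borel_measurable M. integrable M (\<lambda>x. (cmod (f x))\<^sup>2)}"

definition L2_class :: "'x measure \<Rightarrow> ('x \<Rightarrow> complex) \<Rightarrow> ('x \<Rightarrow> complex) set" where
  "L2_class M f = {g \<in> square_integrable M. AE x in M. g x = f x}"

definition L2_rep :: "('x \<Rightarrow> complex) set \<Rightarrow> 'x \<Rightarrow> complex" where
  "L2_rep F = (SOME f. f \<in> F)"

definition L2 :: "'x measure \<Rightarrow> ('x \<Rightarrow> complex) set hilbert" where
  "L2 M = \<lparr>carrier = L2_class M ` square_integrable M,
     mult = undefined, one = undefined,
     zero = L2_class M (\<lambda>x. 0),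
     add = (\<lambda>F G. L2_class M (\<lambda>x. L2_rep F x + L2_rep G x)),
     smult = (\<lambda>c F. L2_class M (\<lambda>x. c * L2_rep F x)),
     cinner = (\<lambda>F G. LINT x|M. L2_rep F x * cnj (L2_rep G x))\<rparr>"

definition koopman_L2 ::
    "'x measure \<Rightarrow> ('x \<Rightarrow> 'x) \<Rightarrow> ('x \<Rightarrow> complex) set \<Rightarrow> ('x \<Rightarrow> complex) set" where
  "koopman_L2 M T F = L2_class M (\<lambda>x. L2_rep F (T x))"

text \<open>Functions on \<open>D\<close> are represented as extensional functions, undefined outside \<open>D\<close>.\<close>

definition function_space ::
    "'x set \<Rightarrow> (('x \<Rightarrow> complex) \<Rightarrow> ('x \<Rightarrow> complex) \<Rightarrow> complex) \<Rightarrow> ('x \<Rightarrow> complex) set \<Rightarrow>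
     ('x \<Rightarrow> complex) hilbert" where
  "function_space D ip V = \<lparr>carrier = V,
     mult = undefined, one = undefined,
     zero = (\<lambda>x\<in>D. 0),
     add = (\<lambda>f g. \<lambda>x\<in>D. f x + g x),
     smult = (\<lambda>c f. \<lambda>x\<in>D. c * f x),
     cinner = ip\<rparr>"

definition adjoin_constants :: "'x set \<Rightarrow> ('x \<Rightarrow> complex) set \<Rightarrow> ('x \<Rightarrow> complex) set" where
  "adjoin_constants D V = {(\<lambda>x\<in>D. f x + c) | f c. f \<in> V}"

definition koopman :: "'x set \<Rightarrow> ('x \<Rightarrow> 'x) \<Rightarrow> ('x \<Rightarrow> complex) \<Rightarrow> 'x \<Rightarrow> complex" where
  "koopman D T f = (\<lambda>x\<in>D. f (T x))"

end

theory Submission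
  imports Defs
begin

text \<open>
  Write \<open>E S = \<integral> dP\<^sub>\<omega> \<otimes> Q S\<^sub>\<omega>\<close>, where \<open>S\<^sub>\<omega>\<close> is the slice of \<open>S\<close> at \<open>\<omega>\<close>. As \<open>P\<close> is self-adjoint, the pieces
  of a vector over disjoint sets of \<open>\<omega>\<close> are orthogonal, so that \<open>E S\<close> is bounded by the bound of \<open>Q\<close>
  although \<open>Q\<close> need not be self-adjoint. The function \<open>\<omega> \<mapsto> Q S\<^sub>\<omega> g\<close> is strongly measurable for every
  measurable \<open>S\<close>, hence almost constant on the parts of a countable partition; this gives the
  existence, multiplicativity and countable additivity of \<open>E\<close>. The integral formula holds on elementary
  tensors, hence everywhere. The spectrum of a spectral integral is the essential range of the
  integrand, and the essential range of \<open>(\<omega>, z) \<mapsto> \<phi> \<omega> \<cdot> \<psi> z\<close> is the closure of the product of those of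
  \<open>\<phi>\<close> and \<open>\<psi>\<close> because \<open>E (X \<times> Y) = P X \<otimes> Q Y\<close> vanishes only if a factor does.
\<close>

section \<open>Complex Hilbert spaces\<close>

text \<open>The obstacle is a bound for \<open>E\<close> that is uniform over all measurable sets: a
  finite disjoint union of rectangles yields a sum of products of projections, and bounds on the
  single products do not control the sum, since no two values of \<open>Q\<close> need be
  orthogonal. Neither can a value of \<open>E\<close> be written down fibre by fibre: the tensor
  product is an abstract completion, and without separability there is no direct integral to
  evaluate at \<omega>. The fibrewise description is therefore replaced by an estimate: if
  \<open>Q\<close> of the slices of \<open>S\<close> over \<omega> in \<open>X\<close> moves
  \<open>g\<close> to within \<open>d\<close> of a fixed \<open>w\<close>, and
  \<open>P X f = f\<close>, then \<open>E S\<close> moves the tensor of \<open>f\<close> and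
  \<open>g\<close> to within \<open>d\<close> times the norm of \<open>f\<close> of the tensor of
  \<open>f\<close> and \<open>w\<close>. This estimate determines \<open>E S\<close> and survives
  complements, disjoint unions, intersections and limits, so that every identity for
  \<open>E\<close> reduces to one for slices. In the calculus for a single resolution, the missing
  orthogonality is replaced by the variation of the scalar measures, which is the source of the
  constant \<open>4 * bnd\<close>.\<close>

lemma complex_field_simps [simp]:
  "carrier complex_field = UNIV" "zero complex_field = 0" "one complex_field = 1"
  "add complex_field = (+)" "mult complex_field = (*)"
  by (simp_all add: complex_field_def)

lemma cring_complex_field: "cring complex_field"
proof (rule cringI)
  show "abelian_group complex_field"
  proof (rule abelian_groupI)
    fix x show "\<exists>y\<in>carrier complex_field. y \<oplus>\<^bsub>complex_field\<^esub> x = \<zero>\<^bsub>complex_field\<^esub>"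
      by (auto intro: exI[of _ "-x"])
  qed (auto simp: algebra_simps)
  show "comm_monoid complex_field"
    by (rule comm_monoidI) (auto simp: algebra_simps)
qed (auto simp: algebra_simps)

context complex_hilbert_space
begin

lemma scaled_closed [simp, intro]: "x \<in> carrier H \<Longrightarrow> c \<odot> x \<in> carrier H"
  by (rule smult_closed) simp_all

section \<open>Inner product and norm\<close>

lemma cinner_add_right:
  assumes "x \<in> carrier H" "y \<in> carrier H" "z \<in> carrier H"
  shows "cinner H z (x \<oplus> y) = cinner H z x + cinner H z y"
proof -
  have "cinner H z (x \<oplus> y) = cnj (cinner H (x \<oplus> y) z)"
    using assms by (intro cinner_commute) auto
  also have "\<dots> = cinner H z x + cinner H z y"
    using assms cinner_commute[of x z] cinner_commute[of y z] by (simp add: cinner_add_left)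
  finally show ?thesis .
qed

lemma cinner_smult_right:
  assumes "x \<in> carrier H" "y \<in> carrier H"
  shows "cinner H x (c \<odot> y) = cnj c * cinner H x y"
proof -
  have "cinner H x (c \<odot> y) = cnj (cinner H (c \<odot> y) x)"
    using assms by (intro cinner_commute) auto
  then show ?thesis using assms cinner_commute[of y x] by (simp add: cinner_smult_left)
qed

lemma cinner_zero_left: "x \<in> carrier H \<Longrightarrow> cinner H \<zero> x = 0"
  using cinner_add_left[of \<zero> \<zero> x] by simp

lemma cinner_zero_right: "x \<in> carrier H \<Longrightarrow> cinner H x \<zero> = 0"
  using cinner_add_right[of \<zero> \<zero> x] by simp

lemma cinner_uminus_left: "\<lbrakk>x \<in> carrier H; y \<in> carrier H\<rbrakk> \<Longrightarrow> cinner H (\<ominus> x) y = - cinner H x y"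
  using cinner_add_left[of "\<ominus> x" x y] by (simp add: l_neg cinner_zero_left eq_neg_iff_add_eq_0)

lemma cinner_uminus_right: "\<lbrakk>x \<in> carrier H; y \<in> carrier H\<rbrakk> \<Longrightarrow> cinner H y (\<ominus> x) = - cinner H y x"
  using cinner_add_right[of "\<ominus> x" x y] by (simp add: l_neg cinner_zero_right eq_neg_iff_add_eq_0)

lemma cinner_diff_left:
  "\<lbrakk>x \<in> carrier H; y \<in> carrier H; z \<in> carrier H\<rbrakk> \<Longrightarrow> cinner H (x \<ominus> y) z = cinner H x z - cinner H y z"
  by (simp add: a_minus_def cinner_add_left cinner_uminus_left)

lemma cinner_diff_right:
  "\<lbrakk>x \<in> carrier H; y \<in> carrier H; z \<in> carrier H\<rbrakk> \<Longrightarrow> cinner H z (x \<ominus> y) = cinner H z x - cinner H z y"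
  by (simp add: a_minus_def cinner_add_right cinner_uminus_right)

lemma cinner_finsum_left:
  assumes "finite I" "\<And>i. i \<in> I \<Longrightarrow> f i \<in> carrier H" "y \<in> carrier H"
  shows "cinner H (\<Oplus>i\<in>I. f i) y = (\<Sum>i\<in>I. cinner H (f i) y)"
  using assms
proof (induction I rule: finite_induct)
  case empty then show ?case by (simp add: cinner_zero_left)
next
  case (insert i I)
  have "(\<Oplus>i\<in>insert i I. f i) = f i \<oplus> (\<Oplus>i\<in>I. f i)"
    using insert by (intro finsum_insert) auto
  moreover have "(\<Oplus>i\<in>I. f i) \<in> carrier H"
    using insert by (intro finsum_closed) auto
  ultimately show ?case using insert by (simp add: cinner_add_left)
qed

lemmas cinner_simps = cinner_add_left cinner_add_right cinner_smult_left cinner_smult_right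
  cinner_zero_left cinner_zero_right cinner_uminus_left cinner_uminus_right
  cinner_diff_left cinner_diff_right

lemma cinner_self_zeroD: "x \<in> carrier H \<Longrightarrow> Re (cinner H x x) = 0 \<Longrightarrow> x = \<zero>"
  using cinner_pos[of x] by force

lemma cinner_self_nonneg: "x \<in> carrier H \<Longrightarrow> 0 \<le> Re (cinner H x x)"
  using cinner_pos[of x] by (cases "x = \<zero>") (auto simp: cinner_zero_left)

lemma diff_self [simp]: "x \<in> carrier H \<Longrightarrow> x \<ominus> x = \<zero>"
  by (simp add: a_minus_def r_neg)

lemma diff_zero [simp]: "x \<in> carrier H \<Longrightarrow> x \<ominus> \<zero> = x"
  by (simp add: a_minus_def)

lemma r_right_minus_eq: "\<lbrakk>x \<in> carrier H; y \<in> carrier H\<rbrakk> \<Longrightarrow> x \<ominus> y = \<zero> \<longleftrightarrow> x = y"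
  by (metis a_minus_def a_inv_closed minus_equality minus_minus r_neg)

text \<open>Definiteness of the inner product. It turns an identity of vectors into one of complex
  numbers, which \<open>cinner_simps\<close> normalises; most rearrangements of
  \<open>\<oplus>\<close> and \<open>\<ominus>\<close> below go this way.\<close>

lemma vector_eqI:
  assumes "x \<in> carrier H" "y \<in> carrier H" "\<And>z. z \<in> carrier H \<Longrightarrow> cinner H x z = cinner H y z"
  shows "x = y"
proof -
  have "cinner H (x \<ominus> y) (x \<ominus> y) = 0"
    using assms by (simp add: cinner_diff_left)
  then have "x \<ominus> y = \<zero>" using assms by (intro cinner_self_zeroD) auto
  then show ?thesis using assms by (simp add: r_right_minus_eq)
qed

lemma cinner_self: "x \<in> carrier H \<Longrightarrow> cinner H x x = complex_of_real ((hnorm H x)\<^sup>2)"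
  using cinner_commute[of x x] cinner_self_nonneg[of x]
  by (auto simp: hnorm_def complex_eq_iff)

lemma hnorm_sq: "x \<in> carrier H \<Longrightarrow> (hnorm H x)\<^sup>2 = Re (cinner H x x)"
  by (simp add: cinner_self)

lemma hnorm_nonneg [simp]: "x \<in> carrier H \<Longrightarrow> 0 \<le> hnorm H x"
  by (simp add: hnorm_def cinner_self_nonneg)

lemma hnorm_zero [simp]: "hnorm H \<zero> = 0"
  by (simp add: hnorm_def cinner_zero_left)

lemma hnorm_eq_zero_iff: "x \<in> carrier H \<Longrightarrow> hnorm H x = 0 \<longleftrightarrow> x = \<zero>"
  using hnorm_sq[of x] cinner_self_zeroD[of x] by auto

lemma hnorm_smult: 
  assumes "x \<in> carrier H" shows "hnorm H (c \<odot> x) = cmod c * hnorm H x"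
proof -
  have "cinner H (c \<odot> x) (c \<odot> x) = (c * cnj c) * cinner H x x"
    using assms by (simp add: cinner_simps)
  also have "\<dots> = complex_of_real ((cmod c)\<^sup>2 * (hnorm H x)\<^sup>2)"
    unfolding cinner_self[OF assms] complex_norm_square[symmetric] by simp
  finally have "(hnorm H (c \<odot> x))\<^sup>2 = (cmod c * hnorm H x)\<^sup>2"
    using assms by (simp only: hnorm_sq scaled_closed power_mult_distrib Re_complex_of_real)
  then show ?thesis using assms by (simp add: power2_eq_iff_nonneg)
qed

lemma hnorm_uminus [simp]: "x \<in> carrier H \<Longrightarrow> hnorm H (\<ominus> x) = hnorm H x"
  by (simp add: hnorm_def cinner_simps)

lemma hnorm_diff_commute: "x \<in> carrier H \<Longrightarrow> y \<in> carrier H \<Longrightarrow> hnorm H (x \<ominus> y) = hnorm H (y \<ominus> x)"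
  by (simp add: hnorm_def cinner_simps algebra_simps)

lemma cauchy_schwarz:
  assumes x: "x \<in> carrier H" and y: "y \<in> carrier H"
  shows "cmod (cinner H x y) \<le> hnorm H x * hnorm H y"
proof (cases "y = \<zero>")
  case True then show ?thesis using x by (simp add: cinner_zero_right)
next
  case False
  define a where "a = cinner H x y"
  define n where "n = (hnorm H y)\<^sup>2"
  have n: "n > 0" "cinner H y y = of_real n"
    using False y cinner_pos[of y] by (simp_all add: n_def cinner_self)
  \<comment> \<open>The component of \<open>x\<close> orthogonal to \<open>y\<close>; expanding its
    nonnegative squared norm gives the inequality.\<close>
  define z where "z = x \<ominus> (a / n) \<odot> y"
  have "0 \<le> Re (cinner H z z)" using x y by (intro cinner_self_nonneg) (auto simp: z_def)
  also have "cinner H z z = complex_of_real ((hnorm H x)\<^sup>2 - (cmod a)\<^sup>2 / n)"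
  proof -
    have "cinner H y x = cnj a" using cinner_commute[OF x y] by (simp add: a_def)
    then have "cinner H z z = of_real ((hnorm H x)\<^sup>2) - cnj (a/n) * a - (a/n) * cnj a + (a/n) * cnj (a/n) * n"
      using x y n by (simp add: z_def cinner_simps cinner_self[of x] flip: a_def)
    also have "\<dots> = of_real ((hnorm H x)\<^sup>2) - (a * cnj a) / n"
      using n by (simp add: field_simps)
    finally show ?thesis by (simp flip: complex_norm_square)
  qed
  finally have "(cmod a)\<^sup>2 \<le> (hnorm H x)\<^sup>2 * n" using n by (simp add: field_simps)
  then have "(cmod a)\<^sup>2 \<le> (hnorm H x * hnorm H y)\<^sup>2" by (simp add: n_def power_mult_distrib)
  then show ?thesis unfolding a_def by (rule power2_le_imp_le) (use x y in simp)
qed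

lemma hnorm_sq_add:
  assumes "x \<in> carrier H" "y \<in> carrier H"
  shows "(hnorm H (x \<oplus> y))\<^sup>2 = (hnorm H x)\<^sup>2 + 2 * Re (cinner H x y) + (hnorm H y)\<^sup>2"
  using assms cinner_commute[of x y] by (simp add: hnorm_sq cinner_simps)

lemma pythagoras:
  assumes "x \<in> carrier H" "y \<in> carrier H" "cinner H x y = 0"
  shows "(hnorm H (x \<oplus> y))\<^sup>2 = (hnorm H x)\<^sup>2 + (hnorm H y)\<^sup>2"
  using assms by (simp add: hnorm_sq_add)

lemma hnorm_triangle:
  assumes "x \<in> carrier H" "y \<in> carrier H"
  shows "hnorm H (x \<oplus> y) \<le> hnorm H x + hnorm H y"
proof (rule power2_le_imp_le)
  have "Re (cinner H x y) \<le> hnorm H x * hnorm H y"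
    using cauchy_schwarz[OF assms] complex_Re_le_cmod[of "cinner H x y"] by linarith
  then show "(hnorm H (x \<oplus> y))\<^sup>2 \<le> (hnorm H x + hnorm H y)\<^sup>2"
    using assms by (simp add: hnorm_sq_add power2_sum)
qed (use assms in simp)

lemma hnorm_triangle_le:
  "\<lbrakk>x \<in> carrier H; y \<in> carrier H; hnorm H x \<le> a; hnorm H y \<le> b\<rbrakk> \<Longrightarrow> hnorm H (x \<oplus> y) \<le> a + b"
  using hnorm_triangle[of x y] by linarith

lemma diff_split:
  assumes "x \<in> carrier H" "y \<in> carrier H" "z \<in> carrier H"
  shows "x \<ominus> z = (x \<ominus> y) \<oplus> (y \<ominus> z)"
  using assms by (intro vector_eqI) (auto simp: cinner_simps)

lemma hnorm_dist_triangle: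
  assumes "x \<in> carrier H" "y \<in> carrier H" "z \<in> carrier H"
  shows "hnorm H (x \<ominus> z) \<le> hnorm H (x \<ominus> y) + hnorm H (y \<ominus> z)"
  using hnorm_triangle[of "x \<ominus> y" "y \<ominus> z"] assms by (simp add: diff_split[of x y z])

lemma hnorm_dist_le:
  assumes "x \<in> carrier H" "y \<in> carrier H" "z \<in> carrier H"
    "hnorm H (x \<ominus> y) \<le> a" "hnorm H (y \<ominus> z) \<le> b"
  shows "hnorm H (x \<ominus> z) \<le> a + b"
  using hnorm_dist_triangle[of x y z] assms by linarith

lemma hnorm_le_dist:
  assumes "x \<in> carrier H" "y \<in> carrier H"
  shows "hnorm H x \<le> hnorm H (x \<ominus> y) + hnorm H y"
  using hnorm_dist_triangle[of x y \<zero>] assms by simp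

lemma hnorm_diff_abs:
  assumes "x \<in> carrier H" "y \<in> carrier H"
  shows "\<bar>hnorm H x - hnorm H y\<bar> \<le> hnorm H (x \<ominus> y)"
  using hnorm_le_dist[of x y] hnorm_le_dist[of y x] hnorm_diff_commute[of x y] assms by linarith

lemma eq_if_dist_le:
  assumes "x \<in> carrier H" "y \<in> carrier H" "\<And>e. e > 0 \<Longrightarrow> hnorm H (x \<ominus> y) \<le> e"
  shows "x = y"
proof -
  have "hnorm H (x \<ominus> y) \<le> 0" using assms(3) by (rule field_le_epsilon) simp
  then have "hnorm H (x \<ominus> y) = 0" using assms by (intro antisym) auto
  then show ?thesis using assms by (simp add: hnorm_eq_zero_iff r_right_minus_eq)
qed

section \<open>Convergent and Cauchy sequences\<close>

lemma hlimit_const: "x \<in> carrier H \<Longrightarrow> hlimit H (\<lambda>n. x) x"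
  by (simp add: hlimit_def)

lemma hlimit_Suc: "hlimit H X l \<Longrightarrow> hlimit H (\<lambda>n. X (Suc n)) l"
  unfolding hlimit_def by (rule LIMSEQ_Suc)

text \<open>Norm convergence implies weak convergence by Cauchy-Schwarz. Uniqueness and linearity of
  limits are then read off from scalar sequences.\<close>

lemma hlimit_cinner:
  assumes "\<And>n. X n \<in> carrier H" "l \<in> carrier H" "hlimit H X l" "y \<in> carrier H"
  shows "(\<lambda>n. cinner H (X n) y) \<longlonglongrightarrow> cinner H l y"
proof (rule Lim_transform2[OF tendsto_const])
  have "(\<lambda>n. hnorm H (X n \<ominus> l) * hnorm H y) \<longlonglongrightarrow> 0 * hnorm H y"
    using assms(3) unfolding hlimit_def by (intro tendsto_intros)
  then have lim: "(\<lambda>n. hnorm H (X n \<ominus> l) * hnorm H y) \<longlonglongrightarrow> 0" by simp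
  have "norm (cinner H l y - cinner H (X n) y) \<le> hnorm H (X n \<ominus> l) * hnorm H y" for n
    using cauchy_schwarz[of "X n \<ominus> l" y] assms by (simp add: cinner_diff_left norm_minus_commute)
  then show "(\<lambda>n. cinner H l y - cinner H (X n) y) \<longlonglongrightarrow> 0"
    by (intro Lim_null_comparison[OF always_eventually lim]) simp
qed

lemma hlimit_hnorm:
  assumes "\<And>n. X n \<in> carrier H" "l \<in> carrier H" "hlimit H X l"
  shows "(\<lambda>n. hnorm H (X n)) \<longlonglongrightarrow> hnorm H l"
proof (rule Lim_transform2[OF tendsto_const])
  have "norm (hnorm H l - hnorm H (X n)) \<le> hnorm H (X n \<ominus> l)" for n
    using hnorm_diff_abs[of "X n" l] assms(1,2) by (simp add: abs_minus_commute)
  then show "(\<lambda>n. hnorm H l - hnorm H (X n)) \<longlonglongrightarrow> 0"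
    by (intro Lim_null_comparison[OF always_eventually assms(3)[unfolded hlimit_def]]) simp
qed

lemma hlimit_hnorm_le:
  assumes "\<And>n. X n \<in> carrier H" "l \<in> carrier H" "hlimit H X l" "\<And>n. n \<ge> n0 \<Longrightarrow> hnorm H (X n) \<le> B"
  shows "hnorm H l \<le> B"
  using hlimit_hnorm[OF assms(1-3)] assms(4) by (intro LIMSEQ_le_const2) auto

lemma hlimit_unique:
  assumes "\<And>n. X n \<in> carrier H" "l \<in> carrier H" "l' \<in> carrier H" "hlimit H X l" "hlimit H X l'"
  shows "l = l'"
  using assms hlimit_cinner[of X] by (intro vector_eqI) (auto intro: LIMSEQ_unique)

lemma hlimitD:
  assumes "hlimit H X l" "e > 0"
  shows "\<exists>N. \<forall>n\<ge>N. hnorm H (X n \<ominus> l) < e"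
  using LIMSEQ_D[OF assms[unfolded hlimit_def]] by force

lemma hlimit_add:
  assumes "\<And>n. X n \<in> carrier H" "\<And>n. Y n \<in> carrier H" "l \<in> carrier H" "m \<in> carrier H"
    "hlimit H X l" "hlimit H Y m"
  shows "hlimit H (\<lambda>n. X n \<oplus> Y n) (l \<oplus> m)"
  unfolding hlimit_def
proof (rule Lim_null_comparison)
  have "(X n \<oplus> Y n) \<ominus> (l \<oplus> m) = (X n \<ominus> l) \<oplus> (Y n \<ominus> m)" for n
    using assms by (intro vector_eqI) (auto simp: cinner_simps)
  then show "\<forall>\<^sub>F n in sequentially. norm (hnorm H ((X n \<oplus> Y n) \<ominus> (l \<oplus> m)))
      \<le> hnorm H (X n \<ominus> l) + hnorm H (Y n \<ominus> m)"
    using assms by (auto intro!: always_eventually hnorm_triangle)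
  show "(\<lambda>n. hnorm H (X n \<ominus> l) + hnorm H (Y n \<ominus> m)) \<longlonglongrightarrow> 0"
    using tendsto_add[OF assms(5,6)[unfolded hlimit_def]] by simp
qed

lemma cauchy_hlimit:
  assumes "\<And>n. X n \<in> carrier H" "\<And>e. e > 0 \<Longrightarrow> \<exists>N. \<forall>m\<ge>N. \<forall>n\<ge>N. hnorm H (X m \<ominus> X n) \<le> e"
  obtains l where "l \<in> carrier H" "hlimit H X l"
proof -
  have "\<exists>l\<in>carrier H. hlimit H X l"
  proof (rule complete[OF assms(1)])
    fix e :: real assume "e > 0"
    then obtain N where "\<forall>m\<ge>N. \<forall>n\<ge>N. hnorm H (X m \<ominus> X n) \<le> e/2" using assms(2)[of "e/2"] by auto
    then show "\<exists>N. \<forall>m\<ge>N. \<forall>n\<ge>N. hnorm H (X m \<ominus> X n) < e"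
      using \<open>e > 0\<close> by (intro exI[of _ N]) force
  qed
  then show ?thesis using that by auto
qed

lemma hlimit_cauchy:
  assumes "\<And>n. X n \<in> carrier H" "l \<in> carrier H" "hlimit H X l" "e > 0"
  shows "\<exists>N. \<forall>m\<ge>N. \<forall>n\<ge>N. hnorm H (X m \<ominus> X n) \<le> e"
proof -
  obtain N where N: "\<And>n. n \<ge> N \<Longrightarrow> hnorm H (X n \<ominus> l) < e/2"
    using hlimitD[OF assms(3), of "e/2"] assms(4) by auto
  have "hnorm H (X m \<ominus> X n) \<le> e/2 + e/2" if "m \<ge> N" "n \<ge> N" for m n
    using N[OF that(1)] N[OF that(2)] assms hnorm_diff_commute[of "X n" l]
    by (intro hnorm_dist_le[of _ l]) auto
  then show ?thesis by auto
qed

lemma scaled_one [simp]: "x \<in> carrier H \<Longrightarrow> 1 \<odot> x = x"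
  by (intro vector_eqI) (auto simp: cinner_simps)

lemma scaled_zero [simp]: "x \<in> carrier H \<Longrightarrow> 0 \<odot> x = \<zero>"
  by (intro vector_eqI) (auto simp: cinner_simps)

section \<open>Bounded operators\<close>

lemma bounded_operator_closed: "bounded_operator H T \<Longrightarrow> x \<in> carrier H \<Longrightarrow> T x \<in> carrier H"
  by (auto simp: bounded_operator_def)

lemma bounded_operator_add:
  "\<lbrakk>bounded_operator H T; x \<in> carrier H; y \<in> carrier H\<rbrakk> \<Longrightarrow> T (x \<oplus> y) = T x \<oplus> T y"
  by (auto simp: bounded_operator_def)

lemma bounded_operator_smult:
  "\<lbrakk>bounded_operator H T; x \<in> carrier H\<rbrakk> \<Longrightarrow> T (c \<odot> x) = c \<odot> T x"
  by (auto simp: bounded_operator_def)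

lemma uminus_eq_smult: "x \<in> carrier H \<Longrightarrow> \<ominus> x = (-1) \<odot> x"
  by (intro vector_eqI) (auto simp: cinner_simps)

lemma bounded_operator_diff:
  "\<lbrakk>bounded_operator H T; x \<in> carrier H; y \<in> carrier H\<rbrakk> \<Longrightarrow> T (x \<ominus> y) = T x \<ominus> T y"
  by (simp add: a_minus_def uminus_eq_smult bounded_operator_add bounded_operator_smult bounded_operator_closed)

lemma bounded_operator_zero: "bounded_operator H T \<Longrightarrow> T \<zero> = \<zero>"
  using bounded_operator_diff[of T \<zero> \<zero>] by (simp add: bounded_operator_closed)

lemma bounded_operator_finsum:
  assumes "bounded_operator H T" "finite I" "\<And>i. i \<in> I \<Longrightarrow> f i \<in> carrier H"
  shows "T (\<Oplus>i\<in>I. f i) = (\<Oplus>i\<in>I. T (f i))"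
  using assms(2,3)
proof (induction I rule: finite_induct)
  case empty then show ?case by (simp add: bounded_operator_zero assms)
next
  case (insert i I)
  then have *: "f \<in> I \<rightarrow> carrier H" "f i \<in> carrier H" "(\<lambda>i. T (f i)) \<in> I \<rightarrow> carrier H" "T (f i) \<in> carrier H"
    using bounded_operator_closed[OF assms(1)] by auto
  then show ?case
    using insert by (simp add: finsum_insert[OF insert(1,2)] bounded_operator_add[OF assms(1)] finsum_closed)
qed

text \<open>The constant in \<open>bounded_operator\<close> need not be positive; a positive one can
  be divided by and multiplied into inequalities.\<close>

lemma bounded_operator_bound:
  assumes "bounded_operator H T"
  obtains C where "C > 0" "\<And>x. x \<in> carrier H \<Longrightarrow> hnorm H (T x) \<le> C * hnorm H x"
proof -
  obtain C where C: "\<And>x. x \<in> carrier H \<Longrightarrow> hnorm H (T x) \<le> C * hnorm H x"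
    using assms unfolding bounded_operator_def by metis
  have "hnorm H (T x) \<le> (\<bar>C\<bar> + 1) * hnorm H x" if "x \<in> carrier H" for x
    using C[OF that] that by (elim order_trans) (intro mult_right_mono, auto)
  then show ?thesis by (rule that[of "\<bar>C\<bar> + 1", rotated]) auto
qed

lemma bounded_operatorI:
  assumes "\<And>x. x \<in> carrier H \<Longrightarrow> T x \<in> carrier H"
    "\<And>x y. \<lbrakk>x \<in> carrier H; y \<in> carrier H\<rbrakk> \<Longrightarrow> T (x \<oplus> y) = T x \<oplus> T y"
    "\<And>c x. x \<in> carrier H \<Longrightarrow> T (c \<odot> x) = c \<odot> T x"
    "\<And>x. x \<in> carrier H \<Longrightarrow> hnorm H (T x) \<le> C * hnorm H x"
  shows "bounded_operator H T"
  unfolding bounded_operator_def using assms by (intro conjI exI[of _ C]) auto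

lemma bounded_operator_hlimit:
  assumes "bounded_operator H T" "\<And>n. X n \<in> carrier H" "l \<in> carrier H" "hlimit H X l"
  shows "hlimit H (\<lambda>n. T (X n)) (T l)"
proof -
  obtain C where C: "C > 0" "\<And>x. x \<in> carrier H \<Longrightarrow> hnorm H (T x) \<le> C * hnorm H x"
    using bounded_operator_bound[OF assms(1)] by blast
  have "(\<lambda>n. C * hnorm H (X n \<ominus> l)) \<longlonglongrightarrow> C * 0"
    using assms(4) unfolding hlimit_def by (intro tendsto_intros)
  then have lim: "(\<lambda>n. C * hnorm H (X n \<ominus> l)) \<longlonglongrightarrow> 0" by simp
  have "norm (hnorm H (T (X n) \<ominus> T l)) \<le> C * hnorm H (X n \<ominus> l)" for n
    using C(2)[of "X n \<ominus> l"] assms by (simp add: bounded_operator_closed bounded_operator_diff)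
  then show ?thesis unfolding hlimit_def by (intro Lim_null_comparison[OF always_eventually lim]) simp
qed

lemma bounded_operator_comp:
  assumes "bounded_operator H S" "bounded_operator H T"
  shows "bounded_operator H (\<lambda>x. S (T x))"
proof -
  obtain C D where C: "C > 0" "\<And>x. x \<in> carrier H \<Longrightarrow> hnorm H (S x) \<le> C * hnorm H x"
    and D: "\<And>x. x \<in> carrier H \<Longrightarrow> hnorm H (T x) \<le> D * hnorm H x"
    using bounded_operator_bound assms by metis
  show ?thesis
  proof (rule bounded_operatorI[where C="C * D"])
    fix x assume x: "x \<in> carrier H"
    then have "hnorm H (S (T x)) \<le> C * hnorm H (T x)"
      using C assms by (auto simp: bounded_operator_closed)
    also have "\<dots> \<le> C * (D * hnorm H x)" using C D x by (intro mult_left_mono) auto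
    finally show "hnorm H (S (T x)) \<le> C * D * hnorm H x" by simp
  qed (use assms in \<open>auto simp: bounded_operator_closed bounded_operator_add bounded_operator_smult\<close>)
qed

lemma bounded_operator_sum:
  assumes "bounded_operator H S" "bounded_operator H T"
  shows "bounded_operator H (\<lambda>x. S x \<oplus> T x)"
proof -
  obtain C D where C: "C > 0" "\<And>x. x \<in> carrier H \<Longrightarrow> hnorm H (S x) \<le> C * hnorm H x"
    and D: "\<And>x. x \<in> carrier H \<Longrightarrow> hnorm H (T x) \<le> D * hnorm H x"
    using bounded_operator_bound assms by metis
  note [simp] = bounded_operator_closed[OF assms(1)] bounded_operator_closed[OF assms(2)]
  show ?thesis
  proof (rule bounded_operatorI[where C="C + D"])
    fix x assume x: "x \<in> carrier H"
    then show "hnorm H (S x \<oplus> T x) \<le> (C + D) * hnorm H x"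
      using hnorm_triangle_le[OF _ _ C(2) D, of x x] by (simp add: algebra_simps)
  qed (use assms in \<open>auto simp: bounded_operator_add bounded_operator_smult a_ac smult_r_distr\<close>)
qed

lemma bounded_operator_scale:
  assumes "bounded_operator H T"
  shows "bounded_operator H (\<lambda>x. c \<odot> T x)"
proof -
  obtain D where D: "D > 0" "\<And>x. x \<in> carrier H \<Longrightarrow> hnorm H (T x) \<le> D * hnorm H x"
    using bounded_operator_bound assms by metis
  note [simp] = bounded_operator_closed[OF assms(1)]
  show ?thesis
  proof (rule bounded_operatorI[where C="cmod c * D"])
    fix x assume x: "x \<in> carrier H"
    then show "hnorm H (c \<odot> T x) \<le> cmod c * D * hnorm H x"
      using D(2)[OF x] by (simp add: hnorm_smult mult_left_mono mult.assoc)
  next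
    fix d x assume "x \<in> carrier H"
    then show "c \<odot> T (d \<odot> x) = d \<odot> (c \<odot> T x)"
      by (intro vector_eqI) (auto simp: cinner_simps bounded_operator_smult[OF assms])
  qed (use assms in \<open>auto simp: bounded_operator_add bounded_operator_smult smult_r_distr\<close>)
qed

lemma bounded_operator_id: "bounded_operator H (\<lambda>x. x)"
  by (rule bounded_operatorI[where C=1]) auto

lemma bounded_operator_cong:
  assumes "bounded_operator H S" "\<And>x. x \<in> carrier H \<Longrightarrow> S x = T x"
  shows "bounded_operator H T"
proof -
  obtain C where C: "C > 0" "\<And>x. x \<in> carrier H \<Longrightarrow> hnorm H (S x) \<le> C * hnorm H x"
    using bounded_operator_bound[OF assms(1)] by blast
  show ?thesis
    using bounded_operator_closed[OF assms(1)] bounded_operator_add[OF assms(1)] bounded_operator_smult[OF assms(1)] assms(2) C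
    by (intro bounded_operatorI[of T C]) force+
qed

lemma bounded_operator_difference:
  assumes "bounded_operator H S" "bounded_operator H T"
  shows "bounded_operator H (\<lambda>x. S x \<ominus> T x)"
  by (rule bounded_operator_cong[OF bounded_operator_sum[OF assms(1) bounded_operator_scale[OF assms(2), of "-1"]]])
    (use assms bounded_operator_closed in \<open>simp add: a_minus_def uminus_eq_smult\<close>)

text \<open>Linearity is tested against a vector \<open>z\<close>, where it is uniqueness of limits
  of complex sequences; the bound passes to the limit because the norm is continuous.\<close>

lemma bounded_operator_limit:
  assumes T: "\<And>n::nat. bounded_operator H (T n)"
    and bound: "\<And>n x. x \<in> carrier H \<Longrightarrow> hnorm H (T n x) \<le> K * hnorm H x"
    and lim: "\<And>x. x \<in> carrier H \<Longrightarrow> T' x \<in> carrier H" "\<And>x. x \<in> carrier H \<Longrightarrow> hlimit H (\<lambda>n. T n x) (T' x)"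
  shows "bounded_operator H T'" and "\<And>x. x \<in> carrier H \<Longrightarrow> hnorm H (T' x) \<le> K * hnorm H x"
proof -
  note [simp] = bounded_operator_closed[OF T] lim(1)
  show *: "hnorm H (T' x) \<le> K * hnorm H x" if "x \<in> carrier H" for x
    using that by (intro hlimit_hnorm_le[OF _ _ lim(2)[OF that], of 0]) (auto intro: bound)
  show "bounded_operator H T'"
  proof (rule bounded_operatorI[where C=K])
    fix x y assume x: "x \<in> carrier H" and y: "y \<in> carrier H"
    show "T' (x \<oplus> y) = T' x \<oplus> T' y"
    proof (rule vector_eqI)
      fix z assume z: "z \<in> carrier H"
      have "(\<lambda>n. cinner H (T n (x \<oplus> y)) z) \<longlonglongrightarrow> cinner H (T' (x \<oplus> y)) z"
        using x y z by (intro hlimit_cinner lim) auto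
      moreover have "(\<lambda>n. cinner H (T n x) z + cinner H (T n y) z) \<longlonglongrightarrow> cinner H (T' x) z + cinner H (T' y) z"
        using x y z by (intro tendsto_add hlimit_cinner lim) auto
      ultimately show "cinner H (T' (x \<oplus> y)) z = cinner H (T' x \<oplus> T' y) z"
        using x y z by (simp add: bounded_operator_add[OF T] cinner_add_left LIMSEQ_unique)
    qed (use x y in auto)
  next
    fix c x assume x: "x \<in> carrier H"
    show "T' (c \<odot> x) = c \<odot> T' x"
    proof (rule vector_eqI)
      fix z assume z: "z \<in> carrier H"
      have "(\<lambda>n. cinner H (T n (c \<odot> x)) z) \<longlonglongrightarrow> cinner H (T' (c \<odot> x)) z"
        using x z by (intro hlimit_cinner lim) auto
      moreover have "(\<lambda>n. c * cinner H (T n x) z) \<longlonglongrightarrow> c * cinner H (T' x) z"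
        using x z by (intro tendsto_mult tendsto_const hlimit_cinner lim) auto
      ultimately show "cinner H (T' (c \<odot> x)) z = cinner H (c \<odot> T' x) z"
        using x z by (simp add: bounded_operator_smult[OF T] cinner_smult_left LIMSEQ_unique)
    qed (use x in auto)
  qed (use * in auto)
qed

lemma closed_subspaceI:
  assumes "W \<subseteq> carrier H" "\<zero> \<in> W" "\<And>x y. \<lbrakk>x \<in> W; y \<in> W\<rbrakk> \<Longrightarrow> x \<oplus> y \<in> W"
    "\<And>c x. x \<in> W \<Longrightarrow> c \<odot> x \<in> W"
    "\<And>X l. \<lbrakk>\<And>n::nat. X n \<in> W; l \<in> carrier H; hlimit H X l\<rbrakk> \<Longrightarrow> l \<in> W"
  shows "closed_subspace H W"
  unfolding closed_subspace_def
proof (intro conjI allI ballI impI)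
  show "submodule W complex_field H"
  proof (rule submoduleI)
    fix a assume "a \<in> W" then show "\<ominus> a \<in> W"
      using assms(1,4) by (subst uminus_eq_smult) auto
  qed (use assms in auto)
next
  fix X :: "nat \<Rightarrow> 'v" and l assume "l \<in> carrier H" "range X \<subseteq> W" "hlimit H X l"
  then show "l \<in> W" by (intro assms(5)[of X l]) auto
qed

end

section \<open>Resolutions of the identity\<close>

locale spectral_measure = complex_hilbert_space H
  for H :: "('v, 'm) hilbert_scheme" (structure) +
  fixes M :: "'s measure" and E :: "'s set \<Rightarrow> 'v \<Rightarrow> 'v"
  assumes resolution: "resolution_of_identity H M E"
begin

lemma E_operator: "S \<in> sets M \<Longrightarrow> bounded_operator H (E S)"
  using resolution unfolding resolution_of_identity_def by blast

lemma E_closed [simp, intro]: "S \<in> sets M \<Longrightarrow> x \<in> carrier H \<Longrightarrow> E S x \<in> carrier H"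
  using E_operator bounded_operator_closed by blast

lemma E_space [simp]: "x \<in> carrier H \<Longrightarrow> E (space M) x = x"
  using resolution unfolding resolution_of_identity_def by blast

lemma E_inter: "\<lbrakk>S \<in> sets M; S' \<in> sets M; x \<in> carrier H\<rbrakk> \<Longrightarrow> E (S \<inter> S') x = E S (E S' x)"
  using resolution unfolding resolution_of_identity_def by blast

lemma E_idem [simp]: "\<lbrakk>S \<in> sets M; x \<in> carrier H\<rbrakk> \<Longrightarrow> E S (E S x) = E S x"
  using E_inter[of S S x] by simp

lemma E_subset: "\<lbrakk>S \<in> sets M; S' \<in> sets M; S \<subseteq> S'; x \<in> carrier H\<rbrakk> \<Longrightarrow> E S (E S' x) = E S x"
  using E_inter[of S S' x] by (simp add: Int_absorb2)

lemma E_countably_additive: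
  fixes S :: "nat \<Rightarrow> 's set"
  assumes "\<And>i. S i \<in> sets M" "disjoint_family S" "x \<in> carrier H"
  shows "hlimit H (\<lambda>n. \<Oplus>i\<in>{..<n}. E (S i) x) (E (\<Union>i. S i) x)"
  using resolution assms unfolding resolution_of_identity_def by blast

text \<open>Some positive uniform bound, fixed so that later constants can refer to it; it is not
  claimed to be the least one.\<close>

definition bnd :: real where
  "bnd = (SOME C. C > 0 \<and> (\<forall>S\<in>sets M. \<forall>x\<in>carrier H. hnorm H (E S x) \<le> C * hnorm H x))"

lemma bnd_pos: "bnd > 0"
  and E_bound: "\<And>S x. \<lbrakk>S \<in> sets M; x \<in> carrier H\<rbrakk> \<Longrightarrow> hnorm H (E S x) \<le> bnd * hnorm H x"
proof -
  obtain C where C: "\<forall>S\<in>sets M. \<forall>x\<in>carrier H. hnorm H (E S x) \<le> C * hnorm H x"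
    using resolution unfolding resolution_of_identity_def by blast
  have "hnorm H (E S x) \<le> (\<bar>C\<bar> + 1) * hnorm H x" if "S \<in> sets M" "x \<in> carrier H" for S x
  proof -
    have "C * hnorm H x \<le> (\<bar>C\<bar> + 1) * hnorm H x" using that by (intro mult_right_mono) auto
    then show ?thesis using C that by fastforce
  qed
  then have "\<exists>C. C > 0 \<and> (\<forall>S\<in>sets M. \<forall>x\<in>carrier H. hnorm H (E S x) \<le> C * hnorm H x)"
    by (intro exI[of _ "\<bar>C\<bar> + 1"]) auto
  from someI_ex[OF this] show "bnd > 0"
    "\<And>S x. \<lbrakk>S \<in> sets M; x \<in> carrier H\<rbrakk> \<Longrightarrow> hnorm H (E S x) \<le> bnd * hnorm H x"
    unfolding bnd_def by blast+
qed

lemma finsum_lessThan_Suc: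
  assumes "\<And>i. f i \<in> carrier H"
  shows "(\<Oplus>i\<in>{..<Suc n}. f i) = (\<Oplus>i\<in>{..<n}. f i) \<oplus> f n"
  using assms finsum_closed[of f "{..<n}"] by (simp add: lessThan_Suc finsum_insert Pi_def a_comm)

text \<open>Countable additivity for the constant family of empty sets makes the partial sums
  converge, so their increments, which all equal \<open>E {} x\<close>, tend to zero.\<close>

lemma E_empty [simp]:
  assumes x: "x \<in> carrier H" shows "E {} x = \<zero>"
proof -
  have [simp]: "E {} x \<in> carrier H" using x by simp
  define F where "F = (\<lambda>n::nat. \<Oplus>i\<in>{..<n}. E {} x)"
  have F[simp]: "F n \<in> carrier H" for n unfolding F_def by (intro finsum_closed) simp
  have "hlimit H F (E {} x)"
    using E_countably_additive[of "\<lambda>i. {}" x] x by (simp add: F_def disjoint_family_on_def)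
  then have N: "\<exists>N. \<forall>m\<ge>N. \<forall>n\<ge>N. hnorm H (F m \<ominus> F n) \<le> e" if "e > 0" for e
    using that by (intro hlimit_cauchy[of F "E {} x"]) auto
  have "hnorm H (E {} x \<ominus> \<zero>) \<le> e" if "e > 0" for e
  proof -
    obtain n where n: "\<forall>m\<ge>n. \<forall>k\<ge>n. hnorm H (F m \<ominus> F k) \<le> e" using N[OF \<open>e > 0\<close>] by blast
    have "F (Suc n) = F n \<oplus> E {} x" unfolding F_def by (rule finsum_lessThan_Suc) simp
    then have "F (Suc n) \<ominus> F n = E {} x" 
      by (intro vector_eqI) (simp_all add: cinner_simps)
    moreover have "hnorm H (F (Suc n) \<ominus> F n) \<le> e" using n by (metis le_Suc_eq order_refl)
    ultimately show ?thesis by simp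
  qed
  then show ?thesis by (intro eq_if_dist_le) auto
qed

text \<open>\<open>resolution_of_identity\<close> speaks only of sequences, so the two sets are
  followed by empty ones; partial sums with at least two terms are then constant.\<close>

lemma E_union:
  assumes S: "S \<in> sets M" "S' \<in> sets M" "S \<inter> S' = {}" and x: "x \<in> carrier H"
  shows "E (S \<union> S') x = E S x \<oplus> E S' x"
proof -
  define B where "B = binaryset S S'"
  have B: "B i \<in> sets M" "disjoint_family B" for i
    using S by (auto simp: B_def binaryset_def disjoint_family_on_def)
  have [simp]: "E (B i) x \<in> carrier H" for i using B x by auto
  have sum: "(\<Oplus>i\<in>{..<Suc (Suc n)}. E (B i) x) = E S x \<oplus> E S' x" for n
  proof (induction n)
    case 0
    have "(\<Oplus>i\<in>{..<Suc (Suc 0)}. E (B i) x) = \<zero> \<oplus> E (B 0) x \<oplus> E (B (Suc 0)) x"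
      by (simp only: finsum_lessThan_Suc \<open>E (B _) x \<in> carrier H\<close>) simp
    then show ?case using S x by (simp add: B_def binaryset_def)
  next
    case (Suc n)
    have "B (Suc (Suc n)) = {}" by (simp add: B_def binaryset_def)
    then show ?case using Suc S x by (subst finsum_lessThan_Suc) auto
  qed
  have "hlimit H (\<lambda>n. \<Oplus>i\<in>{..<n}. E (B i) x) (E (\<Union>i. B i) x)"
    by (intro E_countably_additive B x)
  then have "hlimit H (\<lambda>n. \<Oplus>i\<in>{..<Suc (Suc n)}. E (B i) x) (E (\<Union>i. B i) x)"
    using hlimit_Suc[OF hlimit_Suc] by blast
  then have "hlimit H (\<lambda>n. E S x \<oplus> E S' x) (E (\<Union>i. B i) x)" unfolding sum .
  moreover have "(\<Union>i. B i) = S \<union> S'" by (simp add: B_def range_binaryset_eq)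
  ultimately show ?thesis
    using S x hlimit_const[of "E S x \<oplus> E S' x"] by (intro hlimit_unique[of "\<lambda>_. E S x \<oplus> E S' x"]) auto
qed

lemma E_compl:
  assumes "S \<in> sets M" "x \<in> carrier H"
  shows "E (space M - S) x = x \<ominus> E S x"
proof -
  have "S \<union> (space M - S) = space M" using sets.sets_into_space[OF assms(1)] by blast
  moreover have "E (S \<union> (space M - S)) x = E S x \<oplus> E (space M - S) x"
    using assms by (intro E_union) auto
  ultimately have "E S x \<oplus> E (space M - S) x = x" using assms by simp
  then have "cinner H (E S x) z + cinner H (E (space M - S) x) z = cinner H x z" if "z \<in> carrier H" for z
    using that assms cinner_add_left[of "E S x" "E (space M - S) x" z] by simp
  then show ?thesis using assms by (intro vector_eqI) (auto simp: cinner_diff_left algebra_simps)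
qed

lemma E_UN_lessThan:
  fixes S :: "nat \<Rightarrow> 's set"
  assumes "\<And>i. S i \<in> sets M" "disjoint_family S" "x \<in> carrier H"
  shows "E (\<Union>i<n. S i) x = (\<Oplus>i\<in>{..<n}. E (S i) x)"
proof (induction n)
  case (Suc n)
  have "(\<Union>i<n. S i) \<inter> S n = {}"
    using assms(2) unfolding disjoint_family_on_def by (fastforce dest: less_imp_neq)
  moreover have "(\<Union>i<n. S i) \<in> sets M" using assms(1) by (intro sets.finite_UN) auto
  ultimately have "E ((\<Union>i<n. S i) \<union> S n) x = E (\<Union>i<n. S i) x \<oplus> E (S n) x"
    using assms by (intro E_union) auto
  moreover have "(\<Union>i<Suc n. S i) = (\<Union>i<n. S i) \<union> S n" by (auto simp: less_Suc_eq)
  ultimately show ?case using Suc assms by (simp add: finsum_lessThan_Suc)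
qed (use assms in simp)

lemma disjointed_sets:
  "(\<And>i. S i \<in> sets M) \<Longrightarrow> disjointed S i \<in> sets M"
  using sets.range_disjointed_sets[of S M] by auto

lemma E_UN_limit:
  fixes S :: "nat \<Rightarrow> 's set"
  assumes "\<And>i. S i \<in> sets M" "disjoint_family S" "x \<in> carrier H"
  shows "hlimit H (\<lambda>n. E (\<Union>i<n. S i) x) (E (\<Union>i. S i) x)"
  using E_countably_additive[OF assms] E_UN_lessThan[OF assms] by simp

text \<open>The increments of the sequence are disjoint, and the first \<open>Suc n\<close> of them
  fill up \<open>S n\<close>; hence the shift by one.\<close>

lemma E_incseq:
  assumes "\<And>i. S i \<in> sets M" "incseq S" "x \<in> carrier H"
  shows "hlimit H (\<lambda>n. E (S n) x) (E (\<Union>i. S i) x)"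
proof -
  have "hlimit H (\<lambda>n. E (\<Union>i<n. disjointed S i) x) (E (\<Union>i. disjointed S i) x)"
    using assms by (intro E_UN_limit disjoint_family_disjointed disjointed_sets) auto
  moreover have "(\<Union>i<Suc n. disjointed S i) = S n" for n
  proof -
    have "(\<Union>i<Suc n. disjointed S i) = (\<Union>i<Suc n. S i)"
      using finite_UN_disjointed_eq[of S "Suc n"] by (simp add: atLeast0LessThan)
    also have "\<dots> = S n" using incseqD[OF assms(2)] by (fastforce simp: less_Suc_eq_le)
    finally show ?thesis .
  qed
  ultimately show ?thesis
    using hlimit_Suc[of "\<lambda>n. E (\<Union>i<n. disjointed S i) x"] by (simp only: UN_disjointed_eq)
qed

lemma E_null_UN:
  assumes "\<And>i::nat. S i \<in> sets M" "\<And>i x. x \<in> carrier H \<Longrightarrow> E (S i) x = \<zero>" "x \<in> carrier H"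
  shows "E (\<Union>i. S i) x = \<zero>"
proof -
  have D: "disjointed S i \<in> sets M" "disjointed S i \<subseteq> S i" for i
    using disjointed_sets[of S] assms(1) disjointed_subset[of S i] by blast+
  have "E (disjointed S i) x = \<zero>" for i
    using E_subset[OF D(1) assms(1) D(2) assms(3), of i] 
    unfolding assms(2)[OF assms(3)] bounded_operator_zero[OF E_operator[OF D(1)]] by simp
  then have "hlimit H (\<lambda>n. \<zero>) (E (\<Union>i. disjointed S i) x)"
    using E_countably_additive[of "disjointed S" x] D(1) assms(3) disjoint_family_disjointed[of S] by simp
  then show ?thesis
    using assms(1,3) hlimit_const[of \<zero>] unfolding UN_disjointed_eq
    by (intro hlimit_unique[of "\<lambda>_. \<zero>"]) auto
qed

lemma E_finite_UN:
  assumes "finite I" "\<And>i. i \<in> I \<Longrightarrow> S i \<in> sets M" "disjoint_family_on S I" "x \<in> carrier H" "y \<in> carrier H"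
  shows "cinner H (E (\<Union>i\<in>I. S i) x) y = (\<Sum>i\<in>I. cinner H (E (S i) x) y)"
  using assms(1-3)
proof (induction I rule: finite_induct)
  case empty then show ?case using assms by (simp add: cinner_zero_left)
next
  case (insert i I)
  have U: "(\<Union>i\<in>I. S i) \<in> sets M" using insert by (intro sets.finite_UN) auto
  have "S i \<inter> (\<Union>i\<in>I. S i) = {}" using insert unfolding disjoint_family_on_def by auto
  then have "cinner H (E (S i \<union> (\<Union>i\<in>I. S i)) x) y = cinner H (E (S i) x) y + cinner H (E (\<Union>i\<in>I. S i) x) y"
    using insert assms U by (simp add: E_union cinner_add_left)
  moreover have "disjoint_family_on S I" using insert(5) by (auto simp: disjoint_family_on_def)
  ultimately show ?case using insert by simp
qed

text \<open>Takes the place of "almost everywhere": no scalar measure with the same null sets as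
  \<open>E\<close> is at hand.\<close>

definition conull :: "'s set \<Rightarrow> bool" where
  "conull N \<longleftrightarrow> N \<in> sets M \<and> (\<forall>x\<in>carrier H. E N x = x)"

lemma conull_inter: "conull N \<Longrightarrow> conull N' \<Longrightarrow> conull (N \<inter> N')"
  by (auto simp: conull_def E_inter)

lemma conull_space: "conull (space M)"
  by (simp add: conull_def)

lemma E_conull_inter: "\<lbrakk>conull N; S \<in> sets M; x \<in> carrier H\<rbrakk> \<Longrightarrow> E (S \<inter> N) x = E S x"
  by (simp add: conull_def E_inter)

lemma conull_iff: "S \<in> sets M \<Longrightarrow> conull (space M - S) \<longleftrightarrow> (\<forall>x\<in>carrier H. E S x = \<zero>)"
proof -
  assume S: "S \<in> sets M"
  have "x \<ominus> E S x = x \<longleftrightarrow> E S x = \<zero>" if "x \<in> carrier H" for x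
  proof
    assume eq: "x \<ominus> E S x = x"
    have "cinner H x z - cinner H (E S x) z = cinner H x z" if "z \<in> carrier H" for z 
      using cinner_diff_left[of x "E S x" z] \<open>x \<in> carrier H\<close> S that by (simp add: eq)
    then show "E S x = \<zero>" using that S by (intro vector_eqI) (auto simp: cinner_zero_left)
  qed (use that in simp)
  then show ?thesis using S by (simp add: conull_def E_compl)
qed

section \<open>Integrals of simple functions\<close>

abbreviation simple_int :: "('s \<Rightarrow> complex) \<Rightarrow> 'v \<Rightarrow> 'v" where
  "simple_int \<equiv> simple_spectral_integral H M E"

lemma simple_int_closed [simp, intro]:
  assumes "simple_function M s" "x \<in> carrier H"
  shows "simple_int s x \<in> carrier H"
  unfolding simple_spectral_integral_def
  using assms by (intro finsum_closed) (auto intro: simple_functionD)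

text \<open>Allows a simple integral to be computed over the level sets of any simple function
  through which the integrand factors. With the pair of two simple functions as \<open>p\<close>,
  both integrals live on one common refinement.\<close>

lemma cinner_simple_int_comp:
  assumes p: "simple_function M p" and x: "x \<in> carrier H" and y: "y \<in> carrier H"
  shows "cinner H (simple_int (\<lambda>w. F (p w)) x) y
    = (\<Sum>v\<in>p ` space M. F v * cinner H (E (p -` {v} \<inter> space M) x) y)"
proof -
  let ?m = "\<lambda>S. cinner H (E S x) y"
  define s where "s = (\<lambda>w. F (p w))"
  have s: "simple_function M s" using simple_function_compose1[OF p, of F] by (simp add: s_def)
  have fin: "finite (p ` space M)" "finite (s ` space M)" using p s by (auto dest: simple_functionD)
  have "cinner H (simple_int s x) y = (\<Sum>c\<in>s ` space M. c * ?m (s -` {c} \<inter> space M))"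
    unfolding simple_spectral_integral_def
    using fin x y simple_functionD(2)[OF s] by (subst cinner_finsum_left) (auto simp: cinner_smult_left)
  also have "\<dots> = (\<Sum>c\<in>s ` space M. \<Sum>v\<in>{v \<in> p ` space M. F v = c}. F v * ?m (p -` {v} \<inter> space M))"
  proof (rule sum.cong[OF refl])
    fix c assume c: "c \<in> s ` space M"
    let ?I = "{v \<in> p ` space M. F v = c}"
    have "s -` {c} \<inter> space M = (\<Union>v\<in>?I. p -` {v} \<inter> space M)"
      by (auto simp: s_def)
    moreover have "?m (\<Union>v\<in>?I. p -` {v} \<inter> space M) = (\<Sum>v\<in>?I. ?m (p -` {v} \<inter> space M))"
      using fin x y simple_functionD(2)[OF p]
      by (intro E_finite_UN) (auto simp: disjoint_family_on_def)
    ultimately show "c * ?m (s -` {c} \<inter> space M) = (\<Sum>v\<in>?I. F v * ?m (p -` {v} \<inter> space M))"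
      by (simp add: sum_distrib_left)
  qed
  also have "\<dots> = (\<Sum>v\<in>p ` space M. F v * ?m (p -` {v} \<inter> space M))"
    using fin by (intro sum.group) (auto simp: s_def)
  finally show ?thesis by (simp add: s_def)
qed

lemma simple_int_diff:
  assumes s: "simple_function M s" and r: "simple_function M r" and x: "x \<in> carrier H"
  shows "simple_int (\<lambda>w. s w - r w) x = simple_int s x \<ominus> simple_int r x"
proof (rule vector_eqI)
  fix y assume y: "y \<in> carrier H"
  define p where "p = (\<lambda>w. (s w, r w))"
  have p: "simple_function M p" unfolding p_def using s r by (rule simple_function_Pair)
  note * = cinner_simple_int_comp[OF p x y]
  show "cinner H (simple_int (\<lambda>w. s w - r w) x) y = cinner H (simple_int s x \<ominus> simple_int r x) y"
    using *[of "\<lambda>(a,b). a - b"] *[of fst] *[of snd] s r x y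
    by (simp add: p_def cinner_simps case_prod_beta left_diff_distrib sum_subtractf)
qed (use assms in auto)

text \<open>Rests on the multiplicativity of \<open>E\<close>: a level set of \<open>s\<close> for
  \<open>c\<close> and one of \<open>r\<close> for \<open>d\<close> contribute \<open>c * d\<close>
  on their intersection.\<close>

lemma simple_int_mult:
  assumes s: "simple_function M s" and r: "simple_function M r" and x: "x \<in> carrier H"
  shows "simple_int (\<lambda>w. s w * r w) x = simple_int s (simple_int r x)"
proof (rule vector_eqI)
  fix y assume y: "y \<in> carrier H"
  have rx: "simple_int r x \<in> carrier H" using r x by auto
  define p where "p = (\<lambda>w. (s w, r w))"
  have p: "simple_function M p" unfolding p_def using s r by (rule simple_function_Pair)
  let ?m = "\<lambda>S. cinner H (E S x) y"
  let ?I = "p ` space M" and ?S = "\<lambda>c. s -` {c} \<inter> space M" and ?R = "\<lambda>c. r -` {c} \<inter> space M"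
  have fin: "finite (s ` space M)" "finite (r ` space M)" using s r by (auto dest: simple_functionD)
  have meas: "?S c \<in> sets M" "?R c \<in> sets M" for c using s r by (auto intro: simple_functionD)
  have "cinner H (simple_int s (simple_int r x)) y
      = (\<Sum>c\<in>s ` space M. c * cinner H (E (?S c) (simple_int r x)) y)"
    using cinner_simple_int_comp[OF s rx y, of "\<lambda>c. c"] by simp
  also have "\<dots> = (\<Sum>c\<in>s ` space M. \<Sum>d\<in>r ` space M. c * d * ?m (?S c \<inter> ?R d))"
  proof (rule sum.cong[OF refl])
    fix c assume "c \<in> s ` space M"
    have "E (?S c) (simple_int r x) = (\<Oplus>d\<in>r ` space M. d \<odot> E (?S c \<inter> ?R d) x)"
      unfolding simple_spectral_integral_def using fin meas x
      by (subst bounded_operator_finsum[OF E_operator]) (auto simp: E_inter bounded_operator_smult[OF E_operator])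
    then show "c * cinner H (E (?S c) (simple_int r x)) y = (\<Sum>d\<in>r ` space M. c * d * ?m (?S c \<inter> ?R d))"
      using fin meas x y by (simp add: cinner_finsum_left cinner_smult_left sum_distrib_left mult.assoc sets.Int)
  qed
  also have "\<dots> = (\<Sum>(c,d)\<in>s ` space M \<times> r ` space M. c * d * ?m (?S c \<inter> ?R d))"
    using fin by (simp add: sum.cartesian_product)
  \<comment> \<open>Values that \<open>s\<close> and \<open>r\<close> never take together belong to
    an empty intersection, so only the range of the pair remains.\<close>
  also have "\<dots> = (\<Sum>v\<in>p ` space M. fst v * snd v * ?m (p -` {v} \<inter> space M))"
  proof (rule sum.mono_neutral_cong_right)
    show "\<forall>i\<in>s ` space M \<times> r ` space M - ?I. (case i of (c, d) \<Rightarrow> c * d * ?m (?S c \<inter> ?R d)) = 0"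
    proof safe
      fix a b assume ab: "(s a, r b) \<notin> ?I" 
      then have "?S (s a) \<inter> ?R (r b) = {}" by (auto simp: p_def image_iff)
      then show "s a * r b * ?m (?S (s a) \<inter> ?R (r b)) = 0" using x y by (simp only:) (simp add: cinner_zero_left)
    qed
    fix v assume "v \<in> ?I"
    have "?S (fst v) \<inter> ?R (snd v) = p -` {v} \<inter> space M" by (auto simp: p_def)
    then show "(case v of (c, d) \<Rightarrow> c * d * ?m (?S c \<inter> ?R d)) = fst v * snd v * ?m (p -` {v} \<inter> space M)"
      by (simp add: case_prod_beta)
  qed (use fin in \<open>auto simp: p_def\<close>)
  also have "\<dots> = cinner H (simple_int (\<lambda>w. s w * r w) x) y"
    using cinner_simple_int_comp[OF p x y, of "\<lambda>(a,b). a * b"] by (simp add: p_def case_prod_beta)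
  finally show "cinner H (simple_int (\<lambda>w. s w * r w) x) y = cinner H (simple_int s (simple_int r x)) y" by simp
qed (use assms in auto)

lemma simple_int_indicator:
  assumes S: "S \<in> sets M" and x: "x \<in> carrier H"
  shows "simple_int (\<lambda>w. if w \<in> S then c else 0) x = c \<odot> E S x"
proof (rule vector_eqI)
  have p: "simple_function M (\<lambda>w. w \<in> S)"
    using S unfolding simple_function_def by (auto simp: vimage_def Int_def[symmetric] sets.Int_space_eq2)
  show "simple_int (\<lambda>w. if w \<in> S then c else 0) x \<in> carrier H"
    using simple_function_compose1[OF p, of "\<lambda>b. if b then c else 0"] x by (intro simple_int_closed) auto
  fix y assume y: "y \<in> carrier H"
  have "cinner H (simple_int (\<lambda>w. if w \<in> S then c else 0) x) y
    = (\<Sum>v\<in>(\<lambda>w. w \<in> S) ` space M. (if v then c else 0) * cinner H (E ((\<lambda>w. w \<in> S) -` {v} \<inter> space M) x) y)"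
    by (rule cinner_simple_int_comp[OF p x y])
  also have "\<dots> = (\<Sum>v\<in>(\<lambda>w. w \<in> S) ` space M \<inter> {True}. c * cinner H (E S x) y)"
  proof (rule sum.mono_neutral_cong_right)
    fix v assume "v \<in> (\<lambda>w. w \<in> S) ` space M \<inter> {True}"
    then have "v" by simp
    moreover have "(\<lambda>w. w \<in> S) -` {True} \<inter> space M = S" using sets.sets_into_space[OF S] by auto
    ultimately show "(if v then c else 0) * cinner H (E ((\<lambda>w. w \<in> S) -` {v} \<inter> space M) x) y = c * cinner H (E S x) y"
      by simp
  qed (use simple_functionD(1)[OF p] in auto)
  also have "\<dots> = c * cinner H (E S x) y"
  proof (cases "S = {}")
    case False
    then have "(\<lambda>w. w \<in> S) ` space M \<inter> {True} = {True}" using sets.sets_into_space[OF S] by auto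
    then show ?thesis by simp
  qed (use x y in \<open>auto simp: cinner_zero_left\<close>)
  finally show "cinner H (simple_int (\<lambda>w. if w \<in> S then c else 0) x) y = cinner H (c \<odot> E S x) y"
    using S x y by (simp add: cinner_smult_left)
qed (use assms in auto)

lemma simple_int_const:
  assumes x: "x \<in> carrier H" shows "simple_int (\<lambda>w. c) x = c \<odot> x"
proof -
  have "simple_int (\<lambda>w. c) x = simple_int (\<lambda>w. if w \<in> space M then c else 0) x"
  proof (rule vector_eqI)
    fix y assume y: "y \<in> carrier H"
    have c: "simple_function M (\<lambda>w. c)" and c': "simple_function M (\<lambda>w. if w \<in> space M then c else 0)"
      by (auto cong: simple_function_cong)
    have im: "(\<lambda>w. if w \<in> space M then c else 0) ` space M = (\<lambda>w. c) ` space M" 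
      "(\<lambda>w. if w \<in> space M then c else 0) -` {v} \<inter> space M = (\<lambda>w. c) -` {v} \<inter> space M" for v by auto
    show "cinner H (simple_int (\<lambda>w. c) x) y = cinner H (simple_int (\<lambda>w. if w \<in> space M then c else 0) x) y"
      using cinner_simple_int_comp[OF c x y, of "\<lambda>v. v"] cinner_simple_int_comp[OF c' x y, of "\<lambda>v. v"]
      by (simp only: im)
  qed (use x in \<open>auto cong: simple_function_cong\<close>)
  then show ?thesis using x by (simp add: simple_int_indicator)
qed

lemma simple_int_operator:
  assumes "simple_function M s" shows "bounded_operator H (simple_int s)"
proof -
  have "bounded_operator H (\<lambda>x. \<Oplus>c\<in>I. c \<odot> E (s -` {c} \<inter> space M) x)" if "finite I" for I
    using that
  proof (induction I rule: finite_induct)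
    case empty 
    then show ?case by (intro bounded_operatorI[where C=0]) auto
  next
    case (insert c I)
    have "(\<Oplus>c\<in>insert c I. c \<odot> E (s -` {c} \<inter> space M) x) =
      c \<odot> E (s -` {c} \<inter> space M) x \<oplus> (\<Oplus>c\<in>I. c \<odot> E (s -` {c} \<inter> space M) x)" if "x \<in> carrier H" for x
      using that insert simple_functionD(2)[OF assms] by (intro finsum_insert) auto
    then show ?case
      using bounded_operator_cong[OF bounded_operator_sum[OF bounded_operator_scale[OF E_operator[OF simple_functionD(2)[OF assms]], of c "{c}"] insert(3)]]
      by auto
  qed
  then show ?thesis unfolding simple_spectral_integral_def using simple_functionD(1)[OF assms] by blast
qed

text \<open>Splitting an index set according to the sign of the real part bounds the variation of the
  complex measure \<open>S \<mapsto> \<langle>E S x, y\<rangle>\<close> by the uniform bound on the values of \<open>E\<close>.\<close>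

lemma variation_Re:
  assumes I: "finite I" "\<And>i. i \<in> I \<Longrightarrow> S i \<in> sets M" "disjoint_family_on S I" and x: "x \<in> carrier H" and y: "y \<in> carrier H"
  shows "(\<Sum>i\<in>I. \<bar>Re (cinner H (E (S i) x) y)\<bar>) \<le> 2 * bnd * hnorm H x * hnorm H y"
proof -
  let ?m = "\<lambda>S. cinner H (E S x) y"
  define J where "J = {i \<in> I. Re (?m (S i)) \<ge> 0}"
  have bound: "\<bar>Re (?m (\<Union>i\<in>K. S i))\<bar> \<le> bnd * hnorm H x * hnorm H y" if "K \<subseteq> I" for K
  proof -
    have U: "(\<Union>i\<in>K. S i) \<in> sets M" using that I finite_subset[OF that] by (intro sets.finite_UN) auto
    have "\<bar>Re (?m (\<Union>i\<in>K. S i))\<bar> \<le> cmod (?m (\<Union>i\<in>K. S i))" by (rule abs_Re_le_cmod)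
    also have "\<dots> \<le> hnorm H (E (\<Union>i\<in>K. S i) x) * hnorm H y" using U x y by (intro cauchy_schwarz) auto
    also have "\<dots> \<le> bnd * hnorm H x * hnorm H y" using E_bound[OF U x] y by (intro mult_right_mono) auto
    finally show ?thesis .
  qed
  have sum: "?m (\<Union>i\<in>K. S i) = (\<Sum>i\<in>K. ?m (S i))" if "K \<subseteq> I" for K
    using that I(2) finite_subset[OF that I(1)] disjoint_family_on_mono[OF that I(3)] x y
    by (intro E_finite_UN) auto
  have "(\<Sum>i\<in>I. \<bar>Re (?m (S i))\<bar>) = (\<Sum>i\<in>J. \<bar>Re (?m (S i))\<bar>) + (\<Sum>i\<in>I - J. \<bar>Re (?m (S i))\<bar>)"
    using I sum.subset_diff[of J I "\<lambda>i. \<bar>Re (?m (S i))\<bar>"] by (simp add: J_def add.commute)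
  also have "(\<Sum>i\<in>J. \<bar>Re (?m (S i))\<bar>) = (\<Sum>i\<in>J. Re (?m (S i)))" by (intro sum.cong) (auto simp: J_def)
  also have "\<dots> = Re (?m (\<Union>i\<in>J. S i))" by (subst sum) (auto simp: J_def)
  also have "(\<Sum>i\<in>I - J. \<bar>Re (?m (S i))\<bar>) = - (\<Sum>i\<in>I - J. Re (?m (S i)))"
    unfolding sum_negf[symmetric] by (intro sum.cong) (auto simp: J_def)
  also have "\<dots> = - Re (?m (\<Union>i\<in>I - J. S i))" by (subst sum) auto
  finally show ?thesis using bound[of J] bound[of "I - J"] by (auto simp: J_def)
qed

text \<open>The imaginary part of the inner product with \<open>y\<close> is the real part of that
  with \<open>\<i> \<odot> y\<close>, a vector of the same norm; the real estimate is applied to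
  both, which doubles its factor 2.\<close>

lemma variation_bound:
  assumes I: "finite I" "\<And>i. i \<in> I \<Longrightarrow> S i \<in> sets M" "disjoint_family_on S I" and x: "x \<in> carrier H" and y: "y \<in> carrier H"
  shows "(\<Sum>i\<in>I. cmod (cinner H (E (S i) x) y)) \<le> 4 * bnd * hnorm H x * hnorm H y"
proof -
  have "(\<Sum>i\<in>I. cmod (cinner H (E (S i) x) y))
    \<le> (\<Sum>i\<in>I. \<bar>Re (cinner H (E (S i) x) y)\<bar> + \<bar>Re (cinner H (E (S i) x) (\<i> \<odot> y))\<bar>)"
  proof (rule sum_mono)
    fix i assume "i \<in> I"
    then have "Re (cinner H (E (S i) x) (\<i> \<odot> y)) = Im (cinner H (E (S i) x) y)"
      using I x y by (subst cinner_smult_right) auto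
    then show "cmod (cinner H (E (S i) x) y) \<le> \<bar>Re (cinner H (E (S i) x) y)\<bar> + \<bar>Re (cinner H (E (S i) x) (\<i> \<odot> y))\<bar>"
      using cmod_le by simp
  qed
  also have "\<dots> \<le> 2 * bnd * hnorm H x * hnorm H y + 2 * bnd * hnorm H x * hnorm H (\<i> \<odot> y)"
    unfolding sum.distrib using assms by (intro add_mono variation_Re) auto
  finally show ?thesis using y by (simp add: hnorm_smult mult_ac)
qed

text \<open>The pieces over different level sets need not be orthogonal, so their norms cannot be
  added by Pythagoras. Testing the vector against itself brings in the variation bound instead, and
  one factor of its norm cancels.\<close>

lemma simple_int_bound:
  assumes s: "simple_function M s" and N: "conull N" and B: "\<And>w. w \<in> N \<Longrightarrow> cmod (s w) \<le> B" "0 \<le> B"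
    and x: "x \<in> carrier H"
  shows "hnorm H (simple_int s x) \<le> 4 * bnd * B * hnorm H x"
proof -
  define y where "y = simple_int s x"
  have y: "y \<in> carrier H" using s x by (auto simp: y_def)
  let ?S = "\<lambda>c. s -` {c} \<inter> space M"
  have fin: "finite (s ` space M)" using s by (rule simple_functionD)
  have "(hnorm H y)\<^sup>2 = cmod (cinner H (simple_int s x) y)"
    using y by (simp add: y_def[symmetric] cinner_self norm_power)
  also have "\<dots> \<le> (\<Sum>c\<in>s ` space M. cmod c * cmod (cinner H (E (?S c) x) y))"
    using norm_sum[of "\<lambda>c. c * cinner H (E (?S c) x) y" "s ` space M"] cinner_simple_int_comp[OF s x y, of "\<lambda>c. c"]
    by (simp add: norm_mult)
  also have "\<dots> \<le> (\<Sum>c\<in>s ` space M. B * cmod (cinner H (E (?S c) x) y))"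
  proof (rule sum_mono)
    fix c
    show "cmod c * cmod (cinner H (E (?S c) x) y) \<le> B * cmod (cinner H (E (?S c) x) y)"
    \<comment> \<open>A level set that misses \<open>N\<close> is null, so the size of
      \<open>s\<close> off \<open>N\<close> does not matter.\<close>
    proof (cases "?S c \<inter> N = {}")
      case True
      then have "E (?S c) x = \<zero>" 
        using E_conull_inter[OF N simple_functionD(2)[OF s, of "{c}"] x] x by simp
      then show ?thesis using y by (simp add: cinner_zero_left)
    next
      case False
      then show ?thesis using B by (intro mult_right_mono) auto
    qed
  qed
  also have "\<dots> \<le> B * (4 * bnd * hnorm H x * hnorm H y)"
    unfolding sum_distrib_left[symmetric] using fin B x y simple_functionD(2)[OF s]
    by (intro mult_left_mono variation_bound) (auto simp: disjoint_family_on_def)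
  finally have "hnorm H y * hnorm H y \<le> (4 * bnd * B * hnorm H x) * hnorm H y"
    by (simp add: power2_eq_square mult_ac)
  moreover have "0 \<le> 4 * bnd * B * hnorm H x" using B x bnd_pos by simp
  ultimately show ?thesis using y unfolding y_def[symmetric]
    by (cases "hnorm H y = 0") (auto simp: mult_le_cancel_right dest: antisym)
qed

section \<open>Integrals of essentially bounded functions\<close>

lemma has_integralD:
  assumes "has_spectral_integral H M E f T"
  shows "f \<in> borel_measurable M" "bounded_operator H T"
    and "\<exists>N. conull N \<and> (\<forall>e>0. \<exists>s. simple_function M s \<and> (\<forall>w\<in>N. cmod (f w - s w) \<le> e) \<and>
          (\<forall>x\<in>carrier H. hnorm H (T x \<ominus> simple_int s x) \<le> e * hnorm H x))"
  using assms unfolding has_spectral_integral_def conull_def by blast+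

lemma has_integral_approximants:
  assumes "has_spectral_integral H M E f T"
  obtains N s where "conull N" "\<And>e. e > 0 \<Longrightarrow> simple_function M (s e)"
    "\<And>e w. \<lbrakk>e > 0; w \<in> N\<rbrakk> \<Longrightarrow> cmod (f w - s e w) \<le> e"
    "\<And>e x. \<lbrakk>e > 0; x \<in> carrier H\<rbrakk> \<Longrightarrow> hnorm H (T x \<ominus> simple_int (s e) x) \<le> e * hnorm H x"
proof -
  obtain N where N: "conull N" "\<forall>e>0. \<exists>s. simple_function M s \<and> (\<forall>w\<in>N. cmod (f w - s w) \<le> e) \<and>
          (\<forall>x\<in>carrier H. hnorm H (T x \<ominus> simple_int s x) \<le> e * hnorm H x)"
    using has_integralD(3)[OF assms] by blast
  then obtain s where "\<forall>e>0. simple_function M (s e) \<and> (\<forall>w\<in>N. cmod (f w - s e w) \<le> e) \<and>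
          (\<forall>x\<in>carrier H. hnorm H (T x \<ominus> simple_int (s e) x) \<le> e * hnorm H x)"
    by metis
  then show ?thesis using N(1) by (intro that[of N s]) auto
qed

lemma has_integralI:
  assumes "f \<in> borel_measurable M" "bounded_operator H T" "conull N"
    "\<And>e. e > 0 \<Longrightarrow> \<exists>s. simple_function M s \<and> (\<forall>w\<in>N. cmod (f w - s w) \<le> e) \<and>
          (\<forall>x\<in>carrier H. hnorm H (T x \<ominus> simple_int s x) \<le> e * hnorm H x)"
  shows "has_spectral_integral H M E f T"
  using assms unfolding has_spectral_integral_def conull_def by blast

text \<open>An approximant with error 1 has only finitely many values.\<close>

lemma has_integral_essentially_bounded:
  assumes "has_spectral_integral H M E f T"
  obtains N B where "conull N" "B > 0" "\<And>w. w \<in> N \<Longrightarrow> cmod (f w) \<le> B"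
proof -
  obtain N s where N: "conull N" and s: "simple_function M s" "\<And>w. w \<in> N \<Longrightarrow> cmod (f w - s w) \<le> 1"
    using has_integral_approximants[OF assms] zero_less_one by metis
  have "finite (s ` space M)" using s by (auto dest: simple_functionD)
  then obtain B where B: "\<And>v. v \<in> s ` space M \<Longrightarrow> cmod v \<le> B"
    using finite_imp_bounded[of "s ` space M"] unfolding bounded_iff by blast
  have sub: "N \<subseteq> space M" using N sets.sets_into_space unfolding conull_def by blast
  have "cmod (f w) \<le> \<bar>B\<bar> + 1" if "w \<in> N" for w
  proof -
    have "cmod (f w) \<le> cmod (f w - s w) + cmod (s w)" by (metis diff_add_cancel norm_triangle_ineq)
    moreover have "cmod (s w) \<le> B" using B that sub by blast
    ultimately show ?thesis using s(2) that by fastforce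
  qed
  then show ?thesis using N by (intro that[of N "\<bar>B\<bar> + 1"]) auto
qed

text \<open>The definition promises an operator estimate for one approximant per error only.
  Comparing \<open>s\<close> with these approximants shows that uniform closeness to
  \<open>f\<close> on any conull set suffices, at the price of the factor
  \<open>4 * bnd\<close>.\<close>

lemma has_integral_dist:
  assumes T: "has_spectral_integral H M E f T" and s: "simple_function M s" and N: "conull N"
    and e: "\<And>w. w \<in> N \<Longrightarrow> cmod (f w - s w) \<le> e" "0 \<le> e" and x: "x \<in> carrier H"
  shows "hnorm H (T x \<ominus> simple_int s x) \<le> 4 * bnd * e * hnorm H x"
proof (rule field_le_epsilon)
  fix d :: real assume d: "d > 0"
  obtain N' aT where N': "conull N'" "\<And>e. e > 0 \<Longrightarrow> simple_function M (aT e)"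
    "\<And>e w. \<lbrakk>e > 0; w \<in> N'\<rbrakk> \<Longrightarrow> cmod (f w - aT e w) \<le> e"
    "\<And>e x. \<lbrakk>e > 0; x \<in> carrier H\<rbrakk> \<Longrightarrow> hnorm H (T x \<ominus> simple_int (aT e) x) \<le> e * hnorm H x"
    using has_integral_approximants[OF T] by blast
  \<comment> \<open>Makes all contributions of the error \<open>d / K\<close> add up to at most
    \<open>d\<close>; the summand 1 keeps \<open>K\<close> positive when \<open>x\<close> is
    zero.\<close>
  define K where "K = (1 + 4 * bnd) * hnorm H x + 1"
  have K: "K > 0" using x bnd_pos by (simp add: K_def add_nonneg_pos)
  obtain r where r: "simple_function M r" "\<And>w. w \<in> N' \<Longrightarrow> cmod (f w - r w) \<le> d / K"
    "\<And>x. x \<in> carrier H \<Longrightarrow> hnorm H (T x \<ominus> simple_int r x) \<le> d / K * hnorm H x"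
    using N'(2-4)[OF divide_pos_pos[OF d K]] by blast
  have Tx: "T x \<in> carrier H" using has_integralD(2)[OF T] x by (rule bounded_operator_closed)
  have "hnorm H (simple_int r x \<ominus> simple_int s x) = hnorm H (simple_int (\<lambda>w. r w - s w) x)"
    using r s x by (simp add: simple_int_diff)
  also have "\<dots> \<le> 4 * bnd * (d / K + e) * hnorm H x"
  proof (rule simple_int_bound[OF _ conull_inter[OF N N'(1)]])
    fix w assume "w \<in> N \<inter> N'"
    then have "cmod (f w - s w) \<le> e" "cmod (f w - r w) \<le> d / K" using e r by auto
    moreover have "r w - s w = (f w - s w) - (f w - r w)" by simp
    ultimately show "cmod (r w - s w) \<le> d / K + e" 
      using norm_triangle_ineq4[of "f w - s w" "f w - r w"] by simp
  qed (use r s x e d K in \<open>auto intro: simple_function_diff\<close>)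
  finally have "hnorm H (T x \<ominus> simple_int s x) \<le> d / K * hnorm H x + 4 * bnd * (d / K + e) * hnorm H x"
    using r s x Tx by (intro hnorm_dist_le[of _ "simple_int r x"]) auto
  also have "\<dots> = d * ((1 + 4 * bnd) * hnorm H x / K) + 4 * bnd * e * hnorm H x"
    by (simp add: algebra_simps add_divide_distrib)
  also have "(1 + 4 * bnd) * hnorm H x / K \<le> 1" using K by (simp add: K_def)
  then have "d * ((1 + 4 * bnd) * hnorm H x / K) \<le> d * 1" using d by (intro mult_left_mono) auto
  finally show "hnorm H (T x \<ominus> simple_int s x) \<le> 4 * bnd * e * hnorm H x + d" by simp
qed

lemma simple_has_integral:
  assumes "simple_function M s"
  shows "has_spectral_integral H M E s (simple_int s)"
proof (rule has_integralI[OF _ _ conull_space])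
  show "\<exists>s'. simple_function M s' \<and> (\<forall>w\<in>space M. cmod (s w - s' w) \<le> e) \<and>
      (\<forall>x\<in>carrier H. hnorm H (simple_int s x \<ominus> simple_int s' x) \<le> e * hnorm H x)" if "e > 0" for e
    using assms that by (intro exI[of _ s]) auto
qed (use assms in \<open>auto intro: borel_measurable_simple_function simple_int_operator\<close>)

lemma has_integral_cong:
  assumes "has_spectral_integral H M E f T" "\<And>x. x \<in> carrier H \<Longrightarrow> T x = T' x" 
  shows "has_spectral_integral H M E f T'"
proof -
  have "bounded_operator H T'" using bounded_operator_cong has_integralD(2)[OF assms(1)] assms(2) by blast
  then show ?thesis using assms unfolding has_spectral_integral_def by auto
qed

lemma has_integral_norm_le:
  assumes T: "has_spectral_integral H M E f T" and N: "conull N"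
    and e: "\<And>w. w \<in> N \<Longrightarrow> cmod (f w) \<le> e" "0 \<le> e" and x: "x \<in> carrier H"
  shows "hnorm H (T x) \<le> 4 * bnd * e * hnorm H x"
  using has_integral_dist[OF T _ N, of "\<lambda>w. 0" e x] e x bounded_operator_closed[OF has_integralD(2)[OF T] x]
  by (simp add: simple_int_const)

text \<open>An approximant of \<open>g\<close> is also one of \<open>f\<close> on the common conull
  set, and both operators are close to its integral.\<close>

lemma has_integral_unique:
  assumes T: "has_spectral_integral H M E f T" and R: "has_spectral_integral H M E g R"
    and N: "conull N" "\<And>w. w \<in> N \<Longrightarrow> f w = g w" and x: "x \<in> carrier H"
  shows "T x = R x"
proof (rule eq_if_dist_le)
  show Tx: "T x \<in> carrier H" using has_integralD(2)[OF T] x by (rule bounded_operator_closed)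
  show Rx: "R x \<in> carrier H" using has_integralD(2)[OF R] x by (rule bounded_operator_closed)
  fix e :: real assume e: "e > 0"
  define K where "K = (1 + 4 * bnd) * hnorm H x + 1"
  have K: "K > 0" using x bnd_pos by (simp add: K_def add_nonneg_pos)
  obtain N' aR where N': "conull N'" "\<And>e. e > 0 \<Longrightarrow> simple_function M (aR e)"
    "\<And>e w. \<lbrakk>e > 0; w \<in> N'\<rbrakk> \<Longrightarrow> cmod (g w - aR e w) \<le> e"
    "\<And>e x. \<lbrakk>e > 0; x \<in> carrier H\<rbrakk> \<Longrightarrow> hnorm H (R x \<ominus> simple_int (aR e) x) \<le> e * hnorm H x"
    using has_integral_approximants[OF R] by blast
  obtain r where r: "simple_function M r" "\<And>w. w \<in> N' \<Longrightarrow> cmod (g w - r w) \<le> e / K"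
    "\<And>x. x \<in> carrier H \<Longrightarrow> hnorm H (R x \<ominus> simple_int r x) \<le> e / K * hnorm H x"
    using N'(2-4)[OF divide_pos_pos[OF e K]] by blast
  have "hnorm H (T x \<ominus> simple_int r x) \<le> 4 * bnd * (e / K) * hnorm H x"
    using r N N' e K x by (intro has_integral_dist[OF T _ conull_inter[OF N(1) N'(1)]]) auto
  moreover have "hnorm H (simple_int r x \<ominus> R x) \<le> e / K * hnorm H x"
    using r(3)[OF x] hnorm_diff_commute[of "R x" "simple_int r x"] r x Rx by auto
  ultimately have "hnorm H (T x \<ominus> R x) \<le> 4 * bnd * (e / K) * hnorm H x + e / K * hnorm H x"
    using Tx Rx r x by (intro hnorm_dist_le[of _ "simple_int r x"]) auto
  also have "\<dots> = e * ((1 + 4 * bnd) * hnorm H x / K)" by (simp add: algebra_simps add_divide_distrib)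
  also have "\<dots> \<le> e * 1" using K e by (intro mult_left_mono) (auto simp: K_def)
  finally show "hnorm H (T x \<ominus> R x) \<le> e" by simp
qed

lemma has_integral_mult:
  assumes T: "has_spectral_integral H M E f T" and R: "has_spectral_integral H M E g R"
  shows "has_spectral_integral H M E (\<lambda>w. f w * g w) (\<lambda>x. T (R x))"
proof -
  note opT = has_integralD(2)[OF T] and opR = has_integralD(2)[OF R]
  obtain N1 B1 where B1: "conull N1" "B1 > 0" "\<And>w. w \<in> N1 \<Longrightarrow> cmod (f w) \<le> B1"
    using has_integral_essentially_bounded[OF T] by blast
  obtain N2 B2 where B2: "conull N2" "B2 > 0" "\<And>w. w \<in> N2 \<Longrightarrow> cmod (g w) \<le> B2"
    using has_integral_essentially_bounded[OF R] by blast
  obtain CT where CT: "CT > 0" "\<And>x. x \<in> carrier H \<Longrightarrow> hnorm H (T x) \<le> CT * hnorm H x"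
    using bounded_operator_bound[OF opT] by blast
  obtain CR where CR: "CR > 0" "\<And>x. x \<in> carrier H \<Longrightarrow> hnorm H (R x) \<le> CR * hnorm H x"
    using bounded_operator_bound[OF opR] by blast
  obtain N3 aT where N3: "conull N3" "\<And>e. e > 0 \<Longrightarrow> simple_function M (aT e)"
    "\<And>e w. \<lbrakk>e > 0; w \<in> N3\<rbrakk> \<Longrightarrow> cmod (f w - aT e w) \<le> e"
    "\<And>e x. \<lbrakk>e > 0; x \<in> carrier H\<rbrakk> \<Longrightarrow> hnorm H (T x \<ominus> simple_int (aT e) x) \<le> e * hnorm H x"
    using has_integral_approximants[OF T] by blast
  obtain N4 aR where N4: "conull N4" "\<And>e. e > 0 \<Longrightarrow> simple_function M (aR e)"
    "\<And>e w. \<lbrakk>e > 0; w \<in> N4\<rbrakk> \<Longrightarrow> cmod (g w - aR e w) \<le> e"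
    "\<And>e x. \<lbrakk>e > 0; x \<in> carrier H\<rbrakk> \<Longrightarrow> hnorm H (R x \<ominus> simple_int (aR e) x) \<le> e * hnorm H x"
    using has_integral_approximants[OF R] by blast
  \<comment> \<open>\<open>B1 + B2 + 1\<close> is the coefficient of \<open>d\<close> in the
    pointwise estimate and \<open>CT + CR + 1\<close> that in the operator estimate. Both split a
    difference of products in two, and \<open>d \<le> 1\<close> bounds the approximant
    \<open>r\<close> and its integral.\<close>
  define K where "K = B1 + B2 + 1 + CT + CR + 1"
  have K: "K > 0" using B1 B2 CT CR by (simp add: K_def)
  show ?thesis
  proof (rule has_integralI)
    show "conull (N1 \<inter> N2 \<inter> N3 \<inter> N4)" using B1 B2 N3 N4 by (intro conull_inter)
    fix e :: real assume e: "e > 0"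
    define d where "d = min 1 (e / K)"
    have d: "d > 0" "d \<le> 1" "d * K \<le> e" using e K by (auto simp: d_def min_def field_simps)
    obtain s where s: "simple_function M s" "\<And>w. w \<in> N3 \<Longrightarrow> cmod (f w - s w) \<le> d"
      "\<And>x. x \<in> carrier H \<Longrightarrow> hnorm H (T x \<ominus> simple_int s x) \<le> d * hnorm H x"
      using N3(2-4)[OF d(1)] by blast
    obtain r where r: "simple_function M r" "\<And>w. w \<in> N4 \<Longrightarrow> cmod (g w - r w) \<le> d"
      "\<And>x. x \<in> carrier H \<Longrightarrow> hnorm H (R x \<ominus> simple_int r x) \<le> d * hnorm H x"
      using N4(2-4)[OF d(1)] by blast
    have sr: "simple_function M (\<lambda>w. s w * r w)" using s r by (auto intro: simple_function_mult)
    show "\<exists>s. simple_function M s \<and> (\<forall>w\<in>N1 \<inter> N2 \<inter> N3 \<inter> N4. cmod (f w * g w - s w) \<le> e) \<and>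
          (\<forall>x\<in>carrier H. hnorm H (T (R x) \<ominus> simple_int s x) \<le> e * hnorm H x)"
    proof (intro exI[of _ "\<lambda>w. s w * r w"] conjI ballI sr)
      fix w assume w: "w \<in> N1 \<inter> N2 \<inter> N3 \<inter> N4"
      have "cmod (r w) \<le> cmod (g w) + cmod (g w - r w)"
        using norm_triangle_ineq4[of "g w" "g w - r w"] by simp
      then have rw: "cmod (r w) \<le> B2 + 1" using w B2(3)[of w] r(2)[of w] d by auto
      have "f w * g w - s w * r w = f w * (g w - r w) + (f w - s w) * r w" by (simp add: algebra_simps)
      then have "cmod (f w * g w - s w * r w) \<le> cmod (f w) * cmod (g w - r w) + cmod (f w - s w) * cmod (r w)"
        using norm_triangle_ineq[of "f w * (g w - r w)" "(f w - s w) * r w"] by (simp add: norm_mult)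
      also have "\<dots> \<le> B1 * d + d * (B2 + 1)"
        using w B1 B2 r s rw d by (intro add_mono mult_mono) auto
      also have "\<dots> \<le> d * K" using d CT CR by (simp add: K_def algebra_simps)
      finally show "cmod (f w * g w - s w * r w) \<le> e" using d by simp
    next
      fix x assume x: "x \<in> carrier H"
      have [simp]: "R x \<in> carrier H" "simple_int r x \<in> carrier H" "T (R x) \<in> carrier H"
        "T (simple_int r x) \<in> carrier H" "simple_int s (simple_int r x) \<in> carrier H"
        using x r s opT opR by (auto intro: bounded_operator_closed)
      have "hnorm H (simple_int r x) \<le> hnorm H (simple_int r x \<ominus> R x) + hnorm H (R x)"
        by (rule hnorm_le_dist) auto
      then have rx: "hnorm H (simple_int r x) \<le> (1 + CR) * hnorm H x"
        using r(3)[OF x] CR(2)[OF x] d(2) x hnorm_diff_commute[of "R x" "simple_int r x"]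
          mult_right_mono[of d 1 "hnorm H x"] by (simp add: algebra_simps)
      have "hnorm H (T (R x) \<ominus> T (simple_int r x)) = hnorm H (T (R x \<ominus> simple_int r x))"
        by (simp add: bounded_operator_diff[OF opT])
      also have "\<dots> \<le> CT * (d * hnorm H x)"
        using CT(2)[of "R x \<ominus> simple_int r x"] mult_left_mono[OF r(3)[OF x], of CT] CT(1)
        by (intro order_trans[OF CT(2)]) auto
      finally have "hnorm H (T (R x) \<ominus> T (simple_int r x)) \<le> CT * (d * hnorm H x)" .
      moreover have "hnorm H (T (simple_int r x) \<ominus> simple_int s (simple_int r x)) \<le> d * ((1 + CR) * hnorm H x)"
        by (rule order_trans[OF s(3) mult_left_mono[OF rx]]) (use d in auto)
      ultimately have "hnorm H (T (R x) \<ominus> simple_int s (simple_int r x)) \<le> CT * (d * hnorm H x) + d * ((1 + CR) * hnorm H x)"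
        by (intro hnorm_dist_le[of _ "T (simple_int r x)"]) auto
      also have "\<dots> = d * (CT + 1 + CR) * hnorm H x" by (simp add: algebra_simps)
      also have "\<dots> \<le> e * hnorm H x"
      proof (rule mult_right_mono)
        have "d * (CT + 1 + CR) \<le> d * K" using d B1 B2 by (intro mult_left_mono) (auto simp: K_def)
        then show "d * (CT + 1 + CR) \<le> e" using d(3) by (rule order_trans)
      qed (use x in simp)
      finally show "hnorm H (T (R x) \<ominus> simple_int (\<lambda>w. s w * r w) x) \<le> e * hnorm H x"
        using s r x by (simp add: simple_int_mult)
    qed
  qed (use T R in \<open>auto intro: bounded_operator_comp[OF opT opR] borel_measurable_times has_integralD(1)\<close>)
qed

lemma has_integral_diff_const:
  assumes T: "has_spectral_integral H M E f T"
  shows "has_spectral_integral H M E (\<lambda>w. f w - c) (\<lambda>x. T x \<ominus> c \<odot> x)"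
proof -
  note opT = has_integralD(2)[OF T]
  obtain N aT where N: "conull N" "\<And>e. e > 0 \<Longrightarrow> simple_function M (aT e)"
    "\<And>e w. \<lbrakk>e > 0; w \<in> N\<rbrakk> \<Longrightarrow> cmod (f w - aT e w) \<le> e"
    "\<And>e x. \<lbrakk>e > 0; x \<in> carrier H\<rbrakk> \<Longrightarrow> hnorm H (T x \<ominus> simple_int (aT e) x) \<le> e * hnorm H x"
    using has_integral_approximants[OF T] by blast
  show ?thesis
  proof (rule has_integralI[OF _ _ N(1)])
    show "bounded_operator H (\<lambda>x. T x \<ominus> c \<odot> x)"
      by (intro bounded_operator_difference[OF opT bounded_operator_scale[OF bounded_operator_id]])
    fix e :: real assume e: "e > 0"
    obtain s where s: "simple_function M s" "\<And>w. w \<in> N \<Longrightarrow> cmod (f w - s w) \<le> e"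
      "\<And>x. x \<in> carrier H \<Longrightarrow> hnorm H (T x \<ominus> simple_int s x) \<le> e * hnorm H x"
      using N(2-4)[OF e] by blast
    have "(T x \<ominus> c \<odot> x) \<ominus> simple_int (\<lambda>w. s w - c) x = T x \<ominus> simple_int s x" if x: "x \<in> carrier H" for x
      using bounded_operator_closed[OF opT x] simple_int_closed[OF s(1) x] x
      by (intro vector_eqI) (auto simp: simple_int_diff[OF s(1)] simple_int_const cinner_simps)
    then show "\<exists>s. simple_function M s \<and> (\<forall>w\<in>N. cmod (f w - c - s w) \<le> e) \<and>
          (\<forall>x\<in>carrier H. hnorm H ((T x \<ominus> c \<odot> x) \<ominus> simple_int s x) \<le> e * hnorm H x)"
      using s by (intro exI[of _ "\<lambda>w. s w - c"]) (auto intro: simple_function_diff)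
  qed (use has_integralD(1)[OF T] in measurable)
qed

lemma uniform_simple_approximation:
  fixes f :: "'s \<Rightarrow> complex"
  assumes f: "f \<in> borel_measurable M" and N: "N \<in> sets M" and B: "\<And>w. w \<in> N \<Longrightarrow> cmod (f w) \<le> B" and e: "e > 0"
  shows "\<exists>s. simple_function M s \<and> (\<forall>w\<in>N. cmod (f w - s w) \<le> e)"
proof -
  \<comment> \<open>Rounds down to a multiple of \<open>e/2\<close>; real and imaginary part then
    contribute an error of at most \<open>e/2\<close> each.\<close>
  define r where "r = (\<lambda>t. e/2 * of_int \<lfloor>t / (e/2)\<rfloor> :: real)"
  have r: "\<bar>t - r t\<bar> \<le> e/2" for t
  proof -
    have "t / (e/2) - of_int \<lfloor>t / (e/2)\<rfloor> \<in> {0..1}" by (auto simp: real_of_int_floor_add_one_ge le_diff_eq) linarith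
    then have "e/2 * (t / (e/2) - of_int \<lfloor>t / (e/2)\<rfloor>) \<in> {0..e/2}" using e by (auto simp: mult_left_le)
    moreover have "e/2 * (t / (e/2) - of_int \<lfloor>t / (e/2)\<rfloor>) = t - r t" using e by (simp add: r_def field_simps)
    ultimately show ?thesis by auto
  qed
  have fin: "finite (r ` {-B..B})"
  proof (rule finite_subset)
    have "\<lfloor>t / (e/2)\<rfloor> \<in> {\<lfloor>-B / (e/2)\<rfloor>..\<lfloor>B / (e/2)\<rfloor>}" if "t \<in> {-B..B}" for t
      unfolding atLeastAtMost_iff
      by (intro conjI floor_mono divide_right_mono) (use that e in auto)
    then show "r ` {-B..B} \<subseteq> (\<lambda>k. e/2 * of_int k) ` {\<lfloor>-B / (e/2)\<rfloor>..\<lfloor>B / (e/2)\<rfloor>}"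
      unfolding r_def by blast
  qed auto
  define s where "s = (\<lambda>w. if w \<in> N then Complex (r (Re (f w))) (r (Im (f w))) else 0)"
  have "s ` space M \<subseteq> insert 0 ((\<lambda>(a,b). Complex a b) ` (r ` {-B..B} \<times> r ` {-B..B}))"
  proof
    fix v assume "v \<in> s ` space M"
    then obtain w where w: "v = s w" by auto
    show "v \<in> insert 0 ((\<lambda>(a,b). Complex a b) ` (r ` {-B..B} \<times> r ` {-B..B}))"
    proof (cases "w \<in> N")
      case True
      then have "Re (f w) \<in> {-B..B}" "Im (f w) \<in> {-B..B}" 
        using B[OF True] abs_Re_le_cmod[of "f w"] abs_Im_le_cmod[of "f w"] by auto
      then show ?thesis using True w by (auto simp: s_def intro!: image_eqI[where x="(r (Re (f w)), r (Im (f w)))"])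
    qed (simp add: w s_def)
  qed
  then have "finite (s ` space M)" by (rule finite_subset) (use fin in auto)
  moreover have "s \<in> borel_measurable M"
    unfolding s_def r_def Complex_eq using f N by measurable
  ultimately have "simple_function M s" by (rule simple_function_borel_measurable[rotated])
  moreover have "cmod (f w - s w) \<le> e" if "w \<in> N" for w
    using cmod_le[of "f w - s w"] r[of "Re (f w)"] r[of "Im (f w)"] that by (simp add: s_def)
  ultimately show ?thesis by auto
qed

text \<open>Integrals of uniform approximants are Cauchy with a rate that is linear in the norm of
  the vector. Completeness gives the limit at each vector, and the rate makes the convergence one in
  operator norm.\<close>

lemma has_integral_exists:
  assumes f: "f \<in> borel_measurable M" and N: "conull N" and B: "\<And>w. w \<in> N \<Longrightarrow> cmod (f w) \<le> B"
  shows "\<exists>T. has_spectral_integral H M E f T"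
proof -
  define d where "d = (\<lambda>n. 1 / real (Suc n))"
  have d: "d n > 0" "d n \<le> 1" for n by (auto simp: d_def)
  have dlim: "d \<longlonglongrightarrow> 0" unfolding d_def by (rule LIMSEQ_Suc[OF lim_1_over_n])
  have "\<exists>s. simple_function M s \<and> (\<forall>w\<in>N. cmod (f w - s w) \<le> d n)" for n
    using f N B d by (intro uniform_simple_approximation) (auto simp: conull_def)
  then obtain s where s: "\<And>n. simple_function M (s n)" "\<And>n w. w \<in> N \<Longrightarrow> cmod (f w - s n w) \<le> d n"
    by metis
  have dist: "hnorm H (simple_int (s m) x \<ominus> simple_int (s n) x) \<le> 4 * bnd * (d m + d n) * hnorm H x"
    if x: "x \<in> carrier H" for m n x
  proof -
    have "hnorm H (simple_int (\<lambda>w. s m w - s n w) x) \<le> 4 * bnd * (d m + d n) * hnorm H x"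
    proof (rule simple_int_bound[OF _ N])
      fix w assume "w \<in> N"
      moreover have "s m w - s n w = (f w - s n w) - (f w - s m w)" by simp
      ultimately show "cmod (s m w - s n w) \<le> d m + d n" 
        using norm_triangle_ineq4[of "f w - s n w" "f w - s m w"] s(2)[of w n] s(2)[of w m] by simp
    qed (use s x d[of m] d[of n] in \<open>auto intro: simple_function_diff\<close>)
    then show ?thesis using s x by (simp add: simple_int_diff)
  qed
  have "\<exists>l\<in>carrier H. hlimit H (\<lambda>n. simple_int (s n) x) l" if x: "x \<in> carrier H" for x
  proof (rule cauchy_hlimit[of "\<lambda>n. simple_int (s n) x"])
    fix e :: real assume e: "e > 0"
    define K where "K = 8 * bnd * hnorm H x + 1"
    have K: "K > 0" "8 * bnd * hnorm H x \<le> K" using x bnd_pos by (auto simp: K_def add_nonneg_pos)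
    obtain n0 where n0: "\<And>n. n \<ge> n0 \<Longrightarrow> d n < e / K" using LIMSEQ_D[OF dlim, of "e / K"] e K d by force
    have "hnorm H (simple_int (s m) x \<ominus> simple_int (s n) x) \<le> e" if "m \<ge> n0" "n \<ge> n0" for m n
    proof -
      have "4 * bnd * (d m + d n) * hnorm H x \<le> 4 * bnd * (e / K + e / K) * hnorm H x"
        using n0[OF that(1)] n0[OF that(2)] bnd_pos x by (intro mult_right_mono mult_left_mono) auto
      also have "\<dots> = e * (8 * bnd * hnorm H x / K)" by simp
      also have "\<dots> \<le> e * 1" using e K by (intro mult_left_mono) auto
      finally show ?thesis using dist[OF x, of m n] by simp
    qed
    then show "\<exists>N. \<forall>m\<ge>N. \<forall>n\<ge>N. hnorm H (simple_int (s m) x \<ominus> simple_int (s n) x) \<le> e" by blast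
  qed (use s x in auto)
  then obtain T where T: "\<And>x. x \<in> carrier H \<Longrightarrow> T x \<in> carrier H"
    "\<And>x. x \<in> carrier H \<Longrightarrow> hlimit H (\<lambda>n. simple_int (s n) x) (T x)" by metis
  have op: "bounded_operator H T"
  proof (rule bounded_operator_limit(1)[of "\<lambda>n. simple_int (s n)"])
    fix n x assume x: "x \<in> carrier H"
    show "hnorm H (simple_int (s n) x) \<le> 4 * bnd * (\<bar>B\<bar> + 1) * hnorm H x"
    proof (rule simple_int_bound[OF s(1) N _ _ x])
      fix w assume w: "w \<in> N"
      have "cmod (s n w) \<le> cmod (f w) + cmod (f w - s n w)"
        using norm_triangle_ineq4[of "f w" "f w - s n w"] by simp
      then show "cmod (s n w) \<le> \<bar>B\<bar> + 1" using B[OF w] s(2)[OF w, of n] d[of n] by linarith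
    qed simp
  qed (use T s in \<open>auto intro: simple_int_operator\<close>)
  \<comment> \<open>\<open>dist\<close> with \<open>m\<close> tending to infinity;
    \<open>d m \<le> d n\<close> for \<open>m \<ge> n\<close> turns
    \<open>4 * bnd * (d m + d n)\<close> into \<open>8 * bnd * d n\<close>.\<close>
  have dist': "hnorm H (T x \<ominus> simple_int (s n) x) \<le> 8 * bnd * d n * hnorm H x" if x: "x \<in> carrier H" for x n
  proof -
    have lim: "hlimit H (\<lambda>m. simple_int (s m) x \<ominus> simple_int (s n) x) (T x \<ominus> simple_int (s n) x)"
      using hlimit_add[OF _ _ _ _ T(2)[OF x] hlimit_const[of "\<ominus> simple_int (s n) x"]] T(1) s x
      by (simp add: a_minus_def)
    have le: "hnorm H (simple_int (s m) x \<ominus> simple_int (s n) x) \<le> 8 * bnd * d n * hnorm H x" if "m \<ge> n" for m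
    proof -
      have "d m \<le> d n" using that by (simp add: d_def field_simps)
      then have "4 * bnd * (d m + d n) * hnorm H x \<le> 4 * bnd * (d n + d n) * hnorm H x"
        using bnd_pos x by (intro mult_right_mono mult_left_mono) auto
      also have "\<dots> = 8 * bnd * d n * hnorm H x" by simp
      finally show ?thesis using dist[OF x, of m n] by linarith
    qed
    show ?thesis by (rule hlimit_hnorm_le[OF _ _ lim le]) (use T(1)[OF x] s x in auto)
  qed
  have "has_spectral_integral H M E f T"
  proof (rule has_integralI[OF f op N])
    fix e :: real assume e: "e > 0"
    define K where "K = 8 * bnd + 1"
    have K: "K > 0" using bnd_pos by (simp add: K_def)
    obtain n where "norm (d n - 0) < e / K" 
      using LIMSEQ_D[OF dlim divide_pos_pos[OF e K]] by blast
    then have "d n < e / K" by simp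
    then have "d n * K < e" using K by (simp add: field_simps)
    then have n': "d n \<le> e" "8 * bnd * d n \<le> e" 
      using d(1)[of n] mult_pos_pos[OF bnd_pos d(1)[of n]] by (auto simp: K_def algebra_simps)
    have "hnorm H (T x \<ominus> simple_int (s n) x) \<le> e * hnorm H x" if "x \<in> carrier H" for x
      using dist'[OF that, of n] mult_right_mono[OF n'(2), of "hnorm H x"] that by simp
    moreover have "cmod (f w - s n w) \<le> e" if "w \<in> N" for w using s(2)[OF that, of n] n' by simp
    ultimately show "\<exists>s. simple_function M s \<and> (\<forall>w\<in>N. cmod (f w - s w) \<le> e) \<and>
          (\<forall>x\<in>carrier H. hnorm H (T x \<ominus> simple_int s x) \<le> e * hnorm H x)"
      using s by blast
  qed
  then show ?thesis by blast
qed

lemma const_one_has_integral: "has_spectral_integral H M E (\<lambda>w. 1) (\<lambda>x. x)"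
  by (rule has_integral_cong[OF simple_has_integral]) (auto simp: simple_int_const)

lemma indicator_has_integral:
  assumes S: "S \<in> sets M"
  shows "has_spectral_integral H M E (\<lambda>w. if w \<in> S then 1 else 0) (E S)"
proof (rule has_integral_cong[OF simple_has_integral])
  have p: "simple_function M (\<lambda>w. w \<in> S)"
    using S unfolding simple_function_def by (auto simp: vimage_def Int_def[symmetric] sets.Int_space_eq2)
  show "simple_function M (\<lambda>w. if w \<in> S then 1 else 0)"
    using simple_function_compose1[OF p, of "\<lambda>b. if b then 1 else 0"] by simp
qed (use S in \<open>simp add: simple_int_indicator\<close>)

section \<open>Essential range and spectrum\<close>

definition essential_range :: "('s \<Rightarrow> complex) \<Rightarrow> complex set" where
  "essential_range f = {z. \<forall>e>0. \<exists>x\<in>carrier H. E {w \<in> space M. cmod (f w - z) < e} x \<noteq> \<zero>}"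

text \<open>Off the essential range, \<open>1 / (f - z)\<close> is bounded on a conull set and its
  integral inverts \<open>T - z\<close>. Conversely, on the range of \<open>E\<close> of a small
  disc around \<open>z\<close> the operator \<open>T - z\<close> is so small that a bounded inverse
  forces this range to be zero.\<close>

theorem spectrum_eq_essential_range:
  assumes T: "has_spectral_integral H M E f T"
  shows "spectrum H T = essential_range f"
proof -
  note [measurable] = has_integralD(1)[OF T]
  have S[measurable]: "{w \<in> space M. cmod (f w - z) < e} \<in> sets M" for z e by measurable
  note opT = has_integralD(2)[OF T]
  have "z \<notin> spectrum H T \<longleftrightarrow> z \<notin> essential_range f" for z
  proof
    assume "z \<notin> spectrum H T"
    then obtain R where R: "bounded_operator H R" "\<And>x. x \<in> carrier H \<Longrightarrow> R (T x \<ominus> z \<odot> x) = x"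
      unfolding spectrum_def by blast
    obtain B where B: "B > 0" "\<And>x. x \<in> carrier H \<Longrightarrow> hnorm H (R x) \<le> B * hnorm H x"
      using bounded_operator_bound[OF R(1)] by blast
    \<comment> \<open>Chosen so that \<open>R\<close> composed with \<open>T - z\<close>, cut off to
      the disc of radius \<open>e\<close>, has norm at most 1/2, although it is the identity on that
      range.\<close>
    define e where "e = 1 / (8 * bnd * B)"
    have e: "e > 0" "B * (4 * bnd * e) = 1/2" using B bnd_pos by (auto simp: e_def field_simps)
    let ?S = "{w \<in> space M. cmod (f w - z) < e}"
    have "E ?S x = \<zero>" if x: "x \<in> carrier H" for x
    proof -
      define y where "y = E ?S x"
      have y: "y \<in> carrier H" "E ?S y = y" using x S by (auto simp: y_def)
      have "has_spectral_integral H M E (\<lambda>w. (f w - z) * (if w \<in> ?S then 1 else 0)) (\<lambda>x. T (E ?S x) \<ominus> z \<odot> E ?S x)"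
        by (rule has_integral_mult[OF has_integral_diff_const[OF T] indicator_has_integral[OF S]])
      from has_integral_norm_le[OF this conull_space, of e y] y e
      have "hnorm H (T y \<ominus> z \<odot> y) \<le> 4 * bnd * e * hnorm H y" by auto
      then have "B * hnorm H (T y \<ominus> z \<odot> y) \<le> B * (4 * bnd * e * hnorm H y)"
        using B by (intro mult_left_mono) auto
      also have "\<dots> = (B * (4 * bnd * e)) * hnorm H y" by simp
      finally have "hnorm H y \<le> 1/2 * hnorm H y" unfolding e(2)
        using B(2)[of "T y \<ominus> z \<odot> y"] R(2)[OF y(1)] bounded_operator_closed[OF opT] y by simp
      then have "hnorm H y = 0" using y hnorm_nonneg[of y] by linarith
      then show ?thesis using y by (simp add: hnorm_eq_zero_iff y_def)
    qed
    then show "z \<notin> essential_range f" using e unfolding essential_range_def by blast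
  next
    assume "z \<notin> essential_range f"
    then obtain e where e: "e > 0" and null: "\<And>x. x \<in> carrier H \<Longrightarrow> E {w \<in> space M. cmod (f w - z) < e} x = \<zero>"
      unfolding essential_range_def by blast
    let ?S = "{w \<in> space M. cmod (f w - z) < e}"
    have N: "conull (space M - ?S)" using null S by (simp add: conull_iff)
    \<comment> \<open>Division by zero gives 0 where \<open>f w = z\<close>; these points lie in the
      null set.\<close>
    define g where "g = (\<lambda>w. 1 / (f w - z))"
    have "g \<in> borel_measurable M" unfolding g_def by measurable
    moreover have "cmod (g w) \<le> 1 / e" if "w \<in> space M - ?S" for w
      using that e by (auto simp: g_def norm_divide intro!: frac_le)
    ultimately obtain R where R: "has_spectral_integral H M E g R"
      using has_integral_exists[OF _ N] by blast
    note Tz = has_integral_diff_const[OF T, of z]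
    have "f w \<noteq> z" if "w \<in> space M - ?S" for w using that e by auto
    then have "R (T x \<ominus> z \<odot> x) = x" "T (R x) \<ominus> z \<odot> R x = x" if "x \<in> carrier H" for x
      using has_integral_unique[OF has_integral_mult[OF R Tz] const_one_has_integral N _ that]
        has_integral_unique[OF has_integral_mult[OF Tz R] const_one_has_integral N _ that] 
      by (auto simp: g_def)
    then show "z \<notin> spectrum H T" unfolding spectrum_def using has_integralD(2)[OF R] by blast
  qed
  then show ?thesis by blast
qed

end

section \<open>Tensor products\<close>

locale tensor_product =
  A: complex_hilbert_space HA + B: complex_hilbert_space HB + complex_hilbert_space H
  for HA :: "('a, 'm) hilbert_scheme" and HB :: "('b, 'n) hilbert_scheme"
    and H :: "('h, 'k) hilbert_scheme" (structure) +
  fixes \<tau> :: "'a \<Rightarrow> 'b \<Rightarrow> 'h"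
  assumes tensor: "hilbert_tensor_product HA HB H \<tau>"
begin

lemma tau_closed [simp, intro]: "f \<in> carrier HA \<Longrightarrow> g \<in> carrier HB \<Longrightarrow> \<tau> f g \<in> carrier H"
  using tensor unfolding hilbert_tensor_product_def by blast

lemma tau_add_left: "\<lbrakk>f \<in> carrier HA; f' \<in> carrier HA; g \<in> carrier HB\<rbrakk> \<Longrightarrow> \<tau> (f \<oplus>\<^bsub>HA\<^esub> f') g = \<tau> f g \<oplus> \<tau> f' g"
  using tensor unfolding hilbert_tensor_product_def by blast

lemma tau_add_right: "\<lbrakk>f \<in> carrier HA; g \<in> carrier HB; g' \<in> carrier HB\<rbrakk> \<Longrightarrow> \<tau> f (g \<oplus>\<^bsub>HB\<^esub> g') = \<tau> f g \<oplus> \<tau> f g'"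
  using tensor unfolding hilbert_tensor_product_def by blast

lemma tau_smult_left: "\<lbrakk>f \<in> carrier HA; g \<in> carrier HB\<rbrakk> \<Longrightarrow> \<tau> (c \<odot>\<^bsub>HA\<^esub> f) g = c \<odot> \<tau> f g"
  using tensor unfolding hilbert_tensor_product_def by blast

lemma tau_smult_right: "\<lbrakk>f \<in> carrier HA; g \<in> carrier HB\<rbrakk> \<Longrightarrow> \<tau> f (c \<odot>\<^bsub>HB\<^esub> g) = c \<odot> \<tau> f g"
  using tensor unfolding hilbert_tensor_product_def by blast

lemma cinner_tau:
  "\<lbrakk>f \<in> carrier HA; f' \<in> carrier HA; g \<in> carrier HB; g' \<in> carrier HB\<rbrakk>
    \<Longrightarrow> cinner H (\<tau> f g) (\<tau> f' g') = cinner HA f f' * cinner HB g g'"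
  using tensor unfolding hilbert_tensor_product_def by blast

lemma span_tau: "closed_span H {\<tau> f g | f g. f \<in> carrier HA \<and> g \<in> carrier HB} = carrier H"
  using tensor unfolding hilbert_tensor_product_def by blast

text \<open>Carries results about operators on the second factor over to the first; this is how
  \<open>PH\<close> below is obtained.\<close>

lemma swap: "tensor_product HB HA H (\<lambda>g f. \<tau> f g)"
proof -
  have "{\<tau> f g | g f. g \<in> carrier HB \<and> f \<in> carrier HA} = {\<tau> f g | f g. f \<in> carrier HA \<and> g \<in> carrier HB}"
    by blast
  then have "hilbert_tensor_product HB HA H (\<lambda>g f. \<tau> f g)"
    unfolding hilbert_tensor_product_def using complex_hilbert_space_axioms
    by (simp add: tau_add_left tau_add_right tau_smult_left tau_smult_right cinner_tau span_tau)
  then show ?thesis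
    by (intro tensor_product.intro tensor_product_axioms.intro A.complex_hilbert_space_axioms
        B.complex_hilbert_space_axioms complex_hilbert_space_axioms)
qed

lemma tau_zero_left [simp]: "g \<in> carrier HB \<Longrightarrow> \<tau> \<zero>\<^bsub>HA\<^esub> g = \<zero>"
  using tau_smult_left[of "\<zero>\<^bsub>HA\<^esub>" g 0] by simp

lemma tau_zero_right [simp]: "f \<in> carrier HA \<Longrightarrow> \<tau> f \<zero>\<^bsub>HB\<^esub> = \<zero>"
  using tau_smult_right[of f "\<zero>\<^bsub>HB\<^esub>" 0] by simp

lemma tau_diff_left:
  "\<lbrakk>f \<in> carrier HA; f' \<in> carrier HA; g \<in> carrier HB\<rbrakk> \<Longrightarrow> \<tau> (f \<ominus>\<^bsub>HA\<^esub> f') g = \<tau> f g \<ominus> \<tau> f' g"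
  by (simp add: a_minus_def A.uminus_eq_smult uminus_eq_smult tau_add_left tau_smult_left)

lemma tau_diff_right:
  "\<lbrakk>f \<in> carrier HA; g \<in> carrier HB; g' \<in> carrier HB\<rbrakk> \<Longrightarrow> \<tau> f (g \<ominus>\<^bsub>HB\<^esub> g') = \<tau> f g \<ominus> \<tau> f g'"
  by (simp add: a_minus_def B.uminus_eq_smult uminus_eq_smult tau_add_right tau_smult_right)

lemma hnorm_tau: 
  assumes "f \<in> carrier HA" "g \<in> carrier HB"
  shows "hnorm H (\<tau> f g) = hnorm HA f * hnorm HB g"
proof -
  have "(hnorm H (\<tau> f g))\<^sup>2 = (hnorm HA f * hnorm HB g)\<^sup>2"
    using assms by (simp only: hnorm_sq tau_closed cinner_tau A.cinner_self B.cinner_self power_mult_distrib)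
      (simp flip: of_real_mult)
  then show ?thesis using assms by (simp add: power2_eq_iff_nonneg)
qed

lemma tau_hlimit_right:
  assumes "f \<in> carrier HA" "\<And>n. G n \<in> carrier HB" "g \<in> carrier HB" "hlimit HB G g"
  shows "hlimit H (\<lambda>n. \<tau> f (G n)) (\<tau> f g)"
proof -
  have "(\<lambda>n. hnorm HA f * hnorm HB (G n \<ominus>\<^bsub>HB\<^esub> g)) \<longlonglongrightarrow> hnorm HA f * 0"
    using assms(4) unfolding hlimit_def by (intro tendsto_intros)
  then show ?thesis using assms(1-3) unfolding hlimit_def
    by (simp add: hnorm_tau flip: tau_diff_right)
qed

lemma closed_subspace_total:
  assumes "closed_subspace H W" "\<And>f g. \<lbrakk>f \<in> carrier HA; g \<in> carrier HB\<rbrakk> \<Longrightarrow> \<tau> f g \<in> W" "x \<in> carrier H"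
  shows "x \<in> W"
proof -
  have "closed_span H {\<tau> f g | f g. f \<in> carrier HA \<and> g \<in> carrier HB} \<subseteq> W"
    unfolding closed_span_def using assms by blast
  then show ?thesis using assms span_tau by auto
qed

text \<open>The vectors on which two bounded operators agree form a closed subspace. Operator
  identities on the tensor product are checked on elementary tensors through this lemma.\<close>

lemma operator_eqI:
  assumes S: "bounded_operator H S" and T: "bounded_operator H T"
    and eq: "\<And>f g. \<lbrakk>f \<in> carrier HA; g \<in> carrier HB\<rbrakk> \<Longrightarrow> S (\<tau> f g) = T (\<tau> f g)"
    and x: "x \<in> carrier H"
  shows "S x = T x"
proof -
  have "x \<in> {x \<in> carrier H. S x = T x}"
  proof (rule closed_subspace_total[OF closed_subspaceI])
    fix X l assume X: "\<And>n. X n \<in> {x \<in> carrier H. S x = T x}" and l: "l \<in> carrier H" "hlimit H X l"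
    then have "hlimit H (\<lambda>n. S (X n)) (S l)" "hlimit H (\<lambda>n. S (X n)) (T l)"
      using bounded_operator_hlimit[OF S, of X l] bounded_operator_hlimit[OF T, of X l] by auto
    then have "S l = T l"
      using X l S T by (intro hlimit_unique[of "\<lambda>n. S (X n)"]) (auto intro: bounded_operator_closed)
    then show "l \<in> {x \<in> carrier H. S x = T x}" using l by auto
  qed (use x eq in \<open>auto simp: bounded_operator_zero[OF S] bounded_operator_zero[OF T] 
      bounded_operator_add[OF S] bounded_operator_add[OF T] bounded_operator_smult[OF S] bounded_operator_smult[OF T]\<close>)
  then show ?thesis by simp
qed

text \<open>The vectors at which the sequence converges form a closed subspace: linearity is clear,
  and the uniform bound gives closedness by splitting an error in three.\<close>

lemma strong_limit:
  assumes T: "\<And>n::nat. bounded_operator H (T n)" and K: "\<And>n x. x \<in> carrier H \<Longrightarrow> hnorm H (T n x) \<le> K * hnorm H x"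
    and conv: "\<And>f g. \<lbrakk>f \<in> carrier HA; g \<in> carrier HB\<rbrakk> \<Longrightarrow> \<exists>l\<in>carrier H. hlimit H (\<lambda>n. T n (\<tau> f g)) l"
  obtains T' where "bounded_operator H T'" "\<And>x. x \<in> carrier H \<Longrightarrow> hnorm H (T' x) \<le> K * hnorm H x"
    "\<And>x. x \<in> carrier H \<Longrightarrow> hlimit H (\<lambda>n. T n x) (T' x)"
proof -
  note [simp] = bounded_operator_closed[OF T]
  have ex: "\<exists>l\<in>carrier H. hlimit H (\<lambda>n. T n x) l" if x: "x \<in> carrier H" for x
  proof -
    have "x \<in> {x \<in> carrier H. \<exists>l\<in>carrier H. hlimit H (\<lambda>n. T n x) l}"
    proof (rule closed_subspace_total[OF closed_subspaceI])
      fix x y assume xy: "x \<in> {x \<in> carrier H. \<exists>l\<in>carrier H. hlimit H (\<lambda>n. T n x) l}" "y \<in> {x \<in> carrier H. \<exists>l\<in>carrier H. hlimit H (\<lambda>n. T n x) l}"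
      then obtain l m where "l \<in> carrier H" "m \<in> carrier H" "hlimit H (\<lambda>n. T n x) l" "hlimit H (\<lambda>n. T n y) m" by auto
      then show "x \<oplus> y \<in> {x \<in> carrier H. \<exists>l\<in>carrier H. hlimit H (\<lambda>n. T n x) l}"
        using xy hlimit_add[of "\<lambda>n. T n x" "\<lambda>n. T n y" l m] by (auto simp: bounded_operator_add[OF T] intro!: bexI[of _ "l \<oplus> m"])
    next
      fix c x assume x: "x \<in> {x \<in> carrier H. \<exists>l\<in>carrier H. hlimit H (\<lambda>n. T n x) l}"
      then obtain l where "l \<in> carrier H" "hlimit H (\<lambda>n. T n x) l" by auto
      then show "c \<odot> x \<in> {x \<in> carrier H. \<exists>l\<in>carrier H. hlimit H (\<lambda>n. T n x) l}"
        using x bounded_operator_hlimit[OF bounded_operator_scale[OF bounded_operator_id], of "\<lambda>n. T n x" l c] 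
        by (auto simp: bounded_operator_smult[OF T] intro!: bexI[of _ "c \<odot> l"])
    next
      fix X l assume X: "\<And>k. X k \<in> {x \<in> carrier H. \<exists>l\<in>carrier H. hlimit H (\<lambda>n. T n x) l}"
        and l: "l \<in> carrier H" "hlimit H X l"
      have Xc[simp]: "X k \<in> carrier H" for k using X by auto
      have "\<exists>m\<in>carrier H. hlimit H (\<lambda>n. T n l) m"
      proof (rule cauchy_hlimit[of "\<lambda>n. T n l"])
        fix e :: real assume e: "e > 0"
        \<comment> \<open>\<open>K\<close> is not assumed positive, and \<open>d\<close> below
          divides by this bound.\<close>
        define q where "q = \<bar>K\<bar> + 1"
        have q: "q > 0" "K \<le> q" by (auto simp: q_def)
        define d where "d = e / 3 / q"
        have d: "d > 0" using e q by (simp add: d_def)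
        obtain k where k: "hnorm H (X k \<ominus> l) < d" using hlimitD[OF l(2) d] by blast
        obtain y where y: "y \<in> carrier H" "hlimit H (\<lambda>n. T n (X k)) y" using X[of k] by auto
        obtain N where N: "\<And>m n. \<lbrakk>m \<ge> N; n \<ge> N\<rbrakk> \<Longrightarrow> hnorm H (T m (X k) \<ominus> T n (X k)) \<le> e/3"
          using hlimit_cauchy[of "\<lambda>n. T n (X k)" y "e/3"] y e by auto
        have near: "hnorm H (T n (X k) \<ominus> T n l) \<le> e/3" for n
        proof -
          have "hnorm H (T n (X k) \<ominus> T n l) \<le> K * hnorm H (X k \<ominus> l)"
            using K[of "X k \<ominus> l" n] l by (simp add: bounded_operator_diff[OF T])
          also have "\<dots> \<le> q * d" using k l q by (intro mult_mono) auto
          also have "\<dots> = e/3" using q by (simp add: d_def)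
          finally show ?thesis .
        qed
        have "hnorm H (T m l \<ominus> T n l) \<le> e/3 + (e/3 + e/3)" if "m \<ge> N" "n \<ge> N" for m n
          using near[of m] near[of n] N[OF that] l hnorm_diff_commute[of "T m l" "T m (X k)"]
          by (intro hnorm_dist_le[of _ "T m (X k)"] hnorm_dist_le[of "T m (X k)" "T n (X k)"]) auto
        then show "\<exists>N. \<forall>m\<ge>N. \<forall>n\<ge>N. hnorm H (T m l \<ominus> T n l) \<le> e" by auto
      qed (use l in auto)
      then show "l \<in> {x \<in> carrier H. \<exists>l\<in>carrier H. hlimit H (\<lambda>n. T n x) l}" using l by auto
    qed (use conv x in \<open>auto simp: bounded_operator_zero[OF T] intro!: bexI[of _ \<zero>] hlimit_const\<close>)
    then show ?thesis by simp
  qed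
  define T' where "T' = (\<lambda>x. SOME l. l \<in> carrier H \<and> hlimit H (\<lambda>n. T n x) l)"
  have T': "T' x \<in> carrier H" "hlimit H (\<lambda>n. T n x) (T' x)" if "x \<in> carrier H" for x
    using someI_ex[of "\<lambda>l. l \<in> carrier H \<and> hlimit H (\<lambda>n. T n x) l"] ex[OF that] by (auto simp: T'_def)
  show ?thesis
    using that[of T'] bounded_operator_limit[OF T K T'] T'(2) by blast
qed

text \<open>With \<open>\<tau>\<close> for \<open>e\<close> these are the elements of the algebraic
  tensor product. Lists are formal sums: one element has many lists, and that a map given on
  elementary tensors does not depend on the list is proved afterwards, from a norm bound.\<close>

definition esum :: "('a \<Rightarrow> 'b \<Rightarrow> 'h) \<Rightarrow> ('a \<times> 'b) list \<Rightarrow> 'h" where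
  "esum e l = foldr (\<lambda>(f, g) v. e f g \<oplus> v) l \<zero>"

lemma esum_simps [simp]: "esum e [] = \<zero>" "esum e ((f, g) # l) = e f g \<oplus> esum e l"
  by (simp_all add: esum_def)

definition pairs :: "('a \<times> 'b) list set" where
  "pairs = {l. set l \<subseteq> carrier HA \<times> carrier HB}"

lemma pairs_simps [simp]: "[] \<in> pairs" "(f, g) # l \<in> pairs \<longleftrightarrow> f \<in> carrier HA \<and> g \<in> carrier HB \<and> l \<in> pairs"
  "l @ l' \<in> pairs \<longleftrightarrow> l \<in> pairs \<and> l' \<in> pairs"
  by (auto simp: pairs_def)

lemma pairs_induct [consumes 1, case_names Nil Cons]:
  assumes "l \<in> pairs" "Q []"
    "\<And>f g l. \<lbrakk>f \<in> carrier HA; g \<in> carrier HB; l \<in> pairs; Q l\<rbrakk> \<Longrightarrow> Q ((f, g) # l)"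
  shows "Q l"
  using assms(1) by (induction l) (auto intro: assms)

definition scale :: "complex \<Rightarrow> ('a \<times> 'b) list \<Rightarrow> ('a \<times> 'b) list" where
  "scale c = map (\<lambda>(f, g). (c \<odot>\<^bsub>HA\<^esub> f, g))"

lemma scale_pairs [simp]: "l \<in> pairs \<Longrightarrow> scale c l \<in> pairs"
  by (induction l rule: pairs_induct) (auto simp: scale_def)

context
  fixes e :: "'a \<Rightarrow> 'b \<Rightarrow> 'h"
  assumes e_closed [simp]: "\<And>f g. \<lbrakk>f \<in> carrier HA; g \<in> carrier HB\<rbrakk> \<Longrightarrow> e f g \<in> carrier H"
begin

lemma esum_closed [simp]: "l \<in> pairs \<Longrightarrow> esum e l \<in> carrier H"
  by (induction l rule: pairs_induct) auto

lemma esum_append: "l \<in> pairs \<Longrightarrow> l' \<in> pairs \<Longrightarrow> esum e (l @ l') = esum e l \<oplus> esum e l'"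
  by (induction l rule: pairs_induct) (auto simp: a_assoc)

lemma esum_scale:
  assumes "\<And>c f g. \<lbrakk>f \<in> carrier HA; g \<in> carrier HB\<rbrakk> \<Longrightarrow> e (c \<odot>\<^bsub>HA\<^esub> f) g = c \<odot> e f g"
  shows "l \<in> pairs \<Longrightarrow> esum e (scale c l) = c \<odot> esum e l"
proof (induction l rule: pairs_induct)
  case Nil then show ?case using smult_r_null[of c] by (simp add: scale_def)
next
  case (Cons f g l)
  then show ?case using assms smult_r_distr[of c "e f g" "esum e l"] by (simp add: scale_def)
qed

lemma cinner_esum_zero:
  assumes "l \<in> pairs" "y \<in> carrier H" "\<And>f g. (f, g) \<in> set l \<Longrightarrow> cinner H y (e f g) = 0"
  shows "cinner H y (esum e l) = 0"
  using assms(1,3) by (induction l rule: pairs_induct) (auto simp: cinner_zero_right cinner_add_right assms(2))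

end

lemmas tsum_closed [simp] = esum_closed[of \<tau>, OF tau_closed]
lemmas tsum_append = esum_append[of \<tau>, OF tau_closed]
lemmas tsum_scale = esum_scale[of \<tau>, OF tau_closed tau_smult_left]

text \<open>The vectors that can be approximated by finite sums form a closed subspace that contains
  the elementary tensors.\<close>

lemma tsum_dense:
  assumes "x \<in> carrier H" "d > 0"
  shows "\<exists>l\<in>pairs. hnorm H (x \<ominus> esum \<tau> l) < d"
proof -
  let ?W = "{x \<in> carrier H. \<forall>d>0. \<exists>l\<in>pairs. hnorm H (x \<ominus> esum \<tau> l) < d}"
  have "x \<in> ?W"
  proof (rule closed_subspace_total[OF closed_subspaceI])
    show "\<zero> \<in> ?W" by (auto intro!: bexI[of _ "[]"])
  next
    fix x y assume xy: "x \<in> ?W" "y \<in> ?W"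
    have "\<exists>l\<in>pairs. hnorm H ((x \<oplus> y) \<ominus> esum \<tau> l) < d" if d: "d > 0" for d
    proof -
      obtain l l' where l: "l \<in> pairs" "hnorm H (x \<ominus> esum \<tau> l) < d/2" and l': "l' \<in> pairs" "hnorm H (y \<ominus> esum \<tau> l') < d/2"
        using xy half_gt_zero[OF d] by blast
      have "(x \<oplus> y) \<ominus> esum \<tau> (l @ l') = (x \<ominus> esum \<tau> l) \<oplus> (y \<ominus> esum \<tau> l')"
        using xy l l' by (intro vector_eqI) (auto simp: tsum_append cinner_simps)
      then have "hnorm H ((x \<oplus> y) \<ominus> esum \<tau> (l @ l')) < d"
        using hnorm_triangle[of "x \<ominus> esum \<tau> l" "y \<ominus> esum \<tau> l'"] xy l l' by auto
      then show ?thesis using l l' by (intro bexI[of _ "l @ l'"]) auto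
    qed
    then show "x \<oplus> y \<in> ?W" using xy by auto
  next
    fix c x assume x: "x \<in> ?W"
    have "\<exists>l\<in>pairs. hnorm H ((c \<odot> x) \<ominus> esum \<tau> l) < d" if d: "d > 0" for d
    proof -
      \<comment> \<open>The summand 1 covers \<open>c = 0\<close>.\<close>
      have "d / (cmod c + 1) > 0" using d by (simp add: add_nonneg_pos)
      then obtain l where l: "l \<in> pairs" "hnorm H (x \<ominus> esum \<tau> l) < d / (cmod c + 1)"
        using x by blast
      have "(c \<odot> x) \<ominus> esum \<tau> (scale c l) = c \<odot> (x \<ominus> esum \<tau> l)"
        using x l by (intro vector_eqI) (auto simp: tsum_scale cinner_simps algebra_simps)
      then have "hnorm H ((c \<odot> x) \<ominus> esum \<tau> (scale c l)) = cmod c * hnorm H (x \<ominus> esum \<tau> l)"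
        using x l by (simp add: hnorm_smult)
      also have "\<dots> \<le> cmod c * (d / (cmod c + 1))" using l by (intro mult_left_mono) auto
      also have "\<dots> < (cmod c + 1) * (d / (cmod c + 1))" using d by (intro mult_strict_right_mono) (auto simp: add_nonneg_pos)
      also have "\<dots> = d" using norm_ge_zero[of c] by (simp add: add_nonneg_eq_0_iff)
      finally show ?thesis using l by (intro bexI[of _ "scale c l"]) auto
    qed
    then show "c \<odot> x \<in> ?W" using x by auto
  next
    fix X l assume X: "\<And>n. X n \<in> ?W" and l: "l \<in> carrier H" "hlimit H X l"
    have "\<exists>m\<in>pairs. hnorm H (l \<ominus> esum \<tau> m) < d" if d: "d > 0" for d
    proof -
      obtain n where n: "hnorm H (X n \<ominus> l) < d/2" using hlimitD[OF l(2), of "d/2"] d by auto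
      obtain m where m: "m \<in> pairs" "hnorm H (X n \<ominus> esum \<tau> m) < d/2" 
        using X[of n] d half_gt_zero[OF d] by blast
      have "hnorm H (l \<ominus> esum \<tau> m) \<le> hnorm H (l \<ominus> X n) + hnorm H (X n \<ominus> esum \<tau> m)"
        using X[of n] l m by (intro hnorm_dist_triangle) auto
      then show ?thesis using n m hnorm_diff_commute[of l "X n"] X[of n] l by (intro bexI[of _ m]) auto
    qed
    then show "l \<in> ?W" using l by auto
  next
    fix f g assume "f \<in> carrier HA" "g \<in> carrier HB"
    then show "\<tau> f g \<in> ?W" by (auto intro!: bexI[of _ "[(f, g)]"])
  qed (use assms in auto)
  then show ?thesis using assms by blast
qed

text \<open>The operator is obtained as the closure of its graph over the algebraic tensor product.\<close>

lemma operator_extension: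
  assumes closed: "\<And>f g. \<lbrakk>f \<in> carrier HA; g \<in> carrier HB\<rbrakk> \<Longrightarrow> e f g \<in> carrier H"
    and smult: "\<And>c f g. \<lbrakk>f \<in> carrier HA; g \<in> carrier HB\<rbrakk> \<Longrightarrow> e (c \<odot>\<^bsub>HA\<^esub> f) g = c \<odot> e f g"
    and C: "0 \<le> C" and bound: "\<And>l. l \<in> pairs \<Longrightarrow> hnorm H (esum e l) \<le> C * hnorm H (esum \<tau> l)"
  obtains T where "bounded_operator H T" "\<And>x. x \<in> carrier H \<Longrightarrow> hnorm H (T x) \<le> C * hnorm H x"
    "\<And>f g. \<lbrakk>f \<in> carrier HA; g \<in> carrier HB\<rbrakk> \<Longrightarrow> T (\<tau> f g) = e f g"
proof -
  note [simp] = esum_closed[of e, OF closed]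
  note esum_append = esum_append[of e, OF closed] and esum_scale = esum_scale[of e, OF closed smult]
  \<comment> \<open>A single list has to approximate \<open>x\<close> and \<open>v\<close> at once,
    which is what makes \<open>G\<close> the closure of the graph.\<close>
  define G where "G x v \<longleftrightarrow> x \<in> carrier H \<and> v \<in> carrier H \<and>
    (\<forall>d>0. \<exists>l\<in>pairs. hnorm H (x \<ominus> esum \<tau> l) < d \<and> hnorm H (v \<ominus> esum e l) < d)" for x v
  have G_closed: "G x v \<Longrightarrow> x \<in> carrier H" "G x v \<Longrightarrow> v \<in> carrier H" for x v by (auto simp: G_def)
  have G_bound: "hnorm H v \<le> C * hnorm H x" if G: "G x v" for x v
  proof (rule field_le_epsilon)
    fix d :: real assume d: "d > 0"
    have "d / (C + 1) > 0" using d C by simp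
    then obtain l where l: "l \<in> pairs" "hnorm H (x \<ominus> esum \<tau> l) < d / (C + 1)" "hnorm H (v \<ominus> esum e l) < d / (C + 1)"
      using G unfolding G_def by blast
    have "hnorm H v \<le> hnorm H (v \<ominus> esum e l) + hnorm H (esum e l)"
      using G_closed[OF G] l by (intro hnorm_le_dist) auto
    also have "hnorm H (esum e l) \<le> C * hnorm H (esum \<tau> l)" by (rule bound[OF l(1)])
    also have "C * hnorm H (esum \<tau> l) \<le> C * (hnorm H (esum \<tau> l \<ominus> x) + hnorm H x)"
      using G_closed[OF G] l C by (intro mult_left_mono hnorm_le_dist) auto
    also have "hnorm H (esum \<tau> l \<ominus> x) = hnorm H (x \<ominus> esum \<tau> l)"
      using G_closed[OF G] l by (intro hnorm_diff_commute) auto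
    also have "C * (hnorm H (x \<ominus> esum \<tau> l) + hnorm H x) \<le> C * (d / (C + 1) + hnorm H x)"
      using l C by (intro mult_left_mono) auto
    also have "hnorm H (v \<ominus> esum e l) \<le> d / (C + 1)" using l by simp
    also have "d / (C + 1) + C * (d / (C + 1) + hnorm H x) = (C + 1) * (d / (C + 1)) + C * hnorm H x"
      by (simp only: distrib_right distrib_left mult_1 add.assoc)
    also have "\<dots> = C * hnorm H x + d" using C by simp
    finally show "hnorm H v \<le> C * hnorm H x + d" by simp
  qed
  have G_add: "G (x \<oplus> y) (v \<oplus> w)" if G: "G x v" "G y w" for x y v w
  proof -
    have "\<exists>l\<in>pairs. hnorm H ((x \<oplus> y) \<ominus> esum \<tau> l) < d \<and> hnorm H ((v \<oplus> w) \<ominus> esum e l) < d" if "d > 0" for d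
    proof -
      have d: "d/2 > 0" using that by simp
      obtain l where l: "l \<in> pairs" "hnorm H (x \<ominus> esum \<tau> l) < d/2" "hnorm H (v \<ominus> esum e l) < d/2"
        using G(1) d unfolding G_def by blast
      obtain l' where l': "l' \<in> pairs" "hnorm H (y \<ominus> esum \<tau> l') < d/2" "hnorm H (w \<ominus> esum e l') < d/2"
        using G(2) d unfolding G_def by blast
      have eq: "(x \<oplus> y) \<ominus> esum \<tau> (l @ l') = (x \<ominus> esum \<tau> l) \<oplus> (y \<ominus> esum \<tau> l')"
        "(v \<oplus> w) \<ominus> esum e (l @ l') = (v \<ominus> esum e l) \<oplus> (w \<ominus> esum e l')"
        using G_closed[OF G(1)] G_closed[OF G(2)] l(1) l'(1)
        by (intro vector_eqI, auto simp: tsum_append esum_append cinner_simps)+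
      show ?thesis unfolding bex_simps
        using hnorm_triangle[of "x \<ominus> esum \<tau> l" "y \<ominus> esum \<tau> l'"] hnorm_triangle[of "v \<ominus> esum e l" "w \<ominus> esum e l'"]
          G_closed[OF G(1)] G_closed[OF G(2)] l l' by (intro bexI[of _ "l @ l'"]) (auto simp: eq)
    qed
    then show ?thesis using G_closed[OF G(1)] G_closed[OF G(2)] by (auto simp: G_def)
  qed
  have G_smult: "G (c \<odot> x) (c \<odot> v)" if G: "G x v" for x v c
  proof -
    have "\<exists>l\<in>pairs. hnorm H ((c \<odot> x) \<ominus> esum \<tau> l) < d \<and> hnorm H ((c \<odot> v) \<ominus> esum e l) < d" if d: "d > 0" for d
    proof -
      have d': "d / (cmod c + 1) > 0" using d by (simp add: add_nonneg_pos)
      obtain l where l: "l \<in> pairs" "hnorm H (x \<ominus> esum \<tau> l) < d / (cmod c + 1)" "hnorm H (v \<ominus> esum e l) < d / (cmod c + 1)"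
        using G d' unfolding G_def by blast
      have eq: "(c \<odot> x) \<ominus> esum \<tau> (scale c l) = c \<odot> (x \<ominus> esum \<tau> l)"
        "(c \<odot> v) \<ominus> esum e (scale c l) = c \<odot> (v \<ominus> esum e l)"
        using G_closed[OF G] l(1) by (intro vector_eqI, auto simp: tsum_scale esum_scale cinner_simps algebra_simps)+
      have "cmod c * t < d" if "0 \<le> t" "t < d / (cmod c + 1)" for t
      proof -
        have "cmod c * t \<le> (cmod c + 1) * t" using that by (intro mult_right_mono) auto
        also have "\<dots> < d" using that(2) pos_less_divide_eq[of "cmod c + 1" t d]
          by (simp only: mult.commute add_nonneg_pos norm_ge_zero zero_less_one)
        finally show ?thesis .
      qed
      then show ?thesis using G_closed[OF G] l
        by (intro bexI[of _ "scale c l"]) (auto simp: eq hnorm_smult)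
    qed
    then show ?thesis using G_closed[OF G] by (auto simp: G_def)
  qed
  \<comment> \<open>The graph contains the pair of \<open>x \<ominus> x\<close> and
    \<open>v \<ominus> w\<close>, and \<open>G_bound\<close> sends the former to zero. Independence
    of the list that represents a tensor is a special case.\<close>
  have G_unique: "v = w" if G: "G x v" "G x w" for x v w
  proof -
    have "G (x \<oplus> (-1) \<odot> x) (v \<oplus> (-1) \<odot> w)" by (intro G_add G_smult G)
    then have "hnorm H (v \<ominus> w) \<le> C * hnorm H (x \<ominus> x)"
      using G_bound G_closed[OF G(1)] G_closed[OF G(2)] by (simp add: a_minus_def uminus_eq_smult)
    then show ?thesis using G_closed[OF G(1)] G_closed[OF G(2)] by (intro eq_if_dist_le) auto
  qed
  have G_ex: "\<exists>v. G x v" if x: "x \<in> carrier H" for x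
  proof -
    define d where "d = (\<lambda>n. 1 / real (Suc n))"
    have d: "d n > 0" for n by (simp add: d_def)
    have dlim: "d \<longlonglongrightarrow> 0" unfolding d_def by (rule LIMSEQ_Suc[OF lim_1_over_n])
    obtain l where l: "\<And>n. l n \<in> pairs" "\<And>n. hnorm H (x \<ominus> esum \<tau> (l n)) < d n"
      using tsum_dense[OF x d] by metis
    have dist: "hnorm H (esum e (l m) \<ominus> esum e (l n)) \<le> C * (d m + d n)" for m n
    proof -
      \<comment> \<open>A difference of two sums is again a sum over a list, so that
        \<open>bound\<close> applies to it.\<close>
      have "esum e (l m) \<ominus> esum e (l n) = esum e (l m @ scale (-1) (l n))"
        "esum \<tau> (l m) \<ominus> esum \<tau> (l n) = esum \<tau> (l m @ scale (-1) (l n))"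
        using l(1) by (simp_all add: esum_append esum_scale tsum_append tsum_scale a_minus_def uminus_eq_smult)
      then have "hnorm H (esum e (l m) \<ominus> esum e (l n)) \<le> C * hnorm H (esum \<tau> (l m) \<ominus> esum \<tau> (l n))"
        using bound[of "l m @ scale (-1) (l n)"] l(1) by simp
      also have "\<dots> \<le> C * (d m + d n)"
        using l x C less_imp_le[OF l(2)] hnorm_diff_commute[of "esum \<tau> (l m)" x]
        by (intro mult_left_mono hnorm_dist_le[of _ x]) auto
      finally show ?thesis .
    qed
    obtain v where v: "v \<in> carrier H" "hlimit H (\<lambda>n. esum e (l n)) v"
    proof (rule cauchy_hlimit[of "\<lambda>n. esum e (l n)"])
      fix r :: real assume r: "r > 0"
      define q where "q = r / (C + 1)"
      have q: "q / 2 > 0" "(C + 1) * q = r" using C r by (auto simp: q_def)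
      obtain n0 where n0: "\<And>n. n \<ge> n0 \<Longrightarrow> norm (d n - 0) < q / 2"
        using LIMSEQ_D[OF dlim q(1)] by blast
      have "hnorm H (esum e (l m) \<ominus> esum e (l n)) \<le> r" if "m \<ge> n0" "n \<ge> n0" for m n
      proof -
        have "d m + d n \<le> q" using n0[OF that(1)] n0[OF that(2)] by simp
        then have "C * (d m + d n) \<le> (C + 1) * q"
          using C d[of m] d[of n] by (intro mult_mono) auto
        then show ?thesis using dist[of m n] q(2) by simp
      qed
      then show "\<exists>N. \<forall>m\<ge>N. \<forall>n\<ge>N. hnorm H (esum e (l m) \<ominus> esum e (l n)) \<le> r" by blast
    qed (use l in auto)
    have "\<exists>l\<in>pairs. hnorm H (x \<ominus> esum \<tau> l) < r \<and> hnorm H (v \<ominus> esum e l) < r" if r: "r > 0" for r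
    proof -
      obtain n1 where n1: "\<And>n. n \<ge> n1 \<Longrightarrow> norm (d n - 0) < r" using LIMSEQ_D[OF dlim r] by blast
      obtain n2 where n2: "\<And>n. n \<ge> n2 \<Longrightarrow> hnorm H (esum e (l n) \<ominus> v) < r" using hlimitD[OF v(2) r] by blast
      show ?thesis
        using n1[of "max n1 n2"] n2[of "max n1 n2"] l(1) l(2)[of "max n1 n2"] 
          hnorm_diff_commute[of v "esum e (l (max n1 n2))"] v
        by (intro bexI[of _ "l (max n1 n2)"]) auto
    qed
    then show ?thesis using x v by (auto simp: G_def)
  qed
  define T where "T = (\<lambda>x. SOME v. G x v)"
  have GT: "G x (T x)" if "x \<in> carrier H" for x unfolding T_def by (rule someI_ex[OF G_ex[OF that]])
  show ?thesis
  proof (rule that[of T])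
    show bnd: "hnorm H (T x) \<le> C * hnorm H x" if "x \<in> carrier H" for x by (rule G_bound[OF GT[OF that]])
    show "bounded_operator H T"
    proof (rule bounded_operatorI[OF _ _ _ bnd])
      show "T x \<in> carrier H" if "x \<in> carrier H" for x using G_closed[OF GT[OF that]] by simp
      show "T (x \<oplus> y) = T x \<oplus> T y" if "x \<in> carrier H" "y \<in> carrier H" for x y
        using that by (intro G_unique[of "x \<oplus> y"] GT G_add) auto
      show "T (c \<odot> x) = c \<odot> T x" if "x \<in> carrier H" for x c
        using that by (intro G_unique[of "c \<odot> x"] GT G_smult) auto
    qed auto
    fix f g assume fg: "f \<in> carrier HA" "g \<in> carrier HB"
    have "G (\<tau> f g) (e f g)" using fg closed by (auto simp: G_def intro!: bexI[of _ "[(f, g)]"])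
    then show "T (\<tau> f g) = e f g" using GT[of "\<tau> f g"] fg by (intro G_unique) auto
  qed
qed

text \<open>Replacing the first factors of all other summands by their components orthogonal to \<open>f\<close> and
  collecting the rest in the first summand keeps the tensor and makes the two parts orthogonal.\<close>

lemma tensor_right_bound:
  assumes B: "bounded_operator HB T" "0 \<le> C" "\<And>g. g \<in> carrier HB \<Longrightarrow> hnorm HB (T g) \<le> C * hnorm HB g"
    and "l \<in> pairs"
  shows "hnorm H (esum (\<lambda>f g. \<tau> f (T g)) l) \<le> C * hnorm H (esum \<tau> l)"
  using assms(4)
\<comment> \<open>The induction hypothesis is needed for the modified tail \<open>p l'\<close>,
  which has the length of \<open>l'\<close> but is a different list; hence induction on the
  length.\<close>
proof (induction "length l" arbitrary: l)
  case 0 then show ?case by simp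
next
  case (Suc n)
  obtain f g l' where l: "l = (f, g) # l'" using Suc(2) by (cases l) auto
  have fg: "f \<in> carrier HA" "g \<in> carrier HB" "l' \<in> pairs" and n: "n = length l'" using Suc l by auto
  have [simp]: "T g \<in> carrier HB" if "g \<in> carrier HB" for g using B(1) that by (rule B.bounded_operator_closed)
  let ?e = "\<lambda>f g. \<tau> f (T g)"
  have e_closed: "?e f g \<in> carrier H" if "f \<in> carrier HA" "g \<in> carrier HB" for f g using that by simp
  note [simp] = esum_closed[of ?e, OF e_closed]
  show ?case
  proof (cases "f = \<zero>\<^bsub>HA\<^esub>")
    case True
    then show ?thesis using Suc(1)[OF n fg(3)] fg by (simp add: l)
  next
    case False
    \<comment> \<open>The coefficient of \<open>h\<close> along \<open>f\<close>. Below,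
      \<open>p\<close> removes the parts along \<open>f\<close> from all first factors, and
      \<open>k\<close> adds the second factors, weighted with these coefficients, to the
      \<open>g\<close> of the first summand.\<close>
    define c where "c = (\<lambda>h. cinner HA h f / cinner HA f f)"
    have ff: "cinner HA f f \<noteq> 0" using A.cinner_pos[OF fg(1) False] by auto
    define p where "p = (\<lambda>l. map (\<lambda>(h, k). (h \<ominus>\<^bsub>HA\<^esub> c h \<odot>\<^bsub>HA\<^esub> f, k)) l :: ('a \<times> 'b) list)"
    define k where "k = (\<lambda>l. foldr (\<lambda>(h, k) v. c h \<odot>\<^bsub>HB\<^esub> k \<oplus>\<^bsub>HB\<^esub> v) l g)"
    have p: "p m \<in> pairs" "k m \<in> carrier HB" "length (p m) = length m"
      "\<And>h k. (h, k) \<in> set (p m) \<Longrightarrow> h \<in> carrier HA \<and> k \<in> carrier HB \<and> cinner HA f h = 0" if "m \<in> pairs" for m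
    proof -
      show "p m \<in> pairs" "k m \<in> carrier HB" "length (p m) = length m"
        using that by (induction m rule: pairs_induct) (auto simp: p_def k_def fg)
      have "cinner HA (h \<ominus>\<^bsub>HA\<^esub> c h \<odot>\<^bsub>HA\<^esub> f) f = 0" if "h \<in> carrier HA" for h
        using that fg ff by (simp add: A.cinner_diff_left A.cinner_smult_left c_def)
      then have "cinner HA f (h \<ominus>\<^bsub>HA\<^esub> c h \<odot>\<^bsub>HA\<^esub> f) = 0" if "h \<in> carrier HA" for h
        using that fg A.cinner_commute[of "h \<ominus>\<^bsub>HA\<^esub> c h \<odot>\<^bsub>HA\<^esub> f" f] by simp
      then show "h \<in> carrier HA \<and> k \<in> carrier HB \<and> cinner HA f h = 0" if "(h, k) \<in> set (p m)" for h k
        using that \<open>m \<in> pairs\<close> fg by (fastforce simp: p_def pairs_def)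
    qed
    have split: "\<tau> f g \<oplus> esum \<tau> m = \<tau> f (k m) \<oplus> esum \<tau> (p m) \<and>
        \<tau> f (T g) \<oplus> esum ?e m = \<tau> f (T (k m)) \<oplus> esum ?e (p m)" if "m \<in> pairs" for m
      using that
    proof (induction m rule: pairs_induct)
      case Nil then show ?case by (simp add: p_def k_def)
    next
      case (Cons h q m)
      note [simp] = p(1,2)[OF Cons(3)]
      have kC: "k ((h, q) # m) = c h \<odot>\<^bsub>HB\<^esub> q \<oplus>\<^bsub>HB\<^esub> k m" by (simp add: k_def)
      have pC: "p ((h, q) # m) = (h \<ominus>\<^bsub>HA\<^esub> c h \<odot>\<^bsub>HA\<^esub> f, q) # p m" by (simp add: p_def)
      show ?case
      proof
        have "\<tau> f g \<oplus> esum \<tau> ((h, q) # m) = \<tau> h q \<oplus> (\<tau> f g \<oplus> esum \<tau> m)"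
          using Cons(1-3) fg by (simp add: a_lcomm)
        also have "\<dots> = \<tau> h q \<oplus> (\<tau> f (k m) \<oplus> esum \<tau> (p m))" by (simp only: conjunct1[OF Cons(4)])
        also have "\<dots> = \<tau> f (k ((h, q) # m)) \<oplus> esum \<tau> (p ((h, q) # m))"
          using Cons(1-3) fg by (intro vector_eqI)
            (auto simp: kC pC tau_add_right tau_smult_right tau_diff_left tau_smult_left cinner_simps)
        finally show "\<tau> f g \<oplus> esum \<tau> ((h, q) # m) = \<tau> f (k ((h, q) # m)) \<oplus> esum \<tau> (p ((h, q) # m))" .
        have "\<tau> f (T g) \<oplus> esum ?e ((h, q) # m) = \<tau> h (T q) \<oplus> (\<tau> f (T g) \<oplus> esum ?e m)"
          using Cons(1-3) fg by (simp add: a_lcomm)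
        also have "\<dots> = \<tau> h (T q) \<oplus> (\<tau> f (T (k m)) \<oplus> esum ?e (p m))" by (simp only: conjunct2[OF Cons(4)])
        also have "\<dots> = \<tau> f (T (k ((h, q) # m))) \<oplus> esum ?e (p ((h, q) # m))"
          using Cons(1-3) fg by (intro vector_eqI)
            (auto simp: kC pC B.bounded_operator_add[OF B(1)] B.bounded_operator_smult[OF B(1)]
              tau_add_right tau_smult_right tau_diff_left tau_smult_left cinner_simps)
        finally show "\<tau> f (T g) \<oplus> esum ?e ((h, q) # m) = \<tau> f (T (k ((h, q) # m))) \<oplus> esum ?e (p ((h, q) # m))" .
      qed
    qed
    note [simp] = p(1,2)[OF fg(3)]
    have orth: "cinner H (\<tau> f g') (esum \<tau> (p l')) = 0" "cinner H (\<tau> f g') (esum ?e (p l')) = 0" 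
      if "g' \<in> carrier HB" for g'
      using that fg p(4)[OF fg(3)] by (auto intro!: cinner_esum_zero simp: cinner_tau)
    have "(hnorm H (esum ?e l))\<^sup>2 = (hnorm H (\<tau> f (T (k l'))))\<^sup>2 + (hnorm H (esum ?e (p l')))\<^sup>2"
      using split[OF fg(3)] fg orth by (simp add: l pythagoras)
    also have "\<dots> \<le> (C * hnorm H (\<tau> f (k l')))\<^sup>2 + (C * hnorm H (esum \<tau> (p l')))\<^sup>2"
    proof (intro add_mono power_mono)
      show "hnorm H (\<tau> f (T (k l'))) \<le> C * hnorm H (\<tau> f (k l'))"
        using fg mult_left_mono[OF B(3)[of "k l'"], of "hnorm HA f"] by (simp add: hnorm_tau mult_ac)
      show "hnorm H (esum ?e (p l')) \<le> C * hnorm H (esum \<tau> (p l'))"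
        using Suc(1)[of "p l'"] p(3)[OF fg(3)] n by simp
    qed (use fg in auto)
    also have "\<dots> = C\<^sup>2 * (hnorm H (\<tau> f (k l') \<oplus> esum \<tau> (p l')))\<^sup>2"
      using fg orth by (simp add: pythagoras power_mult_distrib algebra_simps)
    also have "\<tau> f (k l') \<oplus> esum \<tau> (p l') = esum \<tau> l" using split[OF fg(3)] l by simp
    finally have "(hnorm H (esum ?e l))\<^sup>2 \<le> (C * hnorm H (esum \<tau> l))\<^sup>2" by (simp add: power_mult_distrib)
    then show ?thesis using B(2) Suc(3) by (elim power2_le_imp_le) auto
  qed
qed

lemma tensor_right_exists:
  assumes B: "bounded_operator HB T" "0 \<le> C" "\<And>g. g \<in> carrier HB \<Longrightarrow> hnorm HB (T g) \<le> C * hnorm HB g"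
  obtains S where "bounded_operator H S" "\<And>x. x \<in> carrier H \<Longrightarrow> hnorm H (S x) \<le> C * hnorm H x"
    "\<And>f g. \<lbrakk>f \<in> carrier HA; g \<in> carrier HB\<rbrakk> \<Longrightarrow> S (\<tau> f g) = \<tau> f (T g)"
  using operator_extension[OF _ _ B(2) tensor_right_bound[OF B]]
  by (metis B.bounded_operator_closed[OF B(1)] tau_closed tau_smult_left)

end

context tensor_product
begin

text \<open>Finite sums of elementary tensors are dense and both sides are continuous.\<close>

lemma operator_bound_total:
  assumes T: "bounded_operator H T" and C: "\<And>l. l \<in> pairs \<Longrightarrow> hnorm H (T (esum \<tau> l)) \<le> C * hnorm H (esum \<tau> l)"
    and x: "x \<in> carrier H"
  shows "hnorm H (T x) \<le> C * hnorm H x"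
proof -
  define d where "d = (\<lambda>n. 1 / real (Suc n))"
  have d: "d n > 0" for n by (simp add: d_def)
  have dlim: "d \<longlonglongrightarrow> 0" unfolding d_def by (rule LIMSEQ_Suc[OF lim_1_over_n])
  obtain l where l: "\<And>n. l n \<in> pairs" "\<And>n. hnorm H (x \<ominus> esum \<tau> (l n)) < d n"
    using tsum_dense[OF x d] by metis
  have "norm (hnorm H (esum \<tau> (l n) \<ominus> x)) \<le> d n" for n
    using l x hnorm_diff_commute[of x "esum \<tau> (l n)"] less_imp_le[OF l(2)[of n]] by simp
  then have lim: "hlimit H (\<lambda>n. esum \<tau> (l n)) x"
    unfolding hlimit_def by (intro Lim_null_comparison[OF always_eventually dlim]) blast
  have "(\<lambda>n. hnorm H (T (esum \<tau> (l n)))) \<longlonglongrightarrow> hnorm H (T x)"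
    using l x by (intro hlimit_hnorm bounded_operator_hlimit[OF T] lim bounded_operator_closed[OF T]) auto
  moreover have "(\<lambda>n. C * hnorm H (esum \<tau> (l n))) \<longlonglongrightarrow> C * hnorm H x"
    using l x by (intro tendsto_mult tendsto_const hlimit_hnorm lim) auto
  ultimately show ?thesis using C l by (intro LIMSEQ_le) auto
qed

text \<open>All algebraic identities hold on elementary tensors, hence everywhere. For countable
  additivity, \<open>C\<close> yields a strong limit over the partial unions, which is identified
  with the value at the whole union on elementary tensors.\<close>

lemma tensor_right_resolution:
  assumes Q: "spectral_measure HB N Q"
    and T: "\<And>Y. Y \<in> sets N \<Longrightarrow> bounded_operator H (T Y)"
    and C: "\<And>Y x. \<lbrakk>Y \<in> sets N; x \<in> carrier H\<rbrakk> \<Longrightarrow> hnorm H (T Y x) \<le> C * hnorm H x"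
    and tau: "\<And>Y f g. \<lbrakk>Y \<in> sets N; f \<in> carrier HA; g \<in> carrier HB\<rbrakk> \<Longrightarrow> T Y (\<tau> f g) = \<tau> f (Q Y g)"
  shows "spectral_measure H N T"
proof -
  interpret Q: spectral_measure HB N Q by fact
  note [simp] = bounded_operator_closed[OF T]
  have add: "T (S \<union> S') x = T S x \<oplus> T S' x" if "S \<in> sets N" "S' \<in> sets N" "S \<inter> S' = {}" "x \<in> carrier H" for S S' x
    by (rule operator_eqI[OF T bounded_operator_sum[OF T T]]) (use that in \<open>auto simp: tau Q.E_union tau_add_right\<close>)
  have empty: "T {} x = \<zero>" if "x \<in> carrier H" for x
    using operator_eqI[OF T[of "{}"] bounded_operator_scale[OF bounded_operator_id, of 0]] that by (simp add: tau)
  have Un: "T (\<Union>i<n. S i) x = (\<Oplus>i\<in>{..<n}. T (S i) x)"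
    if "\<And>i. S i \<in> sets N" "disjoint_family S" "x \<in> carrier H" for S :: "nat \<Rightarrow> 'c set" and x and n :: nat
  proof (induction n)
    case (Suc n)
    have "(\<Union>i<n. S i) \<inter> S n = {}"
      using that(2) unfolding disjoint_family_on_def by (fastforce dest: less_imp_neq)
    moreover have "(\<Union>i<n. S i) \<in> sets N" using that(1) by (intro sets.finite_UN) auto
    ultimately have "T ((\<Union>i<n. S i) \<union> S n) x = T (\<Union>i<n. S i) x \<oplus> T (S n) x"
      using that by (intro add) auto
    moreover have "(\<Union>i<Suc n. S i) = (\<Union>i<n. S i) \<union> S n" by (auto simp: less_Suc_eq)
    moreover have "(\<Oplus>i\<in>{..<Suc n}. T (S i) x) = (\<Oplus>i\<in>{..<n}. T (S i) x) \<oplus> T (S n) x"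
      using that finsum_closed[of "\<lambda>i. T (S i) x" "{..<n}"] by (simp add: lessThan_Suc finsum_insert Pi_def a_comm)
    ultimately show ?case using Suc by simp
  qed (use that empty in simp)
  have lim: "hlimit H (\<lambda>n. \<Oplus>i\<in>{..<n}. T (S i) x) (T (\<Union>i. S i) x)"
    if S: "\<And>i. S i \<in> sets N" "disjoint_family S" and x: "x \<in> carrier H" for S :: "nat \<Rightarrow> 'c set" and x
  proof -
    have U: "(\<Union>i<n. S i) \<in> sets N" "(\<Union>i. S i) \<in> sets N" for n :: nat 
      using S(1) by (auto intro!: sets.finite_UN)
    have tl: "hlimit H (\<lambda>n. T (\<Union>i<n. S i) (\<tau> f g)) (T (\<Union>i. S i) (\<tau> f g))"
      if "f \<in> carrier HA" "g \<in> carrier HB" for f g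
      using that U Q.E_UN_limit[OF S that(2)] by (auto simp: tau intro!: tau_hlimit_right)
    have ex: "\<exists>l\<in>carrier H. hlimit H (\<lambda>n. T (\<Union>i<n. S i) (\<tau> f g)) l"
      if "f \<in> carrier HA" "g \<in> carrier HB" for f g
      using tl[OF that] bounded_operator_closed[OF T[OF U(2)] tau_closed[OF that]] by blast
    have "\<exists>T'. bounded_operator H T' \<and> (\<forall>x\<in>carrier H. hlimit H (\<lambda>n. T (\<Union>i<n. S i) x) (T' x))"
      by (rule strong_limit[of "\<lambda>n. T (\<Union>i<n. S i)" C, OF T[OF U(1)] C[OF U(1)] ex]) auto
    then obtain T' where T': "bounded_operator H T'" "\<And>x. x \<in> carrier H \<Longrightarrow> hlimit H (\<lambda>n. T (\<Union>i<n. S i) x) (T' x)"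
      by metis
    have "T' x = T (\<Union>i. S i) x"
    proof (rule operator_eqI[OF T'(1) T[OF U(2)] _ x])
      fix f g assume fg: "f \<in> carrier HA" "g \<in> carrier HB"
      show "T' (\<tau> f g) = T (\<Union>i. S i) (\<tau> f g)"
        by (rule hlimit_unique[OF _ _ _ T'(2) tl]) (use fg U bounded_operator_closed[OF T'(1)] in auto)
    qed
    then show ?thesis using T'(2)[OF x] by (simp add: Un[OF S x])
  qed
  have "resolution_of_identity H N T"
    unfolding resolution_of_identity_def
  proof (intro conjI ballI allI impI)
    show "\<exists>C. \<forall>S\<in>sets N. \<forall>x\<in>carrier H. hnorm H (T S x) \<le> C * hnorm H x" using C by blast
    fix x assume x: "x \<in> carrier H"
    show "T (space N) x = x"
      by (rule operator_eqI[OF T bounded_operator_id _ x]) (auto simp: tau)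
    fix S S' assume "S \<in> sets N" "S' \<in> sets N"
    then show "T (S \<inter> S') x = T S (T S' x)"
      by (intro operator_eqI[OF T bounded_operator_comp[OF T T] _ x]) (auto simp: tau Q.E_inter)
  qed (use T lim in auto)
  then show ?thesis by (intro spectral_measure.intro spectral_measure_axioms.intro complex_hilbert_space_axioms)
qed

end

section \<open>Strongly measurable functions\<close>

text \<open>Up to an arbitrarily small error such a function takes countably many values, each on a
  measurable set. This makes sense without a topology or separability on the carrier.\<close>

definition (in complex_hilbert_space) strongly_measurable :: "'s measure \<Rightarrow> ('s \<Rightarrow> 'v) \<Rightarrow> bool" where
  "strongly_measurable M \<Phi> \<longleftrightarrow> (\<forall>w\<in>space M. \<Phi> w \<in> carrier H) \<and>
    (\<forall>e>0. \<exists>k \<in> measurable M (count_space (UNIV :: nat set)).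
      \<forall>w\<in>space M. \<forall>w'\<in>space M. k w = k w' \<longrightarrow> hnorm H (\<Phi> w \<ominus> \<Phi> w') \<le> e)"

context complex_hilbert_space
begin

text \<open>Both indices have countable range, so \<open>F\<close> may be arbitrary. With
  \<open>prod_encode\<close> it gives a common refinement of two partitions, with a predicate it
  gives measurability of conditions on the indices.\<close>

lemma measurable_pair_code:
  assumes k: "k \<in> measurable M (count_space (UNIV :: nat set))" "k' \<in> measurable M (count_space (UNIV :: nat set))"
  shows "(\<lambda>w. F (k w) (k' w)) \<in> measurable M (count_space UNIV)"
proof (rule measurable_compose_countable[OF _ k(1)])
  show "(\<lambda>w. F i (k' w)) \<in> measurable M (count_space UNIV)" for i
    by (rule measurable_compose[OF k(2)]) simp
qed

lemma strongly_measurable_closed: "strongly_measurable M \<Phi> \<Longrightarrow> w \<in> space M \<Longrightarrow> \<Phi> w \<in> carrier H"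
  by (simp add: strongly_measurable_def)

lemma strongly_measurable_index:
  assumes "strongly_measurable M \<Phi>" "e > 0"
  obtains k where "k \<in> measurable M (count_space (UNIV :: nat set))"
    "\<And>w w'. \<lbrakk>w \<in> space M; w' \<in> space M; k w = k w'\<rbrakk> \<Longrightarrow> hnorm H (\<Phi> w \<ominus> \<Phi> w') \<le> e"
proof -
  have "\<exists>k \<in> measurable M (count_space (UNIV :: nat set)).
      \<forall>w\<in>space M. \<forall>w'\<in>space M. k w = k w' \<longrightarrow> hnorm H (\<Phi> w \<ominus> \<Phi> w') \<le> e"
    using assms unfolding strongly_measurable_def by blast
  then show ?thesis using that by blast
qed

lemma strongly_measurableI:
  assumes "\<And>w. w \<in> space M \<Longrightarrow> \<Phi> w \<in> carrier H"
    "\<And>e. e > 0 \<Longrightarrow> \<exists>k \<in> measurable M (count_space (UNIV :: nat set)).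
      \<forall>w\<in>space M. \<forall>w'\<in>space M. k w = k w' \<longrightarrow> hnorm H (\<Phi> w \<ominus> \<Phi> w') \<le> e"
  shows "strongly_measurable M \<Phi>"
  using assms by (simp add: strongly_measurable_def)

lemma strongly_measurable_cong:
  assumes "strongly_measurable M \<Phi>" "\<And>w. w \<in> space M \<Longrightarrow> \<Phi> w = \<Psi> w"
  shows "strongly_measurable M \<Psi>"
  using assms unfolding strongly_measurable_def by simp

lemma strongly_measurable_indicator:
  assumes "X \<in> sets M" "x \<in> carrier H"
  shows "strongly_measurable M (\<lambda>w. if w \<in> X then x else \<zero>)"
proof (rule strongly_measurableI)
  fix e :: real assume "e > 0"
  have [measurable]: "X \<in> sets M" by fact
  have "(\<lambda>w. if w \<in> X then 1 else 0 :: nat) \<in> measurable M (count_space UNIV)" by measurable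
  then show "\<exists>k \<in> measurable M (count_space (UNIV :: nat set)). \<forall>w\<in>space M. \<forall>w'\<in>space M. k w = k w' \<longrightarrow>
      hnorm H ((if w \<in> X then x else \<zero>) \<ominus> (if w' \<in> X then x else \<zero>)) \<le> e"
    using \<open>e > 0\<close> assms by (intro bexI[of _ "\<lambda>w. if w \<in> X then 1 else 0"]) (auto split: if_splits)
qed (use assms in auto)

lemma strongly_measurable_add:
  assumes "strongly_measurable M \<Phi>" "strongly_measurable M \<Psi>"
  shows "strongly_measurable M (\<lambda>w. \<Phi> w \<oplus> \<Psi> w)"
proof (rule strongly_measurableI)
  note [simp] = strongly_measurable_closed[OF assms(1)] strongly_measurable_closed[OF assms(2)]
  show "\<Phi> w \<oplus> \<Psi> w \<in> carrier H" if "w \<in> space M" for w using that by simp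
  fix e :: real assume e: "e > 0"
  then have "e/2 > 0" by simp
  obtain k where k: "k \<in> measurable M (count_space (UNIV :: nat set))"
    "\<And>w w'. \<lbrakk>w \<in> space M; w' \<in> space M; k w = k w'\<rbrakk> \<Longrightarrow> hnorm H (\<Phi> w \<ominus> \<Phi> w') \<le> e/2"
    using strongly_measurable_index[OF assms(1) \<open>e/2 > 0\<close>] by blast
  obtain k' where k': "k' \<in> measurable M (count_space (UNIV :: nat set))"
    "\<And>w w'. \<lbrakk>w \<in> space M; w' \<in> space M; k' w = k' w'\<rbrakk> \<Longrightarrow> hnorm H (\<Psi> w \<ominus> \<Psi> w') \<le> e/2"
    using strongly_measurable_index[OF assms(2) \<open>e/2 > 0\<close>] by blast
  have "hnorm H ((\<Phi> w \<oplus> \<Psi> w) \<ominus> (\<Phi> w' \<oplus> \<Psi> w')) \<le> e"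
    if w: "w \<in> space M" "w' \<in> space M" "prod_encode (k w, k' w) = prod_encode (k w', k' w')" for w w'
  proof -
    have "(\<Phi> w \<oplus> \<Psi> w) \<ominus> (\<Phi> w' \<oplus> \<Psi> w') = (\<Phi> w \<ominus> \<Phi> w') \<oplus> (\<Psi> w \<ominus> \<Psi> w')"
      using w by (intro vector_eqI) (auto simp: cinner_simps)
    then have "hnorm H ((\<Phi> w \<oplus> \<Psi> w) \<ominus> (\<Phi> w' \<oplus> \<Psi> w')) \<le> e/2 + e/2"
      using w k(2)[of w w'] k'(2)[of w w'] by (simp only:) (intro hnorm_triangle_le, auto)
    then show ?thesis by simp
  qed
  then show "\<exists>k \<in> measurable M (count_space (UNIV :: nat set)). \<forall>w\<in>space M. \<forall>w'\<in>space M. k w = k w' \<longrightarrow>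
      hnorm H ((\<Phi> w \<oplus> \<Psi> w) \<ominus> (\<Phi> w' \<oplus> \<Psi> w')) \<le> e"
    by (intro bexI[OF _ measurable_pair_code[OF k(1) k'(1), of "\<lambda>i j. prod_encode (i, j)"]]) blast
qed

lemma strongly_measurable_const_diff:
  assumes "strongly_measurable M \<Phi>" "x \<in> carrier H"
  shows "strongly_measurable M (\<lambda>w. x \<ominus> \<Phi> w)"
proof (rule strongly_measurableI)
  note [simp] = strongly_measurable_closed[OF assms(1)]
  show "x \<ominus> \<Phi> w \<in> carrier H" if "w \<in> space M" for w using that assms by simp
  fix e :: real assume e: "e > 0"
  obtain k where k: "k \<in> measurable M (count_space (UNIV :: nat set))"
    "\<And>w w'. \<lbrakk>w \<in> space M; w' \<in> space M; k w = k w'\<rbrakk> \<Longrightarrow> hnorm H (\<Phi> w \<ominus> \<Phi> w') \<le> e"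
    using strongly_measurable_index[OF assms(1) e] by blast
  have "(x \<ominus> \<Phi> w) \<ominus> (x \<ominus> \<Phi> w') = \<Phi> w' \<ominus> \<Phi> w" if "w \<in> space M" "w' \<in> space M" for w w'
    using that assms by (intro vector_eqI) (auto simp: cinner_simps)
  then show "\<exists>k \<in> measurable M (count_space (UNIV :: nat set)). \<forall>w\<in>space M. \<forall>w'\<in>space M. k w = k w' \<longrightarrow>
      hnorm H ((x \<ominus> \<Phi> w) \<ominus> (x \<ominus> \<Phi> w')) \<le> e"
    using k by (intro bexI[of _ k]) auto
qed

text \<open>A measurable rate of convergence. The norms of differences of the
  \<open>\<Phi> n\<close> are replaced by those of countably valued approximants \<open>u n\<close>,
  for which a Cauchy condition on tails is visibly measurable; \<open>K\<close> is the first index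
  at which it holds.\<close>

lemma strongly_measurable_limit_index:
  assumes \<Phi>: "\<And>n::nat. strongly_measurable M (\<Phi> n)"
    and \<Psi>: "\<And>w. w \<in> space M \<Longrightarrow> \<Psi> w \<in> carrier H" "\<And>w. w \<in> space M \<Longrightarrow> hlimit H (\<lambda>n. \<Phi> n w) (\<Psi> w)"
    and e: "e > 0"
  obtains K where "K \<in> measurable M (count_space (UNIV :: nat set))"
    "\<And>w n. \<lbrakk>w \<in> space M; n \<ge> K w\<rbrakk> \<Longrightarrow> hnorm H (\<Phi> n w \<ominus> \<Psi> w) \<le> e"
proof -
  note [simp] = strongly_measurable_closed[OF \<Phi>] \<Psi>(1)
  have e8: "e/8 > 0" using e by simp
  have "\<exists>k \<in> measurable M (count_space (UNIV :: nat set)).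
      \<forall>w\<in>space M. \<forall>w'\<in>space M. k w = k w' \<longrightarrow> hnorm H (\<Phi> n w \<ominus> \<Phi> n w') \<le> e/8" for n
    using \<Phi>[of n] e8 unfolding strongly_measurable_def by blast
  then obtain k where k: "\<And>n. k n \<in> measurable M (count_space (UNIV :: nat set))"
    "\<And>n w w'. \<lbrakk>w \<in> space M; w' \<in> space M; k n w = k n w'\<rbrakk> \<Longrightarrow> hnorm H (\<Phi> n w \<ominus> \<Phi> n w') \<le> e/8"
    by metis
  \<comment> \<open>A sample point of each cell; its value for an empty cell is arbitrary and never
    reached through \<open>k n w\<close>.\<close>
  define a where "a n j = (SOME w. w \<in> space M \<and> k n w = j)" for n j
  have a: "a n (k n w) \<in> space M" "k n (a n (k n w)) = k n w" if "w \<in> space M" for n w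
    using someI_ex[of "\<lambda>v. v \<in> space M \<and> k n v = k n w"] that by (auto simp: a_def)
  define u where "u n w = \<Phi> n (a n (k n w))" for n w
  have uc[simp]: "u n w \<in> carrier H" if "w \<in> space M" for n w using a[OF that] by (simp add: u_def)
  have u1: "hnorm H (u n w \<ominus> \<Phi> n w) \<le> e/8" if "w \<in> space M" for n w
    unfolding u_def using that a[OF that] by (intro k(2)) auto
  have u2: "hnorm H (\<Phi> n w \<ominus> u n w) \<le> e/8" if "w \<in> space M" for n w
    using u1[OF that, of n] hnorm_diff_commute[of "u n w" "\<Phi> n w"] that by simp
  \<comment> \<open>The threshold \<open>e/2\<close> leaves room on both sides: three errors
    \<open>e/8\<close> make \<open>R\<close> hold eventually, and two more errors \<open>e/8\<close>
    lead back from \<open>u\<close> to \<open>\<Phi>\<close> within \<open>e\<close>.\<close>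
  define R where "R N w \<longleftrightarrow> (\<forall>m\<in>{N..}. \<forall>n\<in>{N..}. hnorm H (u m w \<ominus> u n w) \<le> e/2)" for N w
  have R: "\<exists>N. R N w" if w: "w \<in> space M" for w
  proof -
    obtain N where N: "\<And>m n. \<lbrakk>m \<ge> N; n \<ge> N\<rbrakk> \<Longrightarrow> hnorm H (\<Phi> m w \<ominus> \<Phi> n w) \<le> e/8"
      using hlimit_cauchy[OF _ _ \<Psi>(2)[OF w] e8] w by auto
    have "hnorm H (u m w \<ominus> u n w) \<le> e/8 + (e/8 + e/8)" if "m \<ge> N" "n \<ge> N" for m n
      using w N[OF that] u1[OF w, of m] u2[OF w, of n]
      by (intro hnorm_dist_le[of _ "\<Phi> m w"] hnorm_dist_le[of _ "\<Phi> n w"]) auto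
    then have "R N w" unfolding R_def using e by fastforce
    then show ?thesis by blast
  qed
  have Rm: "(\<lambda>w. R N w) \<in> measurable M (count_space UNIV)" for N
  proof -
    have [measurable]: "(\<lambda>w. hnorm H (u m w \<ominus> u n w) \<le> e/2) \<in> measurable M (count_space UNIV)" for m n
      unfolding u_def by (rule measurable_pair_code[OF k(1) k(1), of "\<lambda>i j. hnorm H (\<Phi> m (a m i) \<ominus> \<Phi> n (a n j)) \<le> e/2"])
    show ?thesis unfolding R_def by measurable
  qed
  define K where "K w = (LEAST N. R N w)" for w
  show ?thesis
  proof (rule that[of K])
    show "K \<in> measurable M (count_space UNIV)"
      unfolding K_def by (rule measurable_Least[OF Rm])
    fix w n assume w: "w \<in> space M" and n: "n \<ge> K w"
    have RK: "R (K w) w" using R[OF w] unfolding K_def by (rule LeastI_ex)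
    have le: "hnorm H (\<Phi> n w \<ominus> \<Phi> m w) \<le> e" if "m \<ge> n" for m
    proof -
      have "hnorm H (u n w \<ominus> u m w) \<le> e/2" using RK n that by (auto simp: R_def)
      then have "hnorm H (\<Phi> n w \<ominus> \<Phi> m w) \<le> e/8 + (e/2 + e/8)"
        using w u2[OF w, of n] u1[OF w, of m]
        by (intro hnorm_dist_le[of _ "u n w"] hnorm_dist_le[of _ "u m w"]) auto
      then show ?thesis using e by simp
    qed
    have lim: "hlimit H (\<lambda>m. \<Phi> n w \<ominus> \<Phi> m w) (\<Phi> n w \<ominus> \<Psi> w)"
    proof -
      have "hlimit H (\<lambda>m. (-1) \<odot> \<Phi> m w) ((-1) \<odot> \<Psi> w)"
        using w by (intro bounded_operator_hlimit[OF bounded_operator_scale[OF bounded_operator_id]] \<Psi>) auto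
      then show ?thesis using w hlimit_add[OF _ _ _ _ hlimit_const[of "\<Phi> n w"], of "\<lambda>m. (-1) \<odot> \<Phi> m w"]
        by (simp add: a_minus_def uminus_eq_smult)
    qed
    show "hnorm H (\<Phi> n w \<ominus> \<Psi> w) \<le> e"
      by (rule hlimit_hnorm_le[OF _ _ lim le]) (use w in auto)
  qed
qed

text \<open>On a cell where the rate \<open>K\<close> is constant, one function
  \<open>\<Phi> (K w)\<close> is near the limit throughout; cutting further by the index of this
  function makes the limit almost constant.\<close>

lemma strongly_measurable_limit:
  assumes \<Phi>: "\<And>n::nat. strongly_measurable M (\<Phi> n)"
    and \<Psi>: "\<And>w. w \<in> space M \<Longrightarrow> \<Psi> w \<in> carrier H" "\<And>w. w \<in> space M \<Longrightarrow> hlimit H (\<lambda>n. \<Phi> n w) (\<Psi> w)"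
  shows "strongly_measurable M \<Psi>"
proof (rule strongly_measurableI)
  note [simp] = strongly_measurable_closed[OF \<Phi>] \<Psi>(1)
  fix e :: real assume e: "e > 0"
  then have e3: "e/3 > 0" by simp
  obtain K where K: "K \<in> measurable M (count_space (UNIV :: nat set))"
    "\<And>w n. \<lbrakk>w \<in> space M; n \<ge> K w\<rbrakk> \<Longrightarrow> hnorm H (\<Phi> n w \<ominus> \<Psi> w) \<le> e/3"
    using strongly_measurable_limit_index[of M \<Phi> \<Psi>, OF \<Phi> \<Psi> e3] by blast
  have "\<exists>k \<in> measurable M (count_space (UNIV :: nat set)).
      \<forall>w\<in>space M. \<forall>w'\<in>space M. k w = k w' \<longrightarrow> hnorm H (\<Phi> n w \<ominus> \<Phi> n w') \<le> e/3" for n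
    using \<Phi>[of n] e3 unfolding strongly_measurable_def by blast
  then obtain k where k: "\<And>n. k n \<in> measurable M (count_space (UNIV :: nat set))"
    "\<And>n w w'. \<lbrakk>w \<in> space M; w' \<in> space M; k n w = k n w'\<rbrakk> \<Longrightarrow> hnorm H (\<Phi> n w \<ominus> \<Phi> n w') \<le> e/3"
    by metis
  have "(\<lambda>w. k (K w) w) \<in> measurable M (count_space UNIV)"
    by (rule measurable_compose_countable[OF k(1) K(1)])
  then have m: "(\<lambda>w. prod_encode (K w, k (K w) w)) \<in> measurable M (count_space UNIV)"
    by (rule measurable_pair_code[OF K(1), of _ "\<lambda>i j. prod_encode (i, j)"])
  have "hnorm H (\<Psi> w \<ominus> \<Psi> w') \<le> e"
    if w: "w \<in> space M" "w' \<in> space M" "prod_encode (K w, k (K w) w) = prod_encode (K w', k (K w') w')" for w w'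
  proof -
    have eq: "K w' = K w" "k (K w) w = k (K w) w'" using w(3) by auto
    have "hnorm H (\<Psi> w \<ominus> \<Psi> w') \<le> e/3 + (e/3 + e/3)"
      using w K(2)[of w "K w"] K(2)[of w' "K w"] k(2)[OF w(1,2) eq(2)] eq hnorm_diff_commute[of "\<Psi> w" "\<Phi> (K w) w"]
      by (intro hnorm_dist_le[of _ "\<Phi> (K w) w"] hnorm_dist_le[of "\<Phi> (K w) w" "\<Phi> (K w) w'"]) auto
    then show ?thesis by simp
  qed
  then show "\<exists>k \<in> measurable M (count_space (UNIV :: nat set)). \<forall>w\<in>space M. \<forall>w'\<in>space M. k w = k w' \<longrightarrow>
      hnorm H (\<Psi> w \<ominus> \<Psi> w') \<le> e" by (intro bexI[OF _ m]) blast
qed (use \<Psi> in auto)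

lemma strongly_measurable_common_index:
  assumes "finite G" "\<And>g. g \<in> G \<Longrightarrow> strongly_measurable M (\<Phi> g)" "e > 0"
  shows "\<exists>k \<in> measurable M (count_space (UNIV :: nat set)).
      \<forall>g\<in>G. \<forall>w\<in>space M. \<forall>w'\<in>space M. k w = k w' \<longrightarrow> hnorm H (\<Phi> g w \<ominus> \<Phi> g w') \<le> e"
  using assms(1,2)
proof (induction G rule: finite_induct)
  case empty then show ?case by (intro bexI[of _ "\<lambda>w. 0"]) auto
next
  case (insert g G)
  then obtain k where k: "k \<in> measurable M (count_space (UNIV :: nat set))"
      "\<forall>g\<in>G. \<forall>w\<in>space M. \<forall>w'\<in>space M. k w = k w' \<longrightarrow> hnorm H (\<Phi> g w \<ominus> \<Phi> g w') \<le> e" by blast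
  obtain k' where k': "k' \<in> measurable M (count_space (UNIV :: nat set))"
    "\<And>w w'. \<lbrakk>w \<in> space M; w' \<in> space M; k' w = k' w'\<rbrakk> \<Longrightarrow> hnorm H (\<Phi> g w \<ominus> \<Phi> g w') \<le> e"
    using strongly_measurable_index[OF insert(4)[of g] assms(3)] by blast
  show ?case
    using k(2) k'(2) by (intro bexI[OF _ measurable_pair_code[OF k(1) k'(1), of "\<lambda>i j. prod_encode (i, j)"]]) auto
qed

end

lemma pair_measure_sets_induct [consumes 1, case_names rectangle compl union]:
  assumes S: "S \<in> sets (M \<Otimes>\<^sub>M N)"
    and rectangle: "\<And>X Y. \<lbrakk>X \<in> sets M; Y \<in> sets N\<rbrakk> \<Longrightarrow> R (X \<times> Y)"
    and compl: "\<And>S. \<lbrakk>S \<in> sets (M \<Otimes>\<^sub>M N); R S\<rbrakk> \<Longrightarrow> R (space M \<times> space N - S)"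
    and union: "\<And>S :: nat \<Rightarrow> _ set. \<lbrakk>disjoint_family S; \<And>i. S i \<in> sets (M \<Otimes>\<^sub>M N); \<And>i. R (S i)\<rbrakk> \<Longrightarrow> R (\<Union>i. S i)"
  shows "R S"
  using Int_stable_pair_measure_generator[of M N] pair_measure_closed[of M N] S[unfolded sets_pair_measure]
proof (induction S rule: sigma_sets_induct_disjoint)
  case empty
  then show ?case using rectangle[of "{}" "{}"] by simp
next
  case (union A)
  then show ?case by (intro assms(4)) (auto simp: sets_pair_measure)
qed (auto simp: sets_pair_measure intro: rectangle compl)

section \<open>Self-adjoint resolutions\<close>

locale self_adjoint_spectral_measure = spectral_measure +
  assumes self_adjoint: "\<lbrakk>S \<in> sets M; x \<in> carrier H; y \<in> carrier H\<rbrakk> \<Longrightarrow> cinner H (E S x) y = cinner H x (E S y)"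
begin

text \<open>Self-adjointness moves one projection to the other side, where the product of
  projections over disjoint sets is zero: the two pieces are orthogonal.\<close>

lemma hnorm_E_union:
  assumes "S \<in> sets M" "S' \<in> sets M" "S \<inter> S' = {}" "x \<in> carrier H"
  shows "(hnorm H (E (S \<union> S') x))\<^sup>2 = (hnorm H (E S x))\<^sup>2 + (hnorm H (E S' x))\<^sup>2"
proof -
  have "cinner H (E S x) (E S' x) = cinner H x (E S (E S' x))"
    using assms by (intro self_adjoint) auto
  also have "E S (E S' x) = E (S \<inter> S') x" using assms by (intro E_inter[symmetric])
  finally have "cinner H (E S x) (E S' x) = cinner H x (E (S \<inter> S') x)" .
  then show ?thesis using assms by (simp add: E_union pythagoras cinner_zero_right)
qed

lemma E_contraction:
  assumes "S \<in> sets M" "x \<in> carrier H"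
  shows "hnorm H (E S x) \<le> hnorm H x"
proof (rule power2_le_imp_le)
  have "S \<union> (space M - S) = space M" using sets.sets_into_space[OF assms(1)] by blast
  then show "(hnorm H (E S x))\<^sup>2 \<le> (hnorm H x)\<^sup>2"
    using hnorm_E_union[of S "space M - S" x] assms by simp
qed (use assms in simp)

text \<open>Squared norms add over finitely many cells by orthogonality, and countable additivity
  exhausts the space.\<close>

lemma parseval:
  assumes k: "k \<in> measurable M (count_space (UNIV :: nat set))" and x: "x \<in> carrier H"
  shows "(\<lambda>j. (hnorm H (E (k -` {j} \<inter> space M) x))\<^sup>2) sums (hnorm H x)\<^sup>2"
proof -
  let ?S = "\<lambda>j. k -` {j} \<inter> space M"
  have S: "?S j \<in> sets M" for j using measurable_sets[OF k, of "{j}"] by simp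
  have U: "(\<Union>j<n. ?S j) \<in> sets M" for n :: nat using S by (intro sets.finite_UN) auto
  have disj: "disjoint_family ?S" by (auto simp: disjoint_family_on_def)
  have "(\<Sum>j<n. (hnorm H (E (?S j) x))\<^sup>2) = (hnorm H (E (\<Union>j<n. ?S j) x))\<^sup>2" for n
  proof (induction n)
    case (Suc n)
    have "(\<Union>j<Suc n. ?S j) = (\<Union>j<n. ?S j) \<union> ?S n" by (auto simp: less_Suc_eq)
    moreover have "(\<Union>j<n. ?S j) \<inter> ?S n = {}" by auto
    ultimately show ?case using Suc hnorm_E_union[OF U S, of n n x] x by simp
  qed (use x in simp)
  moreover have "hlimit H (\<lambda>n. E (\<Union>j<n. ?S j) x) (E (\<Union>j. ?S j) x)"
    by (intro E_UN_limit S disj x)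
  moreover have "(\<Union>j. ?S j) = space M" by auto
  ultimately have "(\<lambda>n. hnorm H (E (\<Union>j<n. ?S j) x)) \<longlonglongrightarrow> hnorm H x"
    using U x by (intro hlimit_hnorm) auto
  moreover note \<open>\<And>n. (\<Sum>j<n. (hnorm H (E (?S j) x))\<^sup>2) = (hnorm H (E (\<Union>j<n. ?S j) x))\<^sup>2\<close>
  ultimately show ?thesis unfolding sums_def using x by (simp add: tendsto_power)
qed

end

section \<open>The product of two resolutions of the identity\<close>

locale spectral_tensor = tensor_product HA HB H \<tau> +
  P: self_adjoint_spectral_measure HA M P + Q: spectral_measure HB N Q
  for HA :: "('a, 'm) hilbert_scheme" and HB :: "('b, 'n) hilbert_scheme"
    and H :: "('h, 'k) hilbert_scheme" (structure) and \<tau> :: "'a \<Rightarrow> 'b \<Rightarrow> 'h"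
    and M :: "'s measure" and P :: "'s set \<Rightarrow> 'a \<Rightarrow> 'a" and N :: "'t measure" and Q :: "'t set \<Rightarrow> 'b \<Rightarrow> 'b"
begin

text \<open>The tensor product of \<open>P X\<close> with the identity; \<open>QH\<close> is that of
  the identity with \<open>Q Y\<close>. \<open>operator_extension\<close> yields existence only,
  hence the choice operator.\<close>

definition PH :: "'s set \<Rightarrow> 'h \<Rightarrow> 'h" where
  "PH X = (SOME T. bounded_operator H T \<and> (\<forall>x\<in>carrier H. hnorm H (T x) \<le> P.bnd * hnorm H x) \<and>
    (\<forall>f\<in>carrier HA. \<forall>g\<in>carrier HB. T (\<tau> f g) = \<tau> (P X f) g))"

definition QH :: "'t set \<Rightarrow> 'h \<Rightarrow> 'h" where
  "QH Y = (SOME T. bounded_operator H T \<and> (\<forall>x\<in>carrier H. hnorm H (T x) \<le> Q.bnd * hnorm H x) \<and>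
    (\<forall>f\<in>carrier HA. \<forall>g\<in>carrier HB. T (\<tau> f g) = \<tau> f (Q Y g)))"

lemma PH_spec:
  assumes X: "X \<in> sets M"
  shows "bounded_operator H (PH X)" "\<And>x. x \<in> carrier H \<Longrightarrow> hnorm H (PH X x) \<le> P.bnd * hnorm H x"
    "\<And>f g. \<lbrakk>f \<in> carrier HA; g \<in> carrier HB\<rbrakk> \<Longrightarrow> PH X (\<tau> f g) = \<tau> (P X f) g"
proof -
  have "\<exists>T. bounded_operator H T \<and> (\<forall>x\<in>carrier H. hnorm H (T x) \<le> P.bnd * hnorm H x) \<and>
    (\<forall>f\<in>carrier HA. \<forall>g\<in>carrier HB. T (\<tau> f g) = \<tau> (P X f) g)"
    by (rule tensor_product.tensor_right_exists[OF swap P.E_operator[OF X] less_imp_le[OF P.bnd_pos] P.E_bound[OF X]]) auto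
  from someI_ex[OF this] show "bounded_operator H (PH X)" "\<And>x. x \<in> carrier H \<Longrightarrow> hnorm H (PH X x) \<le> P.bnd * hnorm H x"
    "\<And>f g. \<lbrakk>f \<in> carrier HA; g \<in> carrier HB\<rbrakk> \<Longrightarrow> PH X (\<tau> f g) = \<tau> (P X f) g"
    unfolding PH_def by blast+
qed

lemma QH_spec:
  assumes Y: "Y \<in> sets N"
  shows "bounded_operator H (QH Y)" "\<And>x. x \<in> carrier H \<Longrightarrow> hnorm H (QH Y x) \<le> Q.bnd * hnorm H x"
    "\<And>f g. \<lbrakk>f \<in> carrier HA; g \<in> carrier HB\<rbrakk> \<Longrightarrow> QH Y (\<tau> f g) = \<tau> f (Q Y g)"
proof -
  have "\<exists>T. bounded_operator H T \<and> (\<forall>x\<in>carrier H. hnorm H (T x) \<le> Q.bnd * hnorm H x) \<and>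
    (\<forall>f\<in>carrier HA. \<forall>g\<in>carrier HB. T (\<tau> f g) = \<tau> f (Q Y g))"
    by (rule tensor_right_exists[OF Q.E_operator[OF Y] less_imp_le[OF Q.bnd_pos] Q.E_bound[OF Y]]) auto
  from someI_ex[OF this] show "bounded_operator H (QH Y)" "\<And>x. x \<in> carrier H \<Longrightarrow> hnorm H (QH Y x) \<le> Q.bnd * hnorm H x"
    "\<And>f g. \<lbrakk>f \<in> carrier HA; g \<in> carrier HB\<rbrakk> \<Longrightarrow> QH Y (\<tau> f g) = \<tau> f (Q Y g)"
    unfolding QH_def by blast+
qed

lemma PH_resolution: "spectral_measure H M PH"
  by (rule tensor_product.tensor_right_resolution[OF swap P.spectral_measure_axioms PH_spec(1,2)]) (auto simp: PH_spec(3))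

text \<open>Bilinear density in two rounds: for an elementary tensor on the right the identity
  extends to all vectors on the left; after conjugation the elementary tensor is on the left, and a
  second extension follows.\<close>

lemma PH_self_adjoint:
  assumes X: "X \<in> sets M" and x: "x \<in> carrier H" and y: "y \<in> carrier H"
  shows "cinner H (PH X x) y = cinner H x (PH X y)"
proof -
  note op = PH_spec(1)[OF X]
  note [simp] = bounded_operator_closed[OF op]
  have left: "x \<in> {x \<in> carrier H. cinner H (PH X x) y = cinner H x (PH X y)}"
    if y: "y \<in> carrier H" and tau: "\<And>f g. \<lbrakk>f \<in> carrier HA; g \<in> carrier HB\<rbrakk> \<Longrightarrow> cinner H (PH X (\<tau> f g)) y = cinner H (\<tau> f g) (PH X y)"
      and x: "x \<in> carrier H" for x y
  proof (rule closed_subspace_total[OF closed_subspaceI])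
    fix Z l assume Z: "\<And>n. Z n \<in> {x \<in> carrier H. cinner H (PH X x) y = cinner H x (PH X y)}"
      and l: "l \<in> carrier H" "hlimit H Z l"
    have "(\<lambda>n. cinner H (PH X (Z n)) y) \<longlonglongrightarrow> cinner H (PH X l) y"
      using Z l y by (intro hlimit_cinner bounded_operator_hlimit[OF op]) auto
    moreover have "(\<lambda>n. cinner H (Z n) (PH X y)) \<longlonglongrightarrow> cinner H l (PH X y)"
      using Z l y by (intro hlimit_cinner) auto
    ultimately have "cinner H (PH X l) y = cinner H l (PH X y)"
      using Z LIMSEQ_unique by auto
    then show "l \<in> {x \<in> carrier H. cinner H (PH X x) y = cinner H x (PH X y)}" using l by auto
  qed (use x y tau in \<open>auto simp: bounded_operator_zero[OF op] bounded_operator_add[OF op] 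
      bounded_operator_smult[OF op] cinner_add_left cinner_zero_left cinner_smult_left\<close>)
  have tau: "cinner H (PH X (\<tau> f g)) z = cinner H (\<tau> f g) (PH X z)"
    if fg: "f \<in> carrier HA" "g \<in> carrier HB" and z: "z \<in> carrier H" for f g z
  proof -
    have "cinner H (PH X z) (\<tau> f g) = cinner H z (PH X (\<tau> f g))"
      using left[of "\<tau> f g" z] fg z X by (auto simp: PH_spec(3) cinner_tau P.self_adjoint)
    then have "cnj (cinner H (PH X z) (\<tau> f g)) = cnj (cinner H z (PH X (\<tau> f g)))" by simp
    then show ?thesis
      using cinner_commute[of "PH X z" "\<tau> f g"] cinner_commute[of z "PH X (\<tau> f g)"] fg z by simp
  qed
  show ?thesis using left[OF y tau x] y by auto
qed

sublocale PH: self_adjoint_spectral_measure H M PH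
  by (intro self_adjoint_spectral_measure.intro PH_resolution self_adjoint_spectral_measure_axioms.intro)
    (rule PH_self_adjoint)

text \<open>Stands for the decomposable operators of a direct integral, which act separately over
  each value of the first spectral variable.\<close>

definition decomposable :: "('h \<Rightarrow> 'h) \<Rightarrow> bool" where
  "decomposable T \<longleftrightarrow> bounded_operator H T \<and> (\<forall>X\<in>sets M. \<forall>x\<in>carrier H. T (PH X x) = PH X (T x))"

lemma decomposableD: "decomposable T \<Longrightarrow> bounded_operator H T"
  "\<lbrakk>decomposable T; X \<in> sets M; x \<in> carrier H\<rbrakk> \<Longrightarrow> T (PH X x) = PH X (T x)"
  by (auto simp: decomposable_def)

lemma decomposable_closed: "\<lbrakk>decomposable T; x \<in> carrier H\<rbrakk> \<Longrightarrow> T x \<in> carrier H"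
  using decomposableD(1) bounded_operator_closed by blast

lemma piece_sets: "k \<in> measurable M (count_space (UNIV :: nat set)) \<Longrightarrow> k -` {j} \<inter> space M \<in> sets M"
  using measurable_sets[of k M "count_space UNIV" "{j}"] by simp

text \<open>Localisation. \<open>T\<close> commutes with the projections onto the cells, so the
  pieces of the error are the errors of the pieces of \<open>f\<close>; by Parseval on both sides
  the local estimates combine without loss, however many cells there are.\<close>

lemma decomposable_estimate:
  assumes T: "decomposable T" and k: "k \<in> measurable M (count_space (UNIV :: nat set))"
    and X: "X \<in> sets M" and f: "f \<in> carrier HA" "P X f = f" and g: "g \<in> carrier HB" and w: "w \<in> carrier HB" and d: "0 \<le> d"
    and est: "\<And>j h. \<lbrakk>h \<in> carrier HA; P (k -` {j} \<inter> space M \<inter> X) h = h; k -` {j} \<inter> space M \<inter> X \<noteq> {}\<rbrakk>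
      \<Longrightarrow> hnorm H (T (\<tau> h g) \<ominus> \<tau> h w) \<le> d * hnorm HA h"
  shows "hnorm H (T (\<tau> f g) \<ominus> \<tau> f w) \<le> d * hnorm HA f"
proof -
  let ?S = "\<lambda>j. k -` {j} \<inter> space M"
  note [simp] = decomposable_closed[OF T] piece_sets[OF k]
  define v where "v = T (\<tau> f g) \<ominus> \<tau> f w"
  have v: "v \<in> carrier H" using f g w by (simp add: v_def)
  have piece: "hnorm H (PH (?S j) v) \<le> d * hnorm HA (P (?S j) f)" for j
  proof -
    define h where "h = P (?S j) f"
    \<comment> \<open>The piece lies over \<open>X\<close> as well as over the cell, so that what is
      known on \<open>X\<close> can be used in \<open>est\<close>.\<close>
    have hE: "h = P (?S j \<inter> X) f" using f X P.E_inter[of "?S j" X f] by (simp add: h_def)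
    have h: "h \<in> carrier HA" "P (?S j \<inter> X) h = h"
      unfolding hE by (intro P.E_closed P.E_idem sets.Int piece_sets k X f(1))+
    have "PH (?S j) v = T (\<tau> h g) \<ominus> \<tau> h w"
      using f g w unfolding v_def h_def
      by (simp add: bounded_operator_diff[OF PH.E_operator] PH_spec(3) flip: decomposableD(2)[OF T])
    moreover have "hnorm H (T (\<tau> h g) \<ominus> \<tau> h w) \<le> d * hnorm HA h"
    proof (cases "?S j \<inter> X = {}")
      case True
      then have "h = \<zero>\<^bsub>HA\<^esub>" using h P.E_empty[of h] by simp
      then show ?thesis using g w by (simp add: bounded_operator_zero[OF decomposableD(1)[OF T]])
    next
      case False
      then show ?thesis using est h by blast
    qed
    ultimately show ?thesis by (simp add: h_def)
  qed
  have "(hnorm H v)\<^sup>2 \<le> d\<^sup>2 * (hnorm HA f)\<^sup>2"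
  proof (rule sums_le)
    show "(\<lambda>j. (hnorm H (PH (?S j) v))\<^sup>2) sums (hnorm H v)\<^sup>2" by (rule PH.parseval[OF k v])
    show "(\<lambda>j. d\<^sup>2 * (hnorm HA (P (?S j) f))\<^sup>2) sums (d\<^sup>2 * (hnorm HA f)\<^sup>2)"
      by (intro sums_mult P.parseval[OF k f(1)])
    show "(hnorm H (PH (?S j) v))\<^sup>2 \<le> d\<^sup>2 * (hnorm HA (P (?S j) f))\<^sup>2" for j
      unfolding power_mult_distrib[symmetric] using v by (intro power_mono piece) simp
  qed
  then have "(hnorm H v)\<^sup>2 \<le> (d * hnorm HA f)\<^sup>2" by (simp add: power_mult_distrib)
  then show ?thesis unfolding v_def[symmetric] by (rule power2_le_imp_le) (use f d in simp)
qed

lemma hnorm_tau_le: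
  "\<lbrakk>f \<in> carrier HA; g \<in> carrier HB; hnorm HB g \<le> d\<rbrakk> \<Longrightarrow> hnorm H (\<tau> f g) \<le> d * hnorm HA f"
  using mult_left_mono[of "hnorm HB g" d "hnorm HA f"] by (simp add: hnorm_tau mult.commute)

section \<open>Slices of measurable sets\<close>

abbreviation slice :: "('s \<times> 't) set \<Rightarrow> 's \<Rightarrow> 'b \<Rightarrow> 'b" where
  "slice S s \<equiv> Q (Pair s -` S)"

lemma slice_closed [simp, intro]: "\<lbrakk>S \<in> sets (M \<Otimes>\<^sub>M N); g \<in> carrier HB\<rbrakk> \<Longrightarrow> slice S s g \<in> carrier HB"
  by (intro Q.E_closed sets_Pair1)

lemma slice_compl:
  assumes "S \<in> sets (M \<Otimes>\<^sub>M N)" "s \<in> space M" "g \<in> carrier HB"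
  shows "slice (space M \<times> space N - S) s g = g \<ominus>\<^bsub>HB\<^esub> slice S s g"
proof -
  have "Pair s -` (space M \<times> space N - S) = space N - Pair s -` S" using assms(2) by auto
  then show ?thesis using assms by (simp add: Q.E_compl sets_Pair1)
qed

lemma slice_union:
  assumes "S \<in> sets (M \<Otimes>\<^sub>M N)" "S' \<in> sets (M \<Otimes>\<^sub>M N)" "S \<inter> S' = {}" "g \<in> carrier HB"
  shows "slice (S \<union> S') s g = slice S s g \<oplus>\<^bsub>HB\<^esub> slice S' s g"
  unfolding vimage_Un using assms by (intro Q.E_union sets_Pair1) auto

lemma slice_UN_limit:
  fixes S :: "nat \<Rightarrow> ('s \<times> 't) set"
  assumes "\<And>i. S i \<in> sets (M \<Otimes>\<^sub>M N)" "disjoint_family S" "g \<in> carrier HB"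
  shows "hlimit HB (\<lambda>n. slice (\<Union>i<n. S i) s g) (slice (\<Union>i. S i) s g)"
proof -
  have "disjoint_family (\<lambda>i. Pair s -` S i)" using assms(2) unfolding disjoint_family_on_def by blast
  then show ?thesis
    using Q.E_UN_limit[of "\<lambda>i. Pair s -` S i" g] assms by (simp add: vimage_UN sets_Pair1)
qed

lemma partial_union_sets:
  fixes S :: "nat \<Rightarrow> ('s \<times> 't) set"
  shows "(\<And>i. S i \<in> sets (M \<Otimes>\<^sub>M N)) \<Longrightarrow> (\<Union>i<n. S i) \<in> sets (M \<Otimes>\<^sub>M N)"
  by (intro sets.finite_UN) auto

lemma partial_union_Suc:
  fixes S :: "nat \<Rightarrow> ('s \<times> 't) set"
  assumes "disjoint_family S"
  shows "(\<Union>i<Suc n. S i) = (\<Union>i<n. S i) \<union> S n" "(\<Union>i<n. S i) \<inter> S n = {}"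
  using assms unfolding disjoint_family_on_def by (auto simp: less_Suc_eq) (metis IntI empty_iff less_irrefl)

text \<open>For a rectangle the function takes the values \<open>Q Y g\<close> and zero. For a
  countable disjoint union it is the pointwise limit over the partial unions, because
  \<open>Q\<close> is countably additive on every slice.\<close>

lemma slice_strongly_measurable:
  assumes "S \<in> sets (M \<Otimes>\<^sub>M N)" "g \<in> carrier HB"
  shows "B.strongly_measurable M (\<lambda>s. slice S s g)"
  using assms(1)
proof (induction S rule: pair_measure_sets_induct)
  case (rectangle X Y)
  then show ?case
    using assms(2) by (intro B.strongly_measurable_cong[OF B.strongly_measurable_indicator[of X M "Q Y g"]]) auto
next
  case (compl S)
  show ?case
    by (rule B.strongly_measurable_cong[OF B.strongly_measurable_const_diff[OF compl(2) assms(2)]])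
      (use compl(1) assms(2) in \<open>simp add: slice_compl\<close>)
next
  case (union S)
  have "B.strongly_measurable M (\<lambda>s. slice (\<Union>i<n. S i) s g)" for n
  proof (induction n)
    case 0
    then show ?case using B.strongly_measurable_indicator[of "{}" M "\<zero>\<^bsub>HB\<^esub>"] assms(2) by simp
  next
    case (Suc n)
    show ?case unfolding partial_union_Suc(1)[OF union(1)]
      by (rule B.strongly_measurable_cong[OF B.strongly_measurable_add[OF Suc union(3)[of n]]])
        (use slice_union[OF partial_union_sets union(2) partial_union_Suc(2)[OF union(1)] assms(2)] union(2) in simp)
  qed
  then show ?case
    by (rule B.strongly_measurable_limit) (use union assms(2) in \<open>auto intro!: slice_UN_limit slice_closed\<close>)
qed

lemma slices_index:
  assumes "finite F" "F \<subseteq> sets (M \<Otimes>\<^sub>M N) \<times> carrier HB" "e > 0"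
  obtains k where "k \<in> measurable M (count_space (UNIV :: nat set))"
    "\<And>S g s s'. \<lbrakk>(S, g) \<in> F; s \<in> space M; s' \<in> space M; k s = k s'\<rbrakk>
      \<Longrightarrow> hnorm HB (slice S s g \<ominus>\<^bsub>HB\<^esub> slice S s' g) \<le> e"
proof -
  have "\<exists>k \<in> measurable M (count_space (UNIV :: nat set)). \<forall>p\<in>F. \<forall>s\<in>space M. \<forall>s'\<in>space M. k s = k s' \<longrightarrow>
      hnorm HB ((case p of (S, g) \<Rightarrow> slice S s g) \<ominus>\<^bsub>HB\<^esub> (case p of (S, g) \<Rightarrow> slice S s' g)) \<le> e"
    using assms slice_strongly_measurable
    by (intro B.strongly_measurable_common_index[of F M "\<lambda>p s. case p of (S, g) \<Rightarrow> slice S s g"]) auto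
  then obtain k where k: "k \<in> measurable M (count_space (UNIV :: nat set))"
    "\<forall>p\<in>F. \<forall>s\<in>space M. \<forall>s'\<in>space M. k s = k s' \<longrightarrow>
      hnorm HB ((case p of (S, g) \<Rightarrow> slice S s g) \<ominus>\<^bsub>HB\<^esub> (case p of (S, g) \<Rightarrow> slice S s' g)) \<le> e"
    by blast
  show ?thesis by (rule that[OF k(1)]) (use k(2) in force)
qed

text \<open>\<open>represents S T\<close>: the operator \<open>T\<close> is the value of the product resolution at \<open>S\<close>, that is, \<open>T\<close> acts
  over the point \<open>s\<close> of the first space as \<open>Q\<close> of the slice of \<open>S\<close> at \<open>s\<close>.\<close>

definition represents :: "('s \<times> 't) set \<Rightarrow> ('h \<Rightarrow> 'h) \<Rightarrow> bool" where
  "represents S T \<longleftrightarrow> S \<in> sets (M \<Otimes>\<^sub>M N) \<and> decomposable T \<and>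
    (\<forall>X\<in>sets M. \<forall>f\<in>carrier HA. \<forall>g\<in>carrier HB. \<forall>w\<in>carrier HB. \<forall>d\<ge>0.
      P X f = f \<longrightarrow> (\<forall>s\<in>X. hnorm HB (slice S s g \<ominus>\<^bsub>HB\<^esub> w) \<le> d) \<longrightarrow>
      hnorm H (T (\<tau> f g) \<ominus> \<tau> f w) \<le> d * hnorm HA f)"

section \<open>Set operations on represented sets\<close>

lemma representsI:
  assumes "S \<in> sets (M \<Otimes>\<^sub>M N)" "decomposable T"
    "\<And>X f g w d. \<lbrakk>X \<in> sets M; f \<in> carrier HA; g \<in> carrier HB; w \<in> carrier HB; 0 \<le> d; P X f = f;
      \<And>s. s \<in> X \<Longrightarrow> hnorm HB (slice S s g \<ominus>\<^bsub>HB\<^esub> w) \<le> d\<rbrakk> \<Longrightarrow> hnorm H (T (\<tau> f g) \<ominus> \<tau> f w) \<le> d * hnorm HA f"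
  shows "represents S T"
  using assms unfolding represents_def by blast

lemma representsD:
  assumes "represents S T"
  shows "S \<in> sets (M \<Otimes>\<^sub>M N)" "decomposable T" "bounded_operator H T"
    "\<And>X f g w d. \<lbrakk>X \<in> sets M; f \<in> carrier HA; g \<in> carrier HB; w \<in> carrier HB; 0 \<le> d; P X f = f;
      \<And>s. s \<in> X \<Longrightarrow> hnorm HB (slice S s g \<ominus>\<^bsub>HB\<^esub> w) \<le> d\<rbrakk> \<Longrightarrow> hnorm H (T (\<tau> f g) \<ominus> \<tau> f w) \<le> d * hnorm HA f"
  using assms decomposableD(1) unfolding represents_def by blast+

lemma decomposable_diff: "\<lbrakk>decomposable T; decomposable R\<rbrakk> \<Longrightarrow> decomposable (\<lambda>x. T x \<ominus> R x)"
  unfolding decomposable_def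
  using bounded_operator_difference[of T R] bounded_operator_closed[of T] bounded_operator_closed[of R]
  by (simp add: bounded_operator_diff[OF PH.E_operator])

lemma decomposable_sum: "\<lbrakk>decomposable T; decomposable R\<rbrakk> \<Longrightarrow> decomposable (\<lambda>x. T x \<oplus> R x)"
  unfolding decomposable_def
  using bounded_operator_sum[of T R] bounded_operator_closed[of T] bounded_operator_closed[of R]
  by (simp add: bounded_operator_add[OF PH.E_operator])

lemma decomposable_comp: "\<lbrakk>decomposable T; decomposable R\<rbrakk> \<Longrightarrow> decomposable (\<lambda>x. T (R x))"
  unfolding decomposable_def
  using bounded_operator_comp[of T R] bounded_operator_closed[of R] by simp

lemma decomposable_id: "decomposable (\<lambda>x. x)"
  unfolding decomposable_def using bounded_operator_id by simp

lemma decomposable_PH: 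
  assumes "X \<in> sets M" shows "decomposable (PH X)"
  unfolding decomposable_def
proof (intro conjI ballI PH.E_operator assms)
  fix Y x assume "Y \<in> sets M" "x \<in> carrier H"
  then show "PH X (PH Y x) = PH Y (PH X x)"
    using PH.E_inter[of X Y x] PH.E_inter[of Y X x] assms by (simp add: Int_commute)
qed

lemma decomposable_QH: 
  assumes "Y \<in> sets N" shows "decomposable (QH Y)"
  unfolding decomposable_def
proof (intro conjI ballI QH_spec(1) assms)
  fix X x assume X: "X \<in> sets M" and x: "x \<in> carrier H"
  show "QH Y (PH X x) = PH X (QH Y x)"
    by (rule operator_eqI[OF bounded_operator_comp[OF QH_spec(1)[OF assms] PH.E_operator[OF X]]
          bounded_operator_comp[OF PH.E_operator[OF X] QH_spec(1)[OF assms]] _ x])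
      (use X assms in \<open>simp add: PH_spec(3) QH_spec(3)\<close>)
qed

lemma represents_rectangle:
  assumes X: "X \<in> sets M" and Y: "Y \<in> sets N"
  shows "represents (X \<times> Y) (\<lambda>x. PH X (QH Y x))"
proof (rule representsI)
  show "X \<times> Y \<in> sets (M \<Otimes>\<^sub>M N)" using X Y by simp
  show "decomposable (\<lambda>x. PH X (QH Y x))" by (rule decomposable_comp[OF decomposable_PH[OF X] decomposable_QH[OF Y]])
  fix Z f g w d
  assume Z: "Z \<in> sets M" and f: "f \<in> carrier HA" "P Z f = f" and g: "g \<in> carrier HB" and w: "w \<in> carrier HB"
    and d: "0 \<le> d" and est: "\<And>s. s \<in> Z \<Longrightarrow> hnorm HB (slice (X \<times> Y) s g \<ominus>\<^bsub>HB\<^esub> w) \<le> d"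
  \<comment> \<open>On each of the two cells the slice is constant, so a single sample point of a
    nonempty cell decides the estimate.\<close>
  let ?k = "\<lambda>s. if s \<in> X then 1 else 0 :: nat"
  have k: "?k \<in> measurable M (count_space UNIV)" using X by measurable
  show "hnorm H (PH X (QH Y (\<tau> f g)) \<ominus> \<tau> f w) \<le> d * hnorm HA f"
  proof (rule decomposable_estimate[OF \<open>decomposable (\<lambda>x. PH X (QH Y x))\<close> k Z f g w d])
    fix j h assume h: "h \<in> carrier HA" "P (?k -` {j} \<inter> space M \<inter> Z) h = h" and ne: "?k -` {j} \<inter> space M \<inter> Z \<noteq> {}"
    let ?S = "?k -` {j} \<inter> space M \<inter> Z"
    have S: "?S \<in> sets M" using piece_sets[OF k] Z by auto
    obtain s where s: "s \<in> ?S" using ne by blast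
    show "hnorm H (PH X (QH Y (\<tau> h g)) \<ominus> \<tau> h w) \<le> d * hnorm HA h"
    proof (cases "s \<in> X")
      case True
      then have "?S \<subseteq> X" using s by (auto split: if_splits)
      then have "P X h = h" using P.E_inter[of X ?S h] X S h by (simp add: Int_absorb1)
      moreover have "hnorm HB (Q Y g \<ominus>\<^bsub>HB\<^esub> w) \<le> d" using est[of s] s True by simp
      ultimately show ?thesis
        using hnorm_tau_le[of h "Q Y g \<ominus>\<^bsub>HB\<^esub> w" d] h g w X Y by (simp add: QH_spec(3) PH_spec(3) tau_diff_right)
    next
      case False
      then have "X \<inter> ?S = {}" using s by (auto split: if_splits)
      then have "P X h = \<zero>\<^bsub>HA\<^esub>" using P.E_inter[of X ?S h] X S h by simp
      moreover have "hnorm HB (\<zero>\<^bsub>HB\<^esub> \<ominus>\<^bsub>HB\<^esub> w) \<le> d" using est[of s] s False g by simp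
      ultimately have "PH X (QH Y (\<tau> h g)) \<ominus> \<tau> h w = \<tau> h (\<zero>\<^bsub>HB\<^esub> \<ominus>\<^bsub>HB\<^esub> w)"
        using h g w X Y by (simp add: QH_spec(3) PH_spec(3) tau_diff_right)
      then show ?thesis
        using h w \<open>hnorm HB (\<zero>\<^bsub>HB\<^esub> \<ominus>\<^bsub>HB\<^esub> w) \<le> d\<close> by (simp add: hnorm_tau_le)
    qed
  qed
qed

lemma represents_compl:
  assumes "represents S T"
  shows "represents (space M \<times> space N - S) (\<lambda>x. x \<ominus> T x)"
proof (rule representsI)
  note S = representsD(1)[OF assms]
  show "space M \<times> space N - S \<in> sets (M \<Otimes>\<^sub>M N)"
    using S by (simp flip: space_pair_measure)
  show "decomposable (\<lambda>x. x \<ominus> T x)" by (intro decomposable_diff decomposable_id representsD(2)[OF assms])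
  fix X f g w d
  assume X: "X \<in> sets M" and f: "f \<in> carrier HA" "P X f = f" and g: "g \<in> carrier HB" and w: "w \<in> carrier HB"
    and d: "0 \<le> d" and est: "\<And>s. s \<in> X \<Longrightarrow> hnorm HB (slice (space M \<times> space N - S) s g \<ominus>\<^bsub>HB\<^esub> w) \<le> d"
  have c[simp]: "T (\<tau> f g) \<in> carrier H" using f g by (simp add: bounded_operator_closed[OF representsD(3)[OF assms]])
  \<comment> \<open>The slice of the complement is near \<open>w\<close> exactly when that of
    \<open>S\<close> is near \<open>g - w\<close>.\<close>
  have "hnorm H (T (\<tau> f g) \<ominus> \<tau> f (g \<ominus>\<^bsub>HB\<^esub> w)) \<le> d * hnorm HA f"
  proof (rule representsD(4)[OF assms X f(1) g _ d f(2)])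
    fix s assume s: "s \<in> X"
    then have "s \<in> space M" using sets.sets_into_space[OF X] by auto
    have "slice S s g \<ominus>\<^bsub>HB\<^esub> (g \<ominus>\<^bsub>HB\<^esub> w) = w \<ominus>\<^bsub>HB\<^esub> (g \<ominus>\<^bsub>HB\<^esub> slice S s g)"
      using S g w by (intro B.vector_eqI) (auto simp: B.cinner_simps)
    then show "hnorm HB (slice S s g \<ominus>\<^bsub>HB\<^esub> (g \<ominus>\<^bsub>HB\<^esub> w)) \<le> d"
      using est[OF s] slice_compl[OF S \<open>s \<in> space M\<close> g] B.hnorm_diff_commute[of w "g \<ominus>\<^bsub>HB\<^esub> slice S s g"] S g w by simp
  qed (use g w in simp)
  moreover have "T (\<tau> f g) \<ominus> \<tau> f (g \<ominus>\<^bsub>HB\<^esub> w) = \<tau> f w \<ominus> (\<tau> f g \<ominus> T (\<tau> f g))"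
    using f g w by (intro vector_eqI) (auto simp: cinner_simps tau_diff_right)
  ultimately show "hnorm H (\<tau> f g \<ominus> T (\<tau> f g) \<ominus> \<tau> f w) \<le> d * hnorm HA f"
    using hnorm_diff_commute[of "\<tau> f w" "\<tau> f g \<ominus> T (\<tau> f g)"] f g w by simp
qed

text \<open>That the sum of the two slices is near \<open>w\<close> says nothing about either of
  them. On cells where both are almost constant each operator is compared with a sample value of its
  own slice, and only the sum of these values with \<open>w\<close>.\<close>

lemma represents_union:
  assumes T1: "represents S1 T1" and T2: "represents S2 T2" and disj: "S1 \<inter> S2 = {}"
  shows "represents (S1 \<union> S2) (\<lambda>x. T1 x \<oplus> T2 x)"
proof (rule representsI)
  note S1 = representsD(1)[OF T1] and S2 = representsD(1)[OF T2]
  show "S1 \<union> S2 \<in> sets (M \<Otimes>\<^sub>M N)" using S1 S2 by simp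
  show dec: "decomposable (\<lambda>x. T1 x \<oplus> T2 x)" by (intro decomposable_sum representsD(2)[OF T1] representsD(2)[OF T2])
  fix X f g w d
  assume X: "X \<in> sets M" and f: "f \<in> carrier HA" "P X f = f" and g: "g \<in> carrier HB" and w: "w \<in> carrier HB"
    and d: "0 \<le> d" and est: "\<And>s. s \<in> X \<Longrightarrow> hnorm HB (slice (S1 \<union> S2) s g \<ominus>\<^bsub>HB\<^esub> w) \<le> d"
  show "hnorm H (T1 (\<tau> f g) \<oplus> T2 (\<tau> f g) \<ominus> \<tau> f w) \<le> d * hnorm HA f"
  proof (rule field_le_epsilon)
    fix r :: real assume r: "r > 0"
    define q where "q = hnorm HA f + 1"
    \<comment> \<open>Each cell contributes two errors \<open>e\<close>, one for each
      operator.\<close>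
    define e where "e = r / 2 / q"
    have q: "q > 0" using f A.hnorm_nonneg[of f] unfolding q_def by linarith
    have e: "e > 0" "2 * e * q = r" using r q by (auto simp: e_def)
    have "finite {(S1, g), (S2, g)}" "{(S1, g), (S2, g)} \<subseteq> sets (M \<Otimes>\<^sub>M N) \<times> carrier HB" using S1 S2 g by auto
    then obtain k where k: "k \<in> measurable M (count_space (UNIV :: nat set))"
      "\<And>S h s s'. \<lbrakk>(S, h) \<in> {(S1, g), (S2, g)}; s \<in> space M; s' \<in> space M; k s = k s'\<rbrakk>
        \<Longrightarrow> hnorm HB (slice S s h \<ominus>\<^bsub>HB\<^esub> slice S s' h) \<le> e"
      using slices_index[OF _ _ e(1)] by blast
    have "hnorm H (T1 (\<tau> f g) \<oplus> T2 (\<tau> f g) \<ominus> \<tau> f w) \<le> (d + 2 * e) * hnorm HA f"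
    proof (rule decomposable_estimate[OF dec k(1) X f g w])
      fix j h assume h: "h \<in> carrier HA" "P (k -` {j} \<inter> space M \<inter> X) h = h" and ne: "k -` {j} \<inter> space M \<inter> X \<noteq> {}"
      let ?S = "k -` {j} \<inter> space M \<inter> X"
      have S: "?S \<in> sets M" using piece_sets[OF k(1)] X by auto
      obtain s where s: "s \<in> ?S" using ne by blast
      have near1: "hnorm H (T1 (\<tau> h g) \<ominus> \<tau> h (slice S1 s g)) \<le> e * hnorm HA h"
        by (rule representsD(4)[OF T1 S h(1) g _ _ h(2) k(2)]) (use s e g S1 in auto)
      have near2: "hnorm H (T2 (\<tau> h g) \<ominus> \<tau> h (slice S2 s g)) \<le> e * hnorm HA h"
        by (rule representsD(4)[OF T2 S h(1) g _ _ h(2) k(2)]) (use s e g S2 in auto)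
      have sl: "slice S1 s g \<in> carrier HB" "slice S2 s g \<in> carrier HB" using S1 S2 g by auto
      define v where "v = slice S1 s g \<oplus>\<^bsub>HB\<^esub> slice S2 s g \<ominus>\<^bsub>HB\<^esub> w"
      have v: "v \<in> carrier HB" "hnorm HB v \<le> d" 
        using est[of s] s slice_union[OF S1 S2 disj g, of s] sl w by (auto simp: v_def)
      have near3: "hnorm H (\<tau> h v) \<le> d * hnorm HA h"
        using v h by (intro hnorm_tau_le)
      have c[simp]: "T1 (\<tau> h g) \<in> carrier H" "T2 (\<tau> h g) \<in> carrier H"
        using h g by (auto intro: bounded_operator_closed representsD(3)[OF T1] representsD(3)[OF T2])
      have "T1 (\<tau> h g) \<oplus> T2 (\<tau> h g) \<ominus> \<tau> h w
          = (T1 (\<tau> h g) \<ominus> \<tau> h (slice S1 s g)) \<oplus> ((T2 (\<tau> h g) \<ominus> \<tau> h (slice S2 s g)) \<oplus> \<tau> h v)"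
        using h g w sl by (intro vector_eqI) (auto simp: v_def cinner_simps tau_diff_right tau_add_right)
      also have "hnorm H \<dots> \<le> e * hnorm HA h + (e * hnorm HA h + d * hnorm HA h)"
        using near1 near2 near3 h g v sl by (intro hnorm_triangle_le) auto
      finally show "hnorm H (T1 (\<tau> h g) \<oplus> T2 (\<tau> h g) \<ominus> \<tau> h w) \<le> (d + 2 * e) * hnorm HA h"
        by (simp add: algebra_simps)
    qed (use d e in simp)
    also have "\<dots> \<le> d * hnorm HA f + 2 * e * q" using e by (simp add: algebra_simps q_def)
    finally show "hnorm H (T1 (\<tau> f g) \<oplus> T2 (\<tau> f g) \<ominus> \<tau> f w) \<le> d * hnorm HA f + r" using e(2) by simp
  qed
qed

text \<open>The quantitative form of uniqueness: with equal sets and \<open>d = 0\<close> it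
  identifies two operators, and for different sets it yields the Cauchy property in
  \<open>represents_limit\<close>. Cells on which both slices are almost constant give the
  comparison.\<close>

lemma represents_dist:
  assumes T1: "represents S1 T1" and T2: "represents S2 T2"
    and X: "X \<in> sets M" and f: "f \<in> carrier HA" "P X f = f" and g: "g \<in> carrier HB" and d: "0 \<le> d"
    and est: "\<And>s. s \<in> X \<Longrightarrow> hnorm HB (slice S1 s g \<ominus>\<^bsub>HB\<^esub> slice S2 s g) \<le> d"
  shows "hnorm H (T1 (\<tau> f g) \<ominus> T2 (\<tau> f g)) \<le> d * hnorm HA f"
proof (rule field_le_epsilon)
  note S1 = representsD(1)[OF T1] and S2 = representsD(1)[OF T2]
  have dec: "decomposable (\<lambda>x. T1 x \<ominus> T2 x)" by (intro decomposable_diff representsD(2)[OF T1] representsD(2)[OF T2])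
  have c[simp]: "T1 (\<tau> h g) \<in> carrier H" "T2 (\<tau> h g) \<in> carrier H" if "h \<in> carrier HA" for h
    using that g by (auto intro: bounded_operator_closed representsD(3)[OF T1] representsD(3)[OF T2])
  fix r :: real assume r: "r > 0"
  define q where "q = hnorm HA f + 1"
  define e where "e = r / 2 / q"
  have q: "q > 0" using f A.hnorm_nonneg[of f] unfolding q_def by linarith
  have e: "e > 0" "2 * e * q = r" using r q by (auto simp: e_def)
  have "finite {(S1, g), (S2, g)}" "{(S1, g), (S2, g)} \<subseteq> sets (M \<Otimes>\<^sub>M N) \<times> carrier HB" using S1 S2 g by auto
  then obtain k where k: "k \<in> measurable M (count_space (UNIV :: nat set))"
    "\<And>S h s s'. \<lbrakk>(S, h) \<in> {(S1, g), (S2, g)}; s \<in> space M; s' \<in> space M; k s = k s'\<rbrakk>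
      \<Longrightarrow> hnorm HB (slice S s h \<ominus>\<^bsub>HB\<^esub> slice S s' h) \<le> e"
    using slices_index[OF _ _ e(1)] by blast
  have "hnorm H (T1 (\<tau> f g) \<ominus> T2 (\<tau> f g) \<ominus> \<tau> f \<zero>\<^bsub>HB\<^esub>) \<le> (d + 2 * e) * hnorm HA f"
  proof (rule decomposable_estimate[OF dec k(1) X f g])
    fix j h assume h: "h \<in> carrier HA" "P (k -` {j} \<inter> space M \<inter> X) h = h" and ne: "k -` {j} \<inter> space M \<inter> X \<noteq> {}"
    let ?S = "k -` {j} \<inter> space M \<inter> X"
    have S: "?S \<in> sets M" using piece_sets[OF k(1)] X by auto
    obtain s where s: "s \<in> ?S" using ne by blast
    have near1: "hnorm H (T1 (\<tau> h g) \<ominus> \<tau> h (slice S1 s g)) \<le> e * hnorm HA h"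
      by (rule representsD(4)[OF T1 S h(1) g _ _ h(2) k(2)]) (use s e g S1 in auto)
    have near2: "hnorm H (T2 (\<tau> h g) \<ominus> \<tau> h (slice S2 s g)) \<le> e * hnorm HA h"
      by (rule representsD(4)[OF T2 S h(1) g _ _ h(2) k(2)]) (use s e g S2 in auto)
    have sl: "slice S1 s g \<in> carrier HB" "slice S2 s g \<in> carrier HB" using S1 S2 g by auto
    have near3: "hnorm H (\<tau> h (slice S1 s g) \<ominus> \<tau> h (slice S2 s g)) \<le> d * hnorm HA h"
      using hnorm_tau_le[of h "slice S1 s g \<ominus>\<^bsub>HB\<^esub> slice S2 s g" d] est[of s] s sl h(1) by (simp add: tau_diff_right)
    have "hnorm H (T1 (\<tau> h g) \<ominus> T2 (\<tau> h g)) \<le> e * hnorm HA h + (d * hnorm HA h + e * hnorm HA h)"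
      using near1 near2 near3 h g sl hnorm_diff_commute[of "T2 (\<tau> h g)" "\<tau> h (slice S2 s g)"]
      by (intro hnorm_dist_le[of _ "\<tau> h (slice S1 s g)"] hnorm_dist_le[of "\<tau> h (slice S1 s g)" "\<tau> h (slice S2 s g)"]) auto
    then show "hnorm H (T1 (\<tau> h g) \<ominus> T2 (\<tau> h g) \<ominus> \<tau> h \<zero>\<^bsub>HB\<^esub>) \<le> (d + 2 * e) * hnorm HA h"
      using h g by (simp add: algebra_simps)
  qed (use d e in auto)
  also have "\<dots> \<le> d * hnorm HA f + 2 * e * q" using e by (simp add: algebra_simps q_def)
  finally show "hnorm H (T1 (\<tau> f g) \<ominus> T2 (\<tau> f g)) \<le> d * hnorm HA f + r" using e(2) f g by simp
qed

lemma represents_unique: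
  assumes T1: "represents S T1" and T2: "represents S T2" and x: "x \<in> carrier H"
  shows "T1 x = T2 x"
proof (rule operator_eqI[OF representsD(3)[OF T1] representsD(3)[OF T2] _ x])
  fix f g assume fg: "f \<in> carrier HA" "g \<in> carrier HB"
  have "hnorm H (T1 (\<tau> f g) \<ominus> T2 (\<tau> f g)) \<le> 0 * hnorm HA f"
    using fg representsD(1)[OF T1] by (intro represents_dist[OF T1 T2 sets.top]) auto
  then show "T1 (\<tau> f g) = T2 (\<tau> f g)"
    using fg by (intro eq_if_dist_le) (auto intro: bounded_operator_closed representsD(3)[OF T1] representsD(3)[OF T2])
qed

lemma slice_inter:
  assumes "S \<in> sets (M \<Otimes>\<^sub>M N)" "S' \<in> sets (M \<Otimes>\<^sub>M N)" "g \<in> carrier HB"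
  shows "slice (S \<inter> S') s g = slice S s (slice S' s g)"
  unfolding vimage_Int using assms by (intro Q.E_inter sets_Pair1)

text \<open>On a cell where the slice of \<open>S2\<close> is almost a constant \<open>v\<close>,
  applying \<open>T2\<close> to a tensor replaces \<open>g\<close> by \<open>v\<close>; the estimate
  for \<open>T1\<close> with \<open>v\<close> in place of \<open>g\<close> then gives the slice of
  the intersection.\<close>

lemma represents_inter:
  assumes T1: "represents S1 T1" and T2: "represents S2 T2"
  shows "represents (S1 \<inter> S2) (\<lambda>x. T1 (T2 x))"
proof (rule representsI)
  note S1 = representsD(1)[OF T1] and S2 = representsD(1)[OF T2]
  obtain C where C: "C > 0" "\<And>x. x \<in> carrier H \<Longrightarrow> hnorm H (T1 x) \<le> C * hnorm H x"
    using bounded_operator_bound[OF representsD(3)[OF T1]] by blast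
  show "S1 \<inter> S2 \<in> sets (M \<Otimes>\<^sub>M N)" using S1 S2 by simp
  show dec: "decomposable (\<lambda>x. T1 (T2 x))" by (rule decomposable_comp[OF representsD(2)[OF T1] representsD(2)[OF T2]])
  fix X f g w d
  assume X: "X \<in> sets M" and f: "f \<in> carrier HA" "P X f = f" and g: "g \<in> carrier HB" and w: "w \<in> carrier HB"
    and d: "0 \<le> d" and est: "\<And>s. s \<in> X \<Longrightarrow> hnorm HB (slice (S1 \<inter> S2) s g \<ominus>\<^bsub>HB\<^esub> w) \<le> d"
  show "hnorm H (T1 (T2 (\<tau> f g)) \<ominus> \<tau> f w) \<le> d * hnorm HA f"
  proof (rule field_le_epsilon)
    fix r :: real assume r: "r > 0"
    \<comment> \<open>The error made by replacing the slice of \<open>S2\<close> with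
      \<open>v\<close> is multiplied by \<open>C\<close> when \<open>T1\<close> is applied and by
      \<open>Q.bnd\<close> inside the slice of \<open>S1\<close>.\<close>
    define q where "q = (C + Q.bnd) * (hnorm HA f + 1)"
    have pos: "hnorm HA f + 1 > 0" using f A.hnorm_nonneg[of f] by linarith
    have q: "q > 0" using pos C(1) Q.bnd_pos by (simp add: q_def)
    define e where "e = r / q"
    have e: "e > 0" "e * q = r" using r q by (auto simp: e_def)
    obtain k where k: "k \<in> measurable M (count_space (UNIV :: nat set))"
      "\<And>s s'. \<lbrakk>s \<in> space M; s' \<in> space M; k s = k s'\<rbrakk> \<Longrightarrow> hnorm HB (slice S2 s g \<ominus>\<^bsub>HB\<^esub> slice S2 s' g) \<le> e"
      using B.strongly_measurable_index[OF slice_strongly_measurable[OF S2 g] e(1)] by blast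
    have "hnorm H (T1 (T2 (\<tau> f g)) \<ominus> \<tau> f w) \<le> (C * e + (Q.bnd * e + d)) * hnorm HA f"
    proof (rule decomposable_estimate[OF dec k(1) X f g w])
      fix j h assume h: "h \<in> carrier HA" "P (k -` {j} \<inter> space M \<inter> X) h = h" and ne: "k -` {j} \<inter> space M \<inter> X \<noteq> {}"
      let ?S = "k -` {j} \<inter> space M \<inter> X"
      have S: "?S \<in> sets M" using piece_sets[OF k(1)] X by auto
      obtain s where s: "s \<in> ?S" using ne by blast
      define v where "v = slice S2 s g"
      have v: "v \<in> carrier HB" using S2 g by (simp add: v_def)
      have c[simp]: "T2 (\<tau> h g) \<in> carrier H" "T1 (T2 (\<tau> h g)) \<in> carrier H" "T1 (\<tau> h v) \<in> carrier H"
        using h g v by (auto intro!: bounded_operator_closed[OF representsD(3)[OF T1]] bounded_operator_closed[OF representsD(3)[OF T2]])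
      have near2: "hnorm H (T2 (\<tau> h g) \<ominus> \<tau> h v) \<le> e * hnorm HA h"
        unfolding v_def by (rule representsD(4)[OF T2 S h(1) g _ _ h(2) k(2)]) (use s e g S2 in auto)
      have "hnorm H (T1 (T2 (\<tau> h g)) \<ominus> T1 (\<tau> h v)) = hnorm H (T1 (T2 (\<tau> h g) \<ominus> \<tau> h v))"
        using h v by (simp add: bounded_operator_diff[OF representsD(3)[OF T1]])
      also have "\<dots> \<le> C * hnorm H (T2 (\<tau> h g) \<ominus> \<tau> h v)" using h v by (intro C(2)) simp
      also have "\<dots> \<le> C * (e * hnorm HA h)" using near2 C(1) by (intro mult_left_mono) auto
      finally have a: "hnorm H (T1 (T2 (\<tau> h g)) \<ominus> T1 (\<tau> h v)) \<le> C * (e * hnorm HA h)" .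
      have b: "hnorm H (T1 (\<tau> h v) \<ominus> \<tau> h w) \<le> (Q.bnd * e + d) * hnorm HA h"
      proof (rule representsD(4)[OF T1 S h(1) v w _ h(2)])
        fix s' assume s': "s' \<in> ?S"
        have sp: "Pair s' -` S1 \<in> sets N" using S1 by (rule sets_Pair1)
        have "hnorm HB (slice S1 s' v \<ominus>\<^bsub>HB\<^esub> slice S1 s' (slice S2 s' g)) = hnorm HB (slice S1 s' (v \<ominus>\<^bsub>HB\<^esub> slice S2 s' g))"
          using v S2 g by (simp add: B.bounded_operator_diff[OF Q.E_operator[OF sp]])
        also have "\<dots> \<le> Q.bnd * hnorm HB (v \<ominus>\<^bsub>HB\<^esub> slice S2 s' g)" using v S2 g by (intro Q.E_bound sp) auto
        also have "\<dots> \<le> Q.bnd * e" using k(2)[of s s'] s s' Q.bnd_pos by (intro mult_left_mono) (auto simp: v_def)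
        finally show "hnorm HB (slice S1 s' v \<ominus>\<^bsub>HB\<^esub> w) \<le> Q.bnd * e + d"
          using est[of s'] s' slice_inter[OF S1 S2 g, of s'] v w S1 S2 g
          by (intro B.hnorm_dist_le[of _ "slice S1 s' (slice S2 s' g)"]) auto
      qed (use d e Q.bnd_pos in simp)
      have "hnorm H (T1 (T2 (\<tau> h g)) \<ominus> \<tau> h w) \<le> C * (e * hnorm HA h) + (Q.bnd * e + d) * hnorm HA h"
        using a b h v w by (intro hnorm_dist_le[of _ "T1 (\<tau> h v)"]) auto
      then show "hnorm H (T1 (T2 (\<tau> h g)) \<ominus> \<tau> h w) \<le> (C * e + (Q.bnd * e + d)) * hnorm HA h"
        by (simp add: algebra_simps)
    qed (use d e C Q.bnd_pos in simp)
    also have "\<dots> = d * hnorm HA f + e * ((C + Q.bnd) * hnorm HA f)" by (simp add: algebra_simps)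
    also have "\<dots> \<le> d * hnorm HA f + e * q"
      unfolding q_def using e C Q.bnd_pos by (intro add_left_mono mult_left_mono) auto
    finally show "hnorm H (T1 (T2 (\<tau> f g)) \<ominus> \<tau> f w) \<le> d * hnorm HA f + r" using e(2) by simp
  qed
qed

end

section \<open>Uniform bound, limits and existence\<close>

context spectral_tensor
begin

text \<open>Over a fine cell \<open>T\<close> is almost one operator \<open>QH Y\<close>, whose
  bound is \<open>Q.bnd\<close>. The cells are orthogonal and preserved by \<open>T\<close>, so the
  same constant bounds \<open>T\<close> on the whole, up to errors that vanish with
  \<open>e\<close>.\<close>

lemma represents_bound:
  assumes T: "represents S T" and x: "x \<in> carrier H"
  shows "hnorm H (T x) \<le> Q.bnd * hnorm H x"
proof (rule operator_bound_total[OF representsD(3)[OF T] _ x])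
  note S = representsD(1)[OF T] and opT = representsD(3)[OF T]
  note [simp] = bounded_operator_closed[OF opT]
  fix l assume l: "l \<in> pairs"
  \<comment> \<open>Bounds the sum of the \<open>(b j)\<^sup>2\<close> below. It doubles with every
    summand because of \<open>(p + b)\<^sup>2 \<le> 2 * p\<^sup>2 + 2 * b\<^sup>2\<close>; only its
    independence of \<open>e\<close> and of the partition matters.\<close>
  define D where "D l = foldr (\<lambda>(f, g) c. 2 * (hnorm HA f)\<^sup>2 + 2 * c) l 0" for l :: "('a \<times> 'b) list"
  have D: "0 \<le> D l" for l by (induction l) (auto simp: D_def)
  define x where "x = esum \<tau> l"
  have x: "x \<in> carrier H" using l by (simp add: x_def)
  define C where "C = Q.bnd"
  have C: "C > 0" using Q.bnd_pos by (simp add: C_def)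
  have "(hnorm H (T x))\<^sup>2 \<le> (C * hnorm H x)\<^sup>2"
  proof (rule field_le_epsilon)
    fix r :: real assume r: "r > 0"
    \<comment> \<open>The coefficient of \<open>e\<close> in the final estimate, made positive by
      the summand 1.\<close>
    define q where "q = C\<^sup>2 * (hnorm H x)\<^sup>2 + 2 * D l + 1"
    have q: "q > 0" using D[of l] by (simp add: q_def add_nonneg_pos)
    define e where "e = min 1 (r / q)"
    have e: "0 < e" "e \<le> 1" "e * q \<le> r" using r q by (auto simp: e_def min_def field_simps)
    have F: "finite ((\<lambda>(f, g). (S, g)) ` set l)" "(\<lambda>(f, g). (S, g)) ` set l \<subseteq> sets (M \<Otimes>\<^sub>M N) \<times> carrier HB"
      using l S by (auto simp: pairs_def)
    obtain k where k: "k \<in> measurable M (count_space (UNIV :: nat set))"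
      "\<And>R g s s'. \<lbrakk>(R, g) \<in> (\<lambda>(f, g). (S, g)) ` set l; s \<in> space M; s' \<in> space M; k s = k s'\<rbrakk>
        \<Longrightarrow> hnorm HB (slice R s g \<ominus>\<^bsub>HB\<^esub> slice R s' g) \<le> e"
      using slices_index[OF F e(1)] by blast
    \<comment> \<open>A sample point of each cell. For an empty cell it is arbitrary, and the
      estimate over that cell is vacuous.\<close>
    define a where "a j = (SOME s. s \<in> space M \<and> k s = j)" for j
    have a: "a (k s) \<in> space M" "k (a (k s)) = k s" if "s \<in> space M" for s
      using someI_ex[of "\<lambda>v. v \<in> space M \<and> k v = k s"] that by (auto simp: a_def)
    let ?X = "\<lambda>j. k -` {j} \<inter> space M" and ?Y = "\<lambda>j. Pair (a j) -` S"
    have X: "?X j \<in> sets M" for j by (rule piece_sets[OF k(1)])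
    have Y: "?Y j \<in> sets N" for j using S by (rule sets_Pair1)
    note [simp] = bounded_operator_closed[OF QH_spec(1)[OF Y]] PH.E_closed[OF X] P.E_closed[OF X] Q.E_closed[OF Y]
    let ?err = "\<lambda>j y. T (PH (?X j) y) \<ominus> QH (?Y j) (PH (?X j) y)"
    \<comment> \<open>The number of cells is infinite, so a uniform error per cell would be useless.
      The weights \<open>b j\<close> are square summable because they are built from norms of pieces
      of the vectors \<open>f\<close> over the cells.\<close>
    have "\<exists>b. (\<forall>j. hnorm H (?err j (esum \<tau> m)) \<le> e * b j) \<and> (\<forall>j. 0 \<le> b j) \<and> summable (\<lambda>j. (b j)\<^sup>2) \<and> (\<Sum>j. (b j)\<^sup>2) \<le> D m"
      if "m \<in> pairs" "set m \<subseteq> set l" for m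
      using that
    proof (induction m rule: pairs_induct)
      case Nil
      then show ?case
        by (intro exI[of _ "\<lambda>j. 0"])
          (auto simp: D_def bounded_operator_zero[OF opT] bounded_operator_zero[OF QH_spec(1)[OF Y]] bounded_operator_zero[OF PH.E_operator[OF X]])
    next
      case (Cons f g m)
      then obtain b where b: "\<And>j. hnorm H (?err j (esum \<tau> m)) \<le> e * b j" "\<And>j. 0 \<le> b j" 
        "summable (\<lambda>j. (b j)\<^sup>2)" "(\<Sum>j. (b j)\<^sup>2) \<le> D m" by auto
      let ?p = "\<lambda>j. hnorm HA (P (?X j) f)"
      have sums: "(\<lambda>j. (?p j)\<^sup>2) sums (hnorm HA f)\<^sup>2" by (rule P.parseval[OF k(1) Cons(1)])
      have le: "(?p j + b j)\<^sup>2 \<le> 2 * (?p j)\<^sup>2 + 2 * (b j)\<^sup>2" for j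
        using zero_le_power2[of "?p j - b j"] by (simp add: power2_eq_square algebra_simps)
      have "(\<lambda>j. 2 * (?p j)\<^sup>2 + 2 * (b j)\<^sup>2) sums (2 * (hnorm HA f)\<^sup>2 + 2 * (\<Sum>j. (b j)\<^sup>2))"
        by (intro sums_add sums_mult sums summable_sums b)
      note dom = this
      have summ: "summable (\<lambda>j. (?p j + b j)\<^sup>2)"
        by (rule summable_comparison_test'[OF sums_summable[OF dom]]) (use le in simp)
      have "(\<Sum>j. (?p j + b j)\<^sup>2) \<le> 2 * (hnorm HA f)\<^sup>2 + 2 * (\<Sum>j. (b j)\<^sup>2)"
        by (rule sums_le[OF le summable_sums[OF summ] dom])
      also have "\<dots> \<le> D ((f, g) # m)" using b(4) by (simp add: D_def)
      finally have total: "(\<Sum>j. (?p j + b j)\<^sup>2) \<le> D ((f, g) # m)" .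
      have "hnorm H (?err j (esum \<tau> ((f, g) # m))) \<le> e * (?p j + b j)" for j
      proof -
        define h where "h = P (?X j) f"
        have h: "h \<in> carrier HA" "P (?X j) h = h" using Cons(1) X[of j] by (auto simp: h_def)
        have near: "hnorm H (T (\<tau> h g) \<ominus> \<tau> h (Q (?Y j) g)) \<le> e * hnorm HA h"
        proof (rule representsD(4)[OF T X h(1) Cons(2) _ _ h(2)])
          fix s assume s: "s \<in> ?X j"
          then have "k s = j" "s \<in> space M" by auto
          then show "hnorm HB (slice S s g \<ominus>\<^bsub>HB\<^esub> Q (?Y j) g) \<le> e"
            using a[of s] Cons(5) by (intro k(2)) (auto intro!: image_eqI[where x="(f, g)"])
        qed (use Cons e in auto)
        have "?err j (esum \<tau> ((f, g) # m)) = (T (\<tau> h g) \<ominus> \<tau> h (Q (?Y j) g)) \<oplus> ?err j (esum \<tau> m)"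
          using Cons(1-3) h(1) X[of j] Y[of j]
          by (intro vector_eqI) (auto simp: h_def bounded_operator_add[OF PH.E_operator[OF X]] bounded_operator_add[OF opT]
              bounded_operator_add[OF QH_spec(1)[OF Y]] PH_spec(3) QH_spec(3) cinner_simps)
        also have "hnorm H \<dots> \<le> e * ?p j + e * b j"
          using near b(1)[of j] h(1) Cons(1-3) by (intro hnorm_triangle_le) (auto simp: h_def)
        finally show ?thesis by (simp add: algebra_simps)
      qed
      then show ?case using summ total b(2) Cons(1) by (intro exI[of _ "\<lambda>j. ?p j + b j"]) auto
    qed
    from this[OF l order_refl] obtain b where b: "\<And>j. hnorm H (?err j x) \<le> e * b j" "\<And>j. 0 \<le> b j" 
      "summable (\<lambda>j. (b j)\<^sup>2)" "(\<Sum>j. (b j)\<^sup>2) \<le> D l" unfolding x_def by blast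
    let ?a = "\<lambda>j. hnorm H (PH (?X j) x)"
    \<comment> \<open>In the square of \<open>e * b j + C * ?a j\<close> the mixed term carries a
      factor \<open>e\<close> and is split by \<open>2 * u * v \<le> u\<^sup>2 + v\<^sup>2\<close>;
      the coefficient of the main term thus tends to \<open>C\<^sup>2\<close>.\<close>
    have le: "(hnorm H (PH (?X j) (T x)))\<^sup>2 \<le> (1 + e) * C\<^sup>2 * (?a j)\<^sup>2 + (e + e\<^sup>2) * (b j)\<^sup>2" for j
    proof -
      have "hnorm H (T (PH (?X j) x)) \<le> hnorm H (?err j x) + hnorm H (QH (?Y j) (PH (?X j) x))"
        using x by (intro hnorm_le_dist) auto
      also have "\<dots> \<le> e * b j + C * ?a j"
        unfolding C_def using x by (intro add_mono b(1) QH_spec(2)[OF Y]) auto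
      finally have "(hnorm H (PH (?X j) (T x)))\<^sup>2 \<le> (e * b j + C * ?a j)\<^sup>2"
        using x by (intro power_mono) (auto simp: decomposableD(2)[OF representsD(2)[OF T] X])
      also have "\<dots> = e\<^sup>2 * (b j)\<^sup>2 + e * (2 * (b j * (C * ?a j))) + C\<^sup>2 * (?a j)\<^sup>2"
        by (simp add: power2_eq_square algebra_simps)
      also have "2 * (b j * (C * ?a j)) \<le> (b j)\<^sup>2 + (C * ?a j)\<^sup>2"
        using sum_squares_bound[of "b j" "C * ?a j"] by (simp add: mult.assoc)
      finally show ?thesis using e by (simp add: power_mult_distrib algebra_simps mult_left_mono)
    qed
    have "(hnorm H (T x))\<^sup>2 \<le> (1 + e) * C\<^sup>2 * (hnorm H x)\<^sup>2 + (e + e\<^sup>2) * (\<Sum>j. (b j)\<^sup>2)"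
      by (rule sums_le[OF le PH.parseval[OF k(1)]])
        (use x b(3) in \<open>auto intro!: sums_add sums_mult PH.parseval[OF k(1)] summable_sums\<close>)
    also have "\<dots> \<le> (1 + e) * C\<^sup>2 * (hnorm H x)\<^sup>2 + (e + e * 1) * D l"
      using e b(4) D[of l] suminf_nonneg[OF b(3)] unfolding power2_eq_square[of e]
      by (intro add_left_mono mult_mono) (auto simp: mult_left_le)
    also have "\<dots> \<le> (C * hnorm H x)\<^sup>2 + e * q" using e by (simp add: q_def power_mult_distrib algebra_simps)
    finally show "(hnorm H (T x))\<^sup>2 \<le> (C * hnorm H x)\<^sup>2 + r" using e(3) by simp
  qed
  then have "hnorm H (T x) \<le> C * hnorm H x" by (rule power2_le_imp_le) (use x C in simp)
  then show "hnorm H (T (esum \<tau> l)) \<le> Q.bnd * hnorm H (esum \<tau> l)" by (simp add: x_def C_def)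
qed

text \<open>Egorov's theorem, with the norm of \<open>P\<close> applied to \<open>f\<close> in the
  role of a finite measure. The rate \<open>K\<close> is measurable, and the sets where it is at
  most \<open>m\<close> increase to the whole space.\<close>

lemma egorov:
  assumes S: "\<And>n::nat. S n \<in> sets (M \<Otimes>\<^sub>M N)" "S' \<in> sets (M \<Otimes>\<^sub>M N)"
    and conv: "\<And>s. s \<in> space M \<Longrightarrow> hlimit HB (\<lambda>n. slice (S n) s g) (slice S' s g)"
    and f: "f \<in> carrier HA" and g: "g \<in> carrier HB" and e: "e > 0"
  obtains X m where "X \<in> sets M" "hnorm HA (f \<ominus>\<^bsub>HA\<^esub> P X f) \<le> e"
    "\<And>n s. \<lbrakk>n \<ge> m; s \<in> X\<rbrakk> \<Longrightarrow> hnorm HB (slice (S n) s g \<ominus>\<^bsub>HB\<^esub> slice S' s g) \<le> e"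
proof -
  obtain K where K: "K \<in> measurable M (count_space (UNIV :: nat set))"
    "\<And>s n. \<lbrakk>s \<in> space M; n \<ge> K s\<rbrakk> \<Longrightarrow> hnorm HB (slice (S n) s g \<ominus>\<^bsub>HB\<^esub> slice S' s g) \<le> e"
    using B.strongly_measurable_limit_index[of M "\<lambda>n s. slice (S n) s g" "\<lambda>s. slice S' s g" e,
        OF slice_strongly_measurable[OF S(1) g] slice_closed[OF S(2) g] conv e] by blast
  define X where "X m = K -` {..m} \<inter> space M" for m
  have X: "X m \<in> sets M" for m unfolding X_def using measurable_sets[OF K(1)] by simp
  have "incseq X" by (auto simp: X_def incseq_def)
  then have "hlimit HA (\<lambda>m. P (X m) f) (P (\<Union>m. X m) f)" by (intro P.E_incseq X f)
  moreover have "(\<Union>m. X m) = space M" by (auto simp: X_def)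
  ultimately have "hlimit HA (\<lambda>m. P (X m) f) f" using f by simp
  then obtain m where "hnorm HA (P (X m) f \<ominus>\<^bsub>HA\<^esub> f) < e" using A.hlimitD[OF _ e] by blast
  then have "hnorm HA (f \<ominus>\<^bsub>HA\<^esub> P (X m) f) \<le> e"
    using A.hnorm_diff_commute[of f "P (X m) f"] f X by simp
  then show ?thesis by (intro that[of "X m" m] X) (auto simp: X_def intro!: K(2))
qed

text \<open>\<open>f\<close> is split into \<open>P X f\<close>, over which the slices converge
  uniformly, and a rest of small norm that \<open>represents_bound\<close> controls for all
  \<open>n\<close> at once. The first part is handled by \<open>represents_dist\<close> for
  convergence, and by the estimate for \<open>T n\<close> for the limit.\<close>

lemma represents_limit:
  assumes T: "\<And>n::nat. represents (S n) (T n)" and S': "S' \<in> sets (M \<Otimes>\<^sub>M N)"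
    and conv: "\<And>s g. \<lbrakk>s \<in> space M; g \<in> carrier HB\<rbrakk> \<Longrightarrow> hlimit HB (\<lambda>n. slice (S n) s g) (slice S' s g)"
  obtains T' where "represents S' T'" "\<And>x. x \<in> carrier H \<Longrightarrow> hlimit H (\<lambda>n. T n x) (T' x)"
proof -
  note S = representsD(1)[OF T] and opT = representsD(3)[OF T]
  note [simp] = bounded_operator_closed[OF opT]
  define C where "C = Q.bnd"
  have C: "C > 0" using Q.bnd_pos by (simp add: C_def)
  have bnd: "hnorm H (T n x) \<le> C * hnorm H x" if "x \<in> carrier H" for n x
    unfolding C_def by (rule represents_bound[OF T that])
  have ex: "\<exists>l\<in>carrier H. hlimit H (\<lambda>n. T n (\<tau> f g)) l" if f: "f \<in> carrier HA" and g: "g \<in> carrier HB" for f g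
  proof (rule cauchy_hlimit[of "\<lambda>n. T n (\<tau> f g)"])
    fix r :: real assume r: "r > 0"
    \<comment> \<open>Two slice errors weighted by the norm of \<open>f\<close>, and two rests
      weighted by \<open>C\<close> and the norm of \<open>g\<close>.\<close>
    define q where "q = 2 * hnorm HA f + 2 * C * hnorm HB g + 1"
    have q: "q > 0" using f g C by (simp add: q_def add_nonneg_pos)
    define e where "e = r / q"
    have e: "e > 0" "e * q = r" using r q by (auto simp: e_def)
    obtain X m where X: "X \<in> sets M" "hnorm HA (f \<ominus>\<^bsub>HA\<^esub> P X f) \<le> e"
      "\<And>n s. \<lbrakk>n \<ge> m; s \<in> X\<rbrakk> \<Longrightarrow> hnorm HB (slice (S n) s g \<ominus>\<^bsub>HB\<^esub> slice S' s g) \<le> e"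
      using egorov[of S S' g f e] S S' conv f g e(1) by blast
    define h where "h = P X f"
    have h: "h \<in> carrier HA" "P X h = h" "hnorm HA h \<le> hnorm HA f"
      using X f by (auto simp: h_def P.E_contraction)
    have rest: "hnorm H (T n (\<tau> f g) \<ominus> T n (\<tau> h g)) \<le> C * (e * hnorm HB g)" for n
    proof -
      have "hnorm H (T n (\<tau> f g) \<ominus> T n (\<tau> h g)) = hnorm H (T n (\<tau> (f \<ominus>\<^bsub>HA\<^esub> h) g))"
        using f g h by (simp add: tau_diff_left bounded_operator_diff[OF opT])
      also have "\<dots> \<le> C * hnorm H (\<tau> (f \<ominus>\<^bsub>HA\<^esub> h) g)" using f g h by (intro bnd) auto
      also have "\<dots> \<le> C * (e * hnorm HB g)"
        using f g h X(2) C by (auto simp: hnorm_tau h_def intro!: mult_left_mono mult_right_mono)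
      finally show ?thesis .
    qed
    have "hnorm H (T i (\<tau> f g) \<ominus> T j (\<tau> f g)) \<le> r" if ij: "i \<ge> m" "j \<ge> m" for i j
    proof -
      have "hnorm H (T i (\<tau> h g) \<ominus> T j (\<tau> h g)) \<le> (e + e) * hnorm HA h"
      proof (rule represents_dist[OF T T X(1) h(1,2) g])
        fix s assume s: "s \<in> X"
        show "hnorm HB (slice (S i) s g \<ominus>\<^bsub>HB\<^esub> slice (S j) s g) \<le> e + e"
          using X(3)[OF ij(1) s] X(3)[OF ij(2) s] S S' g B.hnorm_diff_commute[of "slice S' s g" "slice (S j) s g"]
          by (intro B.hnorm_dist_le[of _ "slice S' s g"]) auto
      qed (use e in simp)
      also have "\<dots> \<le> (e + e) * hnorm HA f" using h e by (intro mult_left_mono) auto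
      finally have "hnorm H (T i (\<tau> f g) \<ominus> T j (\<tau> f g)) \<le> C * (e * hnorm HB g) + ((e + e) * hnorm HA f + C * (e * hnorm HB g))"
        using rest[of i] rest[of j] f g h hnorm_diff_commute[of "T j (\<tau> h g)" "T j (\<tau> f g)"]
        by (intro hnorm_dist_le[of _ "T i (\<tau> h g)"] hnorm_dist_le[of "T i (\<tau> h g)" "T j (\<tau> h g)"]) auto
      also have "\<dots> \<le> e * q" using e by (simp add: q_def algebra_simps)
      finally show ?thesis using e by simp
    qed
    then show "\<exists>N. \<forall>m\<ge>N. \<forall>n\<ge>N. hnorm H (T m (\<tau> f g) \<ominus> T n (\<tau> f g)) \<le> r" by blast
  qed (use f g in auto)
  have "\<exists>T'. bounded_operator H T' \<and> (\<forall>x\<in>carrier H. hlimit H (\<lambda>n. T n x) (T' x))"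
    by (rule strong_limit[of T C, OF opT bnd ex]) auto
  then obtain T' where T': "bounded_operator H T'" "\<And>x. x \<in> carrier H \<Longrightarrow> hlimit H (\<lambda>n. T n x) (T' x)"
    by metis
  note [simp] = bounded_operator_closed[OF T'(1)]
  have "represents S' T'"
  proof (rule representsI[OF S'])
    show "decomposable T'"
      unfolding decomposable_def
    proof (intro conjI T' ballI)
      fix X x assume X: "X \<in> sets M" and x: "x \<in> carrier H"
      have "hlimit H (\<lambda>n. T n (PH X x)) (T' (PH X x))" using X x by (intro T') auto
      moreover have "hlimit H (\<lambda>n. T n (PH X x)) (PH X (T' x))"
        unfolding decomposableD(2)[OF representsD(2)[OF T] X x]
        using x by (intro bounded_operator_hlimit[OF PH.E_operator[OF X]] T') auto
      ultimately show "T' (PH X x) = PH X (T' x)"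
        using X x by (intro hlimit_unique[of "\<lambda>n. T n (PH X x)"]) auto
    qed
    fix X0 f g w d
    assume X0: "X0 \<in> sets M" and f: "f \<in> carrier HA" "P X0 f = f" and g: "g \<in> carrier HB" and w: "w \<in> carrier HB"
      and d: "0 \<le> d" and est: "\<And>s. s \<in> X0 \<Longrightarrow> hnorm HB (slice S' s g \<ominus>\<^bsub>HB\<^esub> w) \<le> d"
    show "hnorm H (T' (\<tau> f g) \<ominus> \<tau> f w) \<le> d * hnorm HA f"
    proof (rule field_le_epsilon)
      fix r :: real assume r: "r > 0"
      define q where "q = hnorm HA f + C * hnorm HB g + hnorm HB w + 1"
      have q: "q > 0" using f g w C by (simp add: q_def add_nonneg_pos)
      define e where "e = r / q"
      have e: "e > 0" "e * q = r" using r q by (auto simp: e_def)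
      obtain X m where X: "X \<in> sets M" "hnorm HA (f \<ominus>\<^bsub>HA\<^esub> P X f) \<le> e"
        "\<And>n s. \<lbrakk>n \<ge> m; s \<in> X\<rbrakk> \<Longrightarrow> hnorm HB (slice (S n) s g \<ominus>\<^bsub>HB\<^esub> slice S' s g) \<le> e"
        using egorov[of S S' g f e] S S' conv f(1) g e(1) by blast
      define h where "h = P X f"
      \<comment> \<open>Over \<open>X\<close> the slices are uniformly near their limit, over
        \<open>X0\<close> the limit is near \<open>w\<close>; both are needed for the same
        vector.\<close>
      have hE: "h = P (X \<inter> X0) f" using P.E_inter[of X X0 f] X X0 f by (simp add: h_def)
      have h: "h \<in> carrier HA" "P (X \<inter> X0) h = h" "hnorm HA h \<le> hnorm HA f"
        unfolding hE using X(1) X0 f(1) by (auto simp: P.E_contraction)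
      have fh: "f \<ominus>\<^bsub>HA\<^esub> h \<in> carrier HA" "hnorm HA (f \<ominus>\<^bsub>HA\<^esub> h) \<le> e" using f h X by (auto simp: h_def)
      have "hnorm H (T n (\<tau> f g) \<ominus> \<tau> f w) \<le> d * hnorm HA f + r" if n: "n \<ge> m" for n
      proof -
        have a: "hnorm H (T n (\<tau> h g) \<ominus> \<tau> h w) \<le> (e + d) * hnorm HA h"
        proof (rule representsD(4)[OF T _ h(1) g w _ h(2)])
          fix s assume s: "s \<in> X \<inter> X0"
          then show "hnorm HB (slice (S n) s g \<ominus>\<^bsub>HB\<^esub> w) \<le> e + d"
            using X(3)[OF n, of s] est[of s] S S' g w by (intro B.hnorm_dist_le[of _ "slice S' s g"]) auto
        qed (use X X0 d e in auto)
        also have "\<dots> \<le> (e + d) * hnorm HA f" using h d e by (intro mult_left_mono) auto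
        finally have a: "hnorm H (T n (\<tau> h g) \<ominus> \<tau> h w) \<le> (e + d) * hnorm HA f" .
        have "hnorm H (T n (\<tau> (f \<ominus>\<^bsub>HA\<^esub> h) g)) \<le> C * hnorm H (\<tau> (f \<ominus>\<^bsub>HA\<^esub> h) g)" using fh g by (intro bnd) auto
        also have "\<dots> \<le> C * (e * hnorm HB g)"
          using fh g C by (auto simp: hnorm_tau intro!: mult_left_mono mult_right_mono)
        finally have b: "hnorm H (T n (\<tau> (f \<ominus>\<^bsub>HA\<^esub> h) g)) \<le> C * (e * hnorm HB g)" .
        have c: "hnorm H (\<ominus> \<tau> (f \<ominus>\<^bsub>HA\<^esub> h) w) \<le> e * hnorm HB w"
          using fh w by (auto simp: hnorm_tau intro!: mult_right_mono)
        have "T n (\<tau> f g) \<ominus> \<tau> f w = (T n (\<tau> h g) \<ominus> \<tau> h w) \<oplus> (T n (\<tau> (f \<ominus>\<^bsub>HA\<^esub> h) g) \<oplus> \<ominus> \<tau> (f \<ominus>\<^bsub>HA\<^esub> h) w)"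
          using f(1) g w h(1) by (intro vector_eqI) (auto simp: tau_diff_left bounded_operator_diff[OF opT] cinner_simps)
        also have "hnorm H \<dots> \<le> (e + d) * hnorm HA f + (C * (e * hnorm HB g) + e * hnorm HB w)"
          using a b c fh(1) g w h(1) by (intro hnorm_triangle_le) auto
        also have "\<dots> \<le> d * hnorm HA f + e * q" using e by (simp add: q_def algebra_simps)
        finally show ?thesis using e by simp
      qed
      note le = this
      have "hlimit H (\<lambda>n. T n (\<tau> f g) \<oplus> \<ominus> \<tau> f w) (T' (\<tau> f g) \<oplus> \<ominus> \<tau> f w)"
        using f g w by (intro hlimit_add hlimit_const T') auto
      then show "hnorm H (T' (\<tau> f g) \<ominus> \<tau> f w) \<le> d * hnorm HA f + r"
        unfolding a_minus_def using le[unfolded a_minus_def] f(1) g w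
        by (elim hlimit_hnorm_le[rotated 2]) auto
    qed
  qed
  then show ?thesis using that T'(2) by blast
qed

text \<open>Rectangles generate the product sets and are stable under intersection. Disjoint unions
  are reached in two stages, finite ones by adding operators and countable ones as limits of
  these.\<close>

lemma represents_exists:
  assumes "S \<in> sets (M \<Otimes>\<^sub>M N)" shows "\<exists>T. represents S T"
  using assms
proof (induction S rule: pair_measure_sets_induct)
  case (union S)
  then obtain T where T: "\<And>i. represents (S i) (T i)" by metis
  have "\<exists>T. represents (\<Union>i<n. S i) T" for n
  proof (induction n)
    case 0 then show ?case using represents_rectangle[of "{}" "{}"] by auto
  next
    case (Suc n)
    then show ?case unfolding partial_union_Suc(1)[OF union(1)]
      using represents_union[OF _ T partial_union_Suc(2)[OF union(1)]] by blast
  qed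
  then obtain R where R: "\<And>n. represents (\<Union>i<n. S i) (R n)" by metis
  have "(\<Union>i. S i) \<in> sets (M \<Otimes>\<^sub>M N)" using union(2) by auto
  then show ?case
    by (rule represents_limit[of "\<lambda>n. \<Union>i<n. S i" R, OF R _ slice_UN_limit[OF union(2,1)]]) auto
qed (use represents_rectangle represents_compl in blast)+

definition PQ :: "('s \<times> 't) set \<Rightarrow> 'h \<Rightarrow> 'h" where
  "PQ S = (SOME T. represents S T)"

lemma represents_PQ: "S \<in> sets (M \<Otimes>\<^sub>M N) \<Longrightarrow> represents S (PQ S)"
  unfolding PQ_def by (rule someI_ex[OF represents_exists])

lemma PQ_eqI: "\<lbrakk>represents S T; x \<in> carrier H\<rbrakk> \<Longrightarrow> PQ S x = T x"
  using represents_unique[OF represents_PQ] representsD(1) by blast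

lemma PQ_rectangle: "\<lbrakk>X \<in> sets M; Y \<in> sets N; x \<in> carrier H\<rbrakk> \<Longrightarrow> PQ (X \<times> Y) x = PH X (QH Y x)"
  by (rule PQ_eqI[OF represents_rectangle])

lemma PQ_tau: "\<lbrakk>X \<in> sets M; Y \<in> sets N; f \<in> carrier HA; g \<in> carrier HB\<rbrakk> \<Longrightarrow> PQ (X \<times> Y) (\<tau> f g) = \<tau> (P X f) (Q Y g)"
  by (simp add: PQ_rectangle PH_spec(3) QH_spec(3))

text \<open>In the set identities both operators represent the same set, so
  \<open>represents_unique\<close> applies. The limit over partial unions from
  \<open>represents_limit\<close> represents the whole union and therefore is \<open>PQ\<close> of
  it.\<close>

lemma PQ_resolution: "resolution_of_identity H (M \<Otimes>\<^sub>M N) PQ"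
  unfolding resolution_of_identity_def
proof (intro conjI ballI allI impI)
  show op: "bounded_operator H (PQ S)" if "S \<in> sets (M \<Otimes>\<^sub>M N)" for S
    by (rule representsD(3)[OF represents_PQ[OF that]])
  note [simp] = bounded_operator_closed[OF op]
  show "\<exists>C. \<forall>S\<in>sets (M \<Otimes>\<^sub>M N). \<forall>x\<in>carrier H. hnorm H (PQ S x) \<le> C * hnorm H x"
    using represents_bound[OF represents_PQ] by blast
  fix x assume x: "x \<in> carrier H"
  show "PQ (space (M \<Otimes>\<^sub>M N)) x = x"
    by (rule operator_eqI[OF op bounded_operator_id _ x]) (simp_all add: space_pair_measure PQ_tau)
  show "PQ (S \<inter> S') x = PQ S (PQ S' x)" if "S \<in> sets (M \<Otimes>\<^sub>M N)" "S' \<in> sets (M \<Otimes>\<^sub>M N)" for S S'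
    by (rule PQ_eqI[OF represents_inter[OF represents_PQ represents_PQ] x]) (use that in auto)
  fix S :: "nat \<Rightarrow> _ set" assume range: "range S \<subseteq> sets (M \<Otimes>\<^sub>M N)" and disj: "disjoint_family S"
  have S: "S i \<in> sets (M \<Otimes>\<^sub>M N)" for i using range by auto
  have U: "(\<Union>i<n. S i) \<in> sets (M \<Otimes>\<^sub>M N)" for n by (rule partial_union_sets[OF S])
  have sum: "PQ (\<Union>i<n. S i) x = (\<Oplus>i\<in>{..<n}. PQ (S i) x)" for n
  proof (induction n)
    case 0 then show ?case using PQ_rectangle[of "{}" "{}" x] x QH_spec(1)[of "{}"] by (simp add: bounded_operator_closed)
  next
    case (Suc n)
    have "PQ (\<Union>i<Suc n. S i) x = PQ (\<Union>i<n. S i) x \<oplus> PQ (S n) x"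
      unfolding partial_union_Suc(1)[OF disj]
      by (rule PQ_eqI[OF represents_union[OF represents_PQ[OF U] represents_PQ[OF S] partial_union_Suc(2)[OF disj]] x])
    then show ?case using Suc PH.finsum_lessThan_Suc[of "\<lambda>i. PQ (S i) x" n] x S by simp
  qed
  have "(\<Union>i. S i) \<in> sets (M \<Otimes>\<^sub>M N)" using S by auto
  then have "\<exists>T. represents (\<Union>i. S i) T \<and> (\<forall>x\<in>carrier H. hlimit H (\<lambda>n. PQ (\<Union>i<n. S i) x) (T x))"
    by (rule represents_limit[of "\<lambda>n. \<Union>i<n. S i" "\<lambda>n. PQ (\<Union>i<n. S i)", OF represents_PQ[OF U] _ slice_UN_limit[OF S disj]]) auto
  then obtain T where T: "represents (\<Union>i. S i) T" "\<And>x. x \<in> carrier H \<Longrightarrow> hlimit H (\<lambda>n. PQ (\<Union>i<n. S i) x) (T x)"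
    by metis
  show "hlimit H (\<lambda>n. \<Oplus>i\<in>{..<n}. PQ (S i) x) (PQ (\<Union>i. S i) x)"
    using T(2)[OF x] PQ_eqI[OF T(1) x] by (simp add: sum)
qed

sublocale PQ: spectral_measure H "M \<Otimes>\<^sub>M N" PQ
  by (intro spectral_measure.intro spectral_measure_axioms.intro PQ_resolution complex_hilbert_space_axioms)

lemma product_resolution_PQ: "product_resolution HA HB H \<tau> M N P Q PQ"
  unfolding product_resolution_def tensor_operator_def
  using PQ_resolution PQ.E_operator by (simp add: PQ_tau)

end

section \<open>Spectral integrals over the product resolution\<close>

context spectral_measure
begin

lemma essential_range_closed:
  assumes f: "f \<in> borel_measurable M"
  shows "closed (essential_range f)"
proof -
  have S: "{w \<in> space M. cmod (f w - z) < e} \<in> sets M" for z e using f by measurable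
  have "z \<in> essential_range f" if z: "z \<in> closure (essential_range f)" for z
    unfolding essential_range_def
  proof (intro CollectI allI impI)
    fix e :: real assume e: "e > 0"
    then obtain z' where z': "z' \<in> essential_range f" "dist z' z < e/2"
      using z unfolding closure_approachable by (meson half_gt_zero)
    then obtain x where x: "x \<in> carrier H" "E {w \<in> space M. cmod (f w - z') < e/2} x \<noteq> \<zero>"
      using e half_gt_zero[OF e] unfolding essential_range_def by blast
    have "cmod (f w - z) < e" if "cmod (f w - z') < e/2" for w
      using that z'(2) norm_triangle_ineq[of "f w - z'" "z' - z"] by (simp add: dist_norm)
    then have "E {w \<in> space M. cmod (f w - z') < e/2} (E {w \<in> space M. cmod (f w - z) < e} x) 
        = E {w \<in> space M. cmod (f w - z') < e/2} x"
      using x by (intro E_subset S) auto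
    then have "E {w \<in> space M. cmod (f w - z) < e} x \<noteq> \<zero>"
      using x(2) bounded_operator_zero[OF E_operator[OF S]] by metis
    then show "\<exists>x\<in>carrier H. E {w \<in> space M. cmod (f w - z) < e} x \<noteq> \<zero>" using x by blast
  qed
  then show ?thesis using closure_subset_eq by blast
qed

text \<open>Every point outside the essential range has a disc with null preimage. There are
  uncountably many such discs, and Lindelof's theorem leaves countably many, whose preimages have a
  null union.\<close>

lemma conull_essential_range:
  assumes f: "f \<in> borel_measurable M"
  shows "conull {w \<in> space M. f w \<in> essential_range f}"
proof -
  define \<F> where "\<F> = {ball z e | z e. 0 < e \<and> (\<forall>x\<in>carrier H. E {w \<in> space M. f w \<in> ball z e} x = \<zero>)}"
  have "\<And>S. S \<in> \<F> \<Longrightarrow> open S" by (auto simp: \<F>_def)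
  then obtain \<G> where \<G>: "\<G> \<subseteq> \<F>" "countable \<G>" "\<Union>\<G> = \<Union>\<F>" using Lindelof[of \<F>] by blast
  have "- essential_range f \<subseteq> \<Union>\<F>"
  proof
    fix z assume "z \<in> - essential_range f"
    then obtain e where e: "e > 0" "\<forall>x\<in>carrier H. E {w \<in> space M. cmod (f w - z) < e} x = \<zero>"
      unfolding essential_range_def by blast
    have "{w \<in> space M. f w \<in> ball z e} = {w \<in> space M. cmod (f w - z) < e}"
      by (auto simp: dist_norm norm_minus_commute)
    then have "\<forall>x\<in>carrier H. E {w \<in> space M. f w \<in> ball z e} x = \<zero>" using e(2) by (simp only:)
    then have "ball z e \<in> \<F>" using e(1) unfolding \<F>_def by blast
    then show "z \<in> \<Union>\<F>" using e(1) by (intro UnionI[of "ball z e"]) auto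
  qed
  \<comment> \<open>\<open>from_nat_into\<close> means nothing for an empty family, so that case is
    filled with empty sets, whose preimages are null as well.\<close>
  moreover define B where "B n = (if \<G> = {} then {} else from_nat_into \<G> n)" for n
  have B: "B n = {} \<or> B n \<in> \<F>" for n using \<G>(1) from_nat_into[of \<G> n] by (auto simp: B_def)
  have UB: "(\<Union>n. B n) = \<Union>\<F>"
    using \<G>(2,3) range_from_nat_into[of \<G>] by (auto simp: B_def)
  have Bm: "{w \<in> space M. f w \<in> B n} \<in> sets M" for n
  proof -
    have "open (B n)" using B[of n] by (auto simp: \<F>_def)
    then show ?thesis using measurable_sets[OF f, of "B n"] by (simp add: vimage_def Int_def conj_commute)
  qed
  have Bnull: "E {w \<in> space M. f w \<in> B n} x = \<zero>" if "x \<in> carrier H" for n x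
    using B[of n] that by (auto simp: \<F>_def)
  have closed: "essential_range f \<in> sets borel" using essential_range_closed[OF f] by (rule borel_closed)
  then have m: "{w \<in> space M. f w \<notin> essential_range f} \<in> sets M" using f by measurable
  have "{w \<in> space M. f w \<notin> essential_range f} \<subseteq> (\<Union>n. {w \<in> space M. f w \<in> B n})"
    using \<open>- essential_range f \<subseteq> \<Union>\<F>\<close> UB by fastforce
  then have "E {w \<in> space M. f w \<notin> essential_range f} x = \<zero>" if x: "x \<in> carrier H" for x
    using E_subset[OF m, of "\<Union>n. {w \<in> space M. f w \<in> B n}" x] E_null_UN[of "\<lambda>n. {w \<in> space M. f w \<in> B n}" x] Bm Bnull x
      bounded_operator_zero[OF E_operator[OF m]] by auto
  then have "conull (space M - {w \<in> space M. f w \<notin> essential_range f})" using conull_iff[OF m] by blast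
  moreover have "space M - {w \<in> space M. f w \<notin> essential_range f} = {w \<in> space M. f w \<in> essential_range f}" by auto
  ultimately show ?thesis by simp
qed

end

text \<open>Applied to \<open>J = (\<lambda>f. \<tau> f g)\<close> and to \<open>J = (\<lambda>g. \<tau> f g)\<close>.\<close>

lemma has_spectral_integral_pullback:
  fixes J :: "'a \<Rightarrow> 'h" and HA :: "('a, 'm) hilbert_scheme" and H :: "('h, 'k) hilbert_scheme" (structure)
  assumes A: "spectral_measure HA M P" and L: "spectral_measure H L E"
    and \<pi>: "\<pi> \<in> measurable L M"
    and J: "\<And>f. f \<in> carrier HA \<Longrightarrow> J f \<in> carrier H"
      "\<And>f f'. \<lbrakk>f \<in> carrier HA; f' \<in> carrier HA\<rbrakk> \<Longrightarrow> J (f \<oplus>\<^bsub>HA\<^esub> f') = J f \<oplus> J f'"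
      "\<And>c f. f \<in> carrier HA \<Longrightarrow> J (c \<odot>\<^bsub>HA\<^esub> f) = c \<odot> J f"
      "\<And>f. f \<in> carrier HA \<Longrightarrow> hnorm H (J f) \<le> c * hnorm HA f" and c: "0 \<le> c"
    and EJ: "\<And>X f. \<lbrakk>X \<in> sets M; f \<in> carrier HA\<rbrakk> \<Longrightarrow> E (\<pi> -` X \<inter> space L) (J f) = J (P X f)"
    and conull: "\<And>X. spectral_measure.conull HA M P X \<Longrightarrow> spectral_measure.conull H L E (\<pi> -` X \<inter> space L)"
    and T: "has_spectral_integral HA M P \<phi> T" and W: "has_spectral_integral H L E (\<lambda>w. \<phi> (\<pi> w)) W"
    and f: "f \<in> carrier HA"
  shows "W (J f) = J (T f)"
proof -
  interpret A: spectral_measure HA M P by fact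
  interpret L: spectral_measure H L E by fact
  have J0: "J \<zero>\<^bsub>HA\<^esub> = \<zero>" using J(3)[of "\<zero>\<^bsub>HA\<^esub>" 0] J(1)[of "\<zero>\<^bsub>HA\<^esub>"] by simp
  have Jdiff: "J (f \<ominus>\<^bsub>HA\<^esub> f') = J f \<ominus> J f'" if "f \<in> carrier HA" "f' \<in> carrier HA" for f f'
    using that J by (simp add: a_minus_def A.uminus_eq_smult L.uminus_eq_smult)
  have Jsum: "J (\<Oplus>\<^bsub>HA\<^esub>i\<in>I. F i) = (\<Oplus>i\<in>I. J (F i))" if "finite I" "\<And>i. i \<in> I \<Longrightarrow> F i \<in> carrier HA" for I and F :: "complex \<Rightarrow> 'a"
    using that
  proof (induction I rule: finite_induct)
    case (insert i I)
    then have "(\<Oplus>\<^bsub>HA\<^esub>i\<in>I. F i) \<in> carrier HA" by (intro A.finsum_closed) auto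
    then show ?case using insert J(1,2)
      by (subst A.finsum_insert L.finsum_insert; auto)+
  qed (simp add: J0)
  have simple: "L.simple_int (\<lambda>w. s (\<pi> w)) (J f) = J (A.simple_int s f)" 
    and simple': "simple_function L (\<lambda>w. s (\<pi> w))" if s: "simple_function M s" for s
  proof -
    show s': "simple_function L (\<lambda>w. s (\<pi> w))" by (rule simple_function_comp[OF \<pi> s])
    have fin: "finite (s ` space M)" using s by (rule simple_functionD)
    have pm: "s -` {c} \<inter> space M \<in> sets M" for c using s by (rule simple_functionD)
    have vim: "(\<lambda>w. s (\<pi> w)) -` {c} \<inter> space L = \<pi> -` (s -` {c} \<inter> space M) \<inter> space L" for c
      using measurable_space[OF \<pi>] by auto
    have piece: "E ((\<lambda>w. s (\<pi> w)) -` {c} \<inter> space L) (J f) = J (P (s -` {c} \<inter> space M) f)" for c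
      unfolding vim by (rule EJ[OF pm f])
    show "L.simple_int (\<lambda>w. s (\<pi> w)) (J f) = J (A.simple_int s f)"
    proof (rule L.vector_eqI)
      fix y assume y: "y \<in> carrier H"
      let ?F = "\<lambda>c. c * cinner H (J (P (s -` {c} \<inter> space M) f)) y"
      have "cinner H (L.simple_int (\<lambda>w. s (\<pi> w)) (J f)) y = (\<Sum>c\<in>(\<lambda>w. s (\<pi> w)) ` space L. ?F c)"
        using L.cinner_simple_int_comp[OF s' J(1)[OF f] y, of "\<lambda>c. c"] by (simp add: piece)
      also have "\<dots> = (\<Sum>c\<in>s ` space M. ?F c)"
      \<comment> \<open>\<open>\<pi>\<close> need not be onto, so \<open>s\<close> may take values
        that the composition does not take; their level sets have empty preimage, and
        \<open>EJ\<close> makes the corresponding terms zero.\<close>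
      proof (rule sum.mono_neutral_left[OF fin])
        show "(\<lambda>w. s (\<pi> w)) ` space L \<subseteq> s ` space M" using measurable_space[OF \<pi>] by auto
        show "\<forall>c\<in>s ` space M - (\<lambda>w. s (\<pi> w)) ` space L. ?F c = 0"
        proof
          fix c assume "c \<in> s ` space M - (\<lambda>w. s (\<pi> w)) ` space L"
          then have "(\<lambda>w. s (\<pi> w)) -` {c} \<inter> space L = {}" by (auto simp: image_iff)
          then have "J (P (s -` {c} \<inter> space M) f) = \<zero>"
            using piece[of c] J(1)[OF f] by simp
          then show "?F c = 0" using y by (simp add: L.cinner_zero_left)
        qed
      qed
      also have "\<dots> = cinner H (J (A.simple_int s f)) y"
        unfolding simple_spectral_integral_def using fin pm f y J
        by (subst Jsum) (auto simp: L.cinner_finsum_left L.cinner_smult_left)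
      finally show "cinner H (L.simple_int (\<lambda>w. s (\<pi> w)) (J f)) y = cinner H (J (A.simple_int s f)) y" .
    qed (use s s' f J in auto)
  qed
  have Tf: "T f \<in> carrier HA" using A.has_integralD(2)[OF T] f by (rule A.bounded_operator_closed)
  have Wf: "W (J f) \<in> carrier H" using L.has_integralD(2)[OF W] J(1)[OF f] by (rule L.bounded_operator_closed)
  obtain X s where X: "A.conull X" and s: "\<And>e. e > 0 \<Longrightarrow> simple_function M (s e)"
    "\<And>e w. \<lbrakk>e > 0; w \<in> X\<rbrakk> \<Longrightarrow> cmod (\<phi> w - s e w) \<le> e"
    "\<And>e x. \<lbrakk>e > 0; x \<in> carrier HA\<rbrakk> \<Longrightarrow> hnorm HA (T x \<ominus>\<^bsub>HA\<^esub> A.simple_int (s e) x) \<le> e * hnorm HA x"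
    using A.has_integral_approximants[OF T] by blast
  show ?thesis
  proof (rule L.eq_if_dist_le[OF Wf J(1)[OF Tf]])
    fix r :: real assume r: "r > 0"
    \<comment> \<open>\<open>4 * L.bnd\<close> comes from comparing \<open>W\<close> with the
      integral of an arbitrary approximant on \<open>H\<close>, and \<open>c\<close> from
      transporting the error on \<open>HA\<close> through \<open>J\<close>.\<close>
    define q where "q = 4 * L.bnd * hnorm H (J f) + c * hnorm HA f + 1"
    have q: "q > 0" using L.bnd_pos f J(1)[OF f] c by (simp add: q_def add_nonneg_pos)
    define e where "e = r / q"
    have e: "e > 0" "e * q = r" using r q by (auto simp: e_def)
    have sf: "A.simple_int (s e) f \<in> carrier HA" using s(1)[OF e(1)] f by simp
    have "hnorm H (W (J f) \<ominus> J (A.simple_int (s e) f)) \<le> 4 * L.bnd * e * hnorm H (J f)"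
      using L.has_integral_dist[OF W simple'[OF s(1)[OF e(1)]] conull[OF X] _ _ J(1)[OF f], of e] s(2)[OF e(1)] e(1)
      by (simp add: simple[OF s(1)[OF e(1)]])
    moreover have "hnorm H (J (A.simple_int (s e) f) \<ominus> J (T f)) \<le> c * (e * hnorm HA f)"
    proof -
      have "hnorm H (J (A.simple_int (s e) f \<ominus>\<^bsub>HA\<^esub> T f)) \<le> c * hnorm HA (A.simple_int (s e) f \<ominus>\<^bsub>HA\<^esub> T f)"
        using sf Tf by (intro J(4)) auto
      also have "\<dots> \<le> c * (e * hnorm HA f)"
        using s(3)[OF e(1) f] sf Tf c A.hnorm_diff_commute[of "T f" "A.simple_int (s e) f"] by (intro mult_left_mono) auto
      finally show ?thesis using sf Tf by (simp add: Jdiff)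
    qed
    ultimately have "hnorm H (W (J f) \<ominus> J (T f)) \<le> 4 * L.bnd * e * hnorm H (J f) + c * (e * hnorm HA f)"
      using Wf Tf sf J(1) by (intro L.hnorm_dist_le[of _ "J (A.simple_int (s e) f)"]) auto
    also have "\<dots> \<le> e * q" using e by (simp add: q_def algebra_simps)
    finally show "hnorm H (W (J f) \<ominus> J (T f)) \<le> r" using e by simp
  qed
qed

section \<open>Spectral integral and spectrum of a tensor product operator\<close>

context spectral_tensor
begin

lemma conull_rectangle:
  assumes X: "P.conull X" and Y: "Q.conull Y"
  shows "PQ.conull (X \<times> Y)"
  unfolding PQ.conull_def
proof (intro conjI ballI)
  have XY: "X \<in> sets M" "Y \<in> sets N" using X Y by (auto simp: P.conull_def Q.conull_def)
  then show S: "X \<times> Y \<in> sets (M \<Otimes>\<^sub>M N)" by simp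
  fix x assume x: "x \<in> carrier H"
  show "PQ (X \<times> Y) x = x"
    by (rule operator_eqI[OF PQ.E_operator[OF S] bounded_operator_id _ x])
      (use X Y XY in \<open>simp add: PQ_tau P.conull_def Q.conull_def\<close>)
qed

text \<open>The integral \<open>W1\<close> of the first factor acts on elementary tensors as
  \<open>TA\<close> on the left, and \<open>W2\<close> as \<open>TB\<close> on the right.
  Multiplicativity of the integral turns the product of functions into the composition, which agrees
  with \<open>T\<close> there.\<close>

theorem tensor_operator_has_integral:
  assumes TA: "has_spectral_integral HA M P \<phi> TA" and TB: "has_spectral_integral HB N Q \<psi> TB"
    and T: "tensor_operator HA HB H \<tau> TA TB T"
  shows "has_spectral_integral H (M \<Otimes>\<^sub>M N) PQ (\<lambda>w. \<phi> (fst w) * \<psi> (snd w)) T"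
proof -
  note [measurable] = P.has_integralD(1)[OF TA] Q.has_integralD(1)[OF TB]
  have fst_vim: "fst -` X \<inter> space (M \<Otimes>\<^sub>M N) = X \<times> space N" if "X \<in> sets M" for X
    using sets.sets_into_space[OF that] by (auto simp: space_pair_measure)
  have snd_vim: "snd -` Y \<inter> space (M \<Otimes>\<^sub>M N) = space M \<times> Y" if "Y \<in> sets N" for Y
    using sets.sets_into_space[OF that] by (auto simp: space_pair_measure)
  have conull1: "PQ.conull (fst -` X \<inter> space (M \<Otimes>\<^sub>M N))" if "P.conull X" for X
    using conull_rectangle[OF that Q.conull_space] fst_vim that by (simp add: P.conull_def)
  have conull2: "PQ.conull (snd -` Y \<inter> space (M \<Otimes>\<^sub>M N))" if "Q.conull Y" for Y
    using conull_rectangle[OF P.conull_space that] snd_vim that by (simp add: Q.conull_def)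
  obtain X b where X: "P.conull X" "\<And>w. w \<in> X \<Longrightarrow> cmod (\<phi> w) \<le> b"
    using P.has_integral_essentially_bounded[OF TA] by blast
  obtain Y c where Y: "Q.conull Y" "\<And>w. w \<in> Y \<Longrightarrow> cmod (\<psi> w) \<le> c"
    using Q.has_integral_essentially_bounded[OF TB] by blast
  have "\<exists>W1. has_spectral_integral H (M \<Otimes>\<^sub>M N) PQ (\<lambda>w. \<phi> (fst w)) W1"
    by (rule PQ.has_integral_exists[OF _ conull1[OF X(1)], of _ b]) (use X(2) in auto)
  then obtain W1 where W1: "has_spectral_integral H (M \<Otimes>\<^sub>M N) PQ (\<lambda>w. \<phi> (fst w)) W1" by blast
  have "\<exists>W2. has_spectral_integral H (M \<Otimes>\<^sub>M N) PQ (\<lambda>w. \<psi> (snd w)) W2"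
    by (rule PQ.has_integral_exists[OF _ conull2[OF Y(1)], of _ c]) (use Y(2) in auto)
  then obtain W2 where W2: "has_spectral_integral H (M \<Otimes>\<^sub>M N) PQ (\<lambda>w. \<psi> (snd w)) W2" by blast
  have W1_tau: "W1 (\<tau> f g) = \<tau> (TA f) g" if f: "f \<in> carrier HA" and g: "g \<in> carrier HB" for f g
    by (rule has_spectral_integral_pullback[OF P.spectral_measure_axioms PQ.spectral_measure_axioms measurable_fst,
          of "\<lambda>f. \<tau> f g" "hnorm HB g", OF _ _ _ _ _ _ conull1 TA W1 f])
      (use g in \<open>auto simp: tau_add_left tau_smult_left hnorm_tau fst_vim PQ_tau\<close>)
  have W2_tau: "W2 (\<tau> f g) = \<tau> f (TB g)" if f: "f \<in> carrier HA" and g: "g \<in> carrier HB" for f g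
    by (rule has_spectral_integral_pullback[OF Q.spectral_measure_axioms PQ.spectral_measure_axioms measurable_snd,
          of "\<lambda>g. \<tau> f g" "hnorm HA f", OF _ _ _ _ _ _ conull2 TB W2 g])
      (use f in \<open>auto simp: tau_add_right tau_smult_right hnorm_tau snd_vim PQ_tau\<close>)
  show ?thesis
  proof (rule PQ.has_integral_cong[OF PQ.has_integral_mult[OF W1 W2]])
    have opT: "bounded_operator H T" using T by (simp add: tensor_operator_def)
    fix x assume x: "x \<in> carrier H"
    show "W1 (W2 x) = T x"
      by (rule operator_eqI[OF bounded_operator_comp[OF PQ.has_integralD(2)[OF W1] PQ.has_integralD(2)[OF W2]] opT _ x])
        (use T Q.has_integralD(2)[OF TB] in \<open>auto simp: W1_tau W2_tau tensor_operator_def B.bounded_operator_closed\<close>)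
  qed
qed

theorem spectrum_tensor_operator:
  assumes TA: "has_spectral_integral HA M P \<phi> TA" and TB: "has_spectral_integral HB N Q \<psi> TB"
    and T: "tensor_operator HA HB H \<tau> TA TB T"
  shows "spectrum H T = closure (set_of_products (spectrum HA TA) (spectrum HB TB))"
proof -
  note \<phi>[measurable] = P.has_integralD(1)[OF TA] and \<psi>[measurable] = Q.has_integralD(1)[OF TB]
  note TPQ = tensor_operator_has_integral[OF TA TB T]
  let ?\<chi> = "\<lambda>w. \<phi> (fst w) * \<psi> (snd w)"
  have \<chi>[measurable]: "?\<chi> \<in> borel_measurable (M \<Otimes>\<^sub>M N)" by measurable
  have mA: "{w \<in> space M. cmod (\<phi> w - z) < e} \<in> sets M" for z e by measurable
  have mB: "{w \<in> space N. cmod (\<psi> w - z) < e} \<in> sets N" for z e by measurable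
  have m: "{w \<in> space (M \<Otimes>\<^sub>M N). cmod (?\<chi> w - z) < e} \<in> sets (M \<Otimes>\<^sub>M N)" for z e by measurable
  let ?R = "PQ.essential_range ?\<chi>" and ?RA = "P.essential_range \<phi>" and ?RB = "Q.essential_range \<psi>"
  have "set_of_products ?RA ?RB \<subseteq> ?R"
  proof
    fix z assume "z \<in> set_of_products ?RA ?RB"
    then obtain a b where z: "z = a * b" and a: "a \<in> ?RA" and b: "b \<in> ?RB" unfolding set_of_products_def by blast
    show "z \<in> ?R" unfolding PQ.essential_range_def
    proof (intro CollectI allI impI)
      fix e :: real assume e: "e > 0"
      \<comment> \<open>With deviations \<open>u\<close> and \<open>v\<close> from \<open>a\<close>
        and \<open>b\<close>, the product deviates by \<open>u * v + (a * v + b * u)\<close>;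
        \<open>d \<le> 1\<close> reduces the quadratic term to a linear one, which is the summand
        1.\<close>
      define q where "q = cmod a + cmod b + 1"
      have q: "q > 0" unfolding q_def using norm_ge_zero[of a] norm_ge_zero[of b] by linarith
      define d where "d = min 1 (e / q)"
      have d: "d > 0" "d \<le> 1" "d * q \<le> e" using e q by (auto simp: d_def min_def field_simps)
      let ?X = "{w \<in> space M. cmod (\<phi> w - a) < d}" and ?Y = "{w \<in> space N. cmod (\<psi> w - b) < d}"
      obtain f where f: "f \<in> carrier HA" "P ?X f \<noteq> \<zero>\<^bsub>HA\<^esub>" using a d(1) unfolding P.essential_range_def by blast
      obtain g where g: "g \<in> carrier HB" "Q ?Y g \<noteq> \<zero>\<^bsub>HB\<^esub>" using b d(1) unfolding Q.essential_range_def by blast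
      have c: "P ?X f \<in> carrier HA" "Q ?Y g \<in> carrier HB" using f g mA mB by auto
      have "hnorm H (PQ (?X \<times> ?Y) (\<tau> f g)) = hnorm HA (P ?X f) * hnorm HB (Q ?Y g)"
        using f(1) g(1) c mA mB by (simp add: PQ_tau hnorm_tau)
      then have "PQ (?X \<times> ?Y) (\<tau> f g) \<noteq> \<zero>"
        using f(2) g(2) c A.hnorm_eq_zero_iff B.hnorm_eq_zero_iff by auto
      moreover have "?X \<times> ?Y \<subseteq> {w \<in> space (M \<Otimes>\<^sub>M N). cmod (?\<chi> w - z) < e}"
      proof
        fix w assume w: "w \<in> ?X \<times> ?Y"
        let ?u = "\<phi> (fst w) - a" and ?v = "\<psi> (snd w) - b"
        have uv: "cmod ?u < d" "cmod ?v < d" using w by auto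
        have "?\<chi> w - z = ?u * ?v + (a * ?v + b * ?u)" by (simp add: z algebra_simps)
        then have "cmod (?\<chi> w - z) \<le> cmod ?u * cmod ?v + (cmod a * cmod ?v + cmod b * cmod ?u)"
          by (metis norm_mult norm_triangle_ineq norm_triangle_mono order_refl)
        also have "\<dots> \<le> 1 * cmod ?v + (cmod a * d + cmod b * d)"
          using uv d by (intro add_mono mult_mono) auto
        also have "\<dots> < d * q" using uv(2) by (simp add: q_def algebra_simps)
        finally show "w \<in> {w \<in> space (M \<Otimes>\<^sub>M N). cmod (?\<chi> w - z) < e}" using d(3) w by (auto simp: space_pair_measure)
      qed
      then have "PQ (?X \<times> ?Y) (PQ {w \<in> space (M \<Otimes>\<^sub>M N). cmod (?\<chi> w - z) < e} (\<tau> f g)) = PQ (?X \<times> ?Y) (\<tau> f g)"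
        using f g mA mB by (intro PQ.E_subset m) auto
      moreover have "PQ (?X \<times> ?Y) \<zero> = \<zero>" using mA mB by (intro bounded_operator_zero PQ.E_operator) auto
      ultimately have "PQ {w \<in> space (M \<Otimes>\<^sub>M N). cmod (?\<chi> w - z) < e} (\<tau> f g) \<noteq> \<zero>" by metis
      then show "\<exists>x\<in>carrier H. PQ {w \<in> space (M \<Otimes>\<^sub>M N). cmod (?\<chi> w - z) < e} x \<noteq> \<zero>" using f g by blast
    qed
  qed
  then have sub: "closure (set_of_products ?RA ?RB) \<subseteq> ?R"
    using PQ.essential_range_closed[OF \<chi>] by (rule closure_minimal)
  have "?R \<subseteq> closure (set_of_products ?RA ?RB)"
  proof (rule ccontr)
    assume "\<not> ?R \<subseteq> closure (set_of_products ?RA ?RB)"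
    then obtain z where z: "z \<in> ?R" "z \<notin> closure (set_of_products ?RA ?RB)" by blast
    then obtain e where e: "e > 0" "\<And>y. y \<in> set_of_products ?RA ?RB \<Longrightarrow> \<not> dist y z < e"
      unfolding closure_approachable by blast
    let ?X = "{w \<in> space M. \<phi> w \<in> ?RA}" and ?Y = "{w \<in> space N. \<psi> w \<in> ?RB}"
    let ?S = "{w \<in> space (M \<Otimes>\<^sub>M N). cmod (?\<chi> w - z) < e}"
    \<comment> \<open>On this rectangle both factors take values in their essential ranges, so the
      product stays at distance at least \<open>e\<close> from \<open>z\<close>, and the preimage of
      the disc is null.\<close>
    have N: "PQ.conull (?X \<times> ?Y)"
      by (intro conull_rectangle P.conull_essential_range Q.conull_essential_range \<phi> \<psi>)
    have "?\<chi> w \<in> set_of_products ?RA ?RB" if "w \<in> ?X \<times> ?Y" for w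
      using that unfolding set_of_products_def
      by (intro CollectI exI[of _ "\<phi> (fst w)"] exI[of _ "\<psi> (snd w)"]) auto
    then have "?S \<inter> (?X \<times> ?Y) = {}" using e(2) by (fastforce simp: dist_norm)
    then have "PQ ?S x = \<zero>" if "x \<in> carrier H" for x
      using PQ.E_conull_inter[OF N m that, of z e] that by simp
    then show False using z(1) e(1) unfolding PQ.essential_range_def by blast
  qed
  then show ?thesis
    using sub PQ.spectrum_eq_essential_range[OF TPQ] P.spectrum_eq_essential_range[OF TA] Q.spectrum_eq_essential_range[OF TB]
    by auto
qed

end

text \<open>\<open>E\<close> is obtained before the functions and operators are fixed, so one
  product resolution serves all times \<open>t\<close> at once.\<close>

theorem product_resolution_spectrum:
  assumes HA: "complex_hilbert_space HA" and HB: "complex_hilbert_space HB"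
    and H: "hilbert_tensor_product HA HB H \<tau>"
    and P: "self_adjoint_resolution HA M P" and Q: "resolution_of_identity HB N Q"
  obtains E where "product_resolution HA HB H \<tau> M N P Q E"
    "\<And>\<phi> \<psi> TA TB T. \<lbrakk>has_spectral_integral HA M P \<phi> TA; has_spectral_integral HB N Q \<psi> TB; tensor_operator HA HB H \<tau> TA TB T\<rbrakk>
      \<Longrightarrow> has_spectral_integral H (M \<Otimes>\<^sub>M N) E (\<lambda>w. \<phi> (fst w) * \<psi> (snd w)) T
        \<and> spectrum H T = closure (set_of_products (spectrum HA TA) (spectrum HB TB))"
proof -
  have "complex_hilbert_space H" using H by (simp add: hilbert_tensor_product_def)
  then interpret spectral_tensor HA HB H \<tau> M P N Q
    using assms unfolding self_adjoint_resolution_def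
    by (intro spectral_tensor.intro tensor_product.intro tensor_product_axioms.intro self_adjoint_spectral_measure.intro
        spectral_measure.intro spectral_measure_axioms.intro self_adjoint_spectral_measure_axioms.intro) auto
  show ?thesis
    using that[OF product_resolution_PQ] tensor_operator_has_integral spectrum_tensor_operator by blast
qed

section \<open>Completeness of square integrable functions\<close>

lemma square_integrableD:
  assumes "f \<in> square_integrable M"
  shows "f \<in> borel_measurable M" "integrable M (\<lambda>x. (cmod (f x))\<^sup>2)"
  using assms by (auto simp: square_integrable_def)

lemma square_integrable_zero: "(\<lambda>x. 0) \<in> square_integrable M"
  by (simp add: square_integrable_def)

lemma square_integrable_scale:
  assumes "f \<in> square_integrable M" shows "(\<lambda>x. c * f x) \<in> square_integrable M"
  using square_integrableD[OF assms] by (auto simp: square_integrable_def norm_mult power_mult_distrib)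

lemma square_integrable_add:
  assumes f: "f \<in> square_integrable M" and g: "g \<in> square_integrable M"
  shows "(\<lambda>x. f x + g x) \<in> square_integrable M"
proof -
  note [measurable] = square_integrableD(1)[OF f] square_integrableD(1)[OF g]
  have "integrable M (\<lambda>x. (cmod (f x + g x))\<^sup>2)"
  proof (rule Bochner_Integration.integrable_bound)
    show "integrable M (\<lambda>x. 2 * (cmod (f x))\<^sup>2 + 2 * (cmod (g x))\<^sup>2)"
      using square_integrableD(2)[OF f] square_integrableD(2)[OF g] by simp
    have "(cmod (f x + g x))\<^sup>2 \<le> 2 * (cmod (f x))\<^sup>2 + 2 * (cmod (g x))\<^sup>2" for x
    proof -
      have "(cmod (f x + g x))\<^sup>2 \<le> (cmod (f x) + cmod (g x))\<^sup>2" by (intro power_mono norm_triangle_ineq) simp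
      then show ?thesis using sum_squares_bound[of "cmod (f x)" "cmod (g x)"] by (simp add: power2_sum)
    qed
    then show "AE x in M. norm ((cmod (f x + g x))\<^sup>2) \<le> norm (2 * (cmod (f x))\<^sup>2 + 2 * (cmod (g x))\<^sup>2)" by simp
  qed simp
  then show ?thesis by (simp add: square_integrable_def)
qed

lemma square_integrable_diff:
  assumes "f \<in> square_integrable M" "g \<in> square_integrable M"
  shows "(\<lambda>x. f x - g x) \<in> square_integrable M"
  using square_integrable_add[OF assms(1) square_integrable_scale[OF assms(2), of "-1"]] by simp

lemma square_integrable_product:
  assumes f: "f \<in> square_integrable M" and g: "g \<in> square_integrable M"
  shows "integrable M (\<lambda>x. f x * cnj (g x))"
proof (rule Bochner_Integration.integrable_bound)
  note [measurable] = square_integrableD(1)[OF f] square_integrableD(1)[OF g]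
  show "integrable M (\<lambda>x. (cmod (f x))\<^sup>2 + (cmod (g x))\<^sup>2)"
    using square_integrableD(2)[OF f] square_integrableD(2)[OF g] by simp
  have "cmod (f x) * cmod (g x) \<le> (cmod (f x))\<^sup>2 + (cmod (g x))\<^sup>2" for x
    using sum_squares_bound[of "cmod (f x)" "cmod (g x)", unfolded mult.assoc]
      mult_nonneg_nonneg[OF norm_ge_zero[of "f x"] norm_ge_zero[of "g x"]] by linarith
  then show "AE x in M. norm (f x * cnj (g x)) \<le> norm ((cmod (f x))\<^sup>2 + (cmod (g x))\<^sup>2)"
    by (simp add: norm_mult)
  have [measurable]: "cnj \<in> borel_measurable borel" by (intro borel_measurable_continuous_onI continuous_intros)
  show "(\<lambda>x. f x * cnj (g x)) \<in> borel_measurable M" by measurable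
qed

text \<open>Along a rapidly Cauchy subsequence the increments \<open>d\<^sub>k\<close> satisfy
  \<open>|d\<^sub>k| \<le> 2\<^sup>-\<^sup>k + 2\<^sup>k |d\<^sub>k|\<^sup>2\<close>, so that they are almost everywhere absolutely summable.\<close>

lemma riesz_fischer:
  fixes f :: "nat \<Rightarrow> 'x \<Rightarrow> complex"
  assumes f: "\<And>n. f n \<in> square_integrable M"
    and cauchy: "\<And>e. e > 0 \<Longrightarrow> \<exists>N. \<forall>m\<ge>N. \<forall>n\<ge>N. (LINT x|M. (cmod (f m x - f n x))\<^sup>2) < e"
  obtains g where "g \<in> square_integrable M" "(\<lambda>n. LINT x|M. (cmod (f n x - g x))\<^sup>2) \<longlonglongrightarrow> 0"
proof -
  have nn: "(\<integral>\<^sup>+x. ennreal ((cmod (u x))\<^sup>2) \<partial>M) = ennreal (LINT x|M. (cmod (u x))\<^sup>2)" if "u \<in> square_integrable M" for u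
    using square_integrableD[OF that] by (intro nn_integral_eq_integral) auto
  \<comment> \<open>The rate \<open>(1/4)^k\<close> leaves \<open>(1/2)^k\<close> after
    multiplication with the weight \<open>2^k\<close>.\<close>
  have "\<exists>N. \<forall>m\<ge>N. \<forall>n\<ge>N. (LINT x|M. (cmod (f m x - f n x))\<^sup>2) < (1/4)^k" for k :: nat
    by (rule cauchy) simp
  then obtain N where N: "\<And>k m n. \<lbrakk>m \<ge> N k; n \<ge> N k\<rbrakk> \<Longrightarrow> (LINT x|M. (cmod (f m x - f n x))\<^sup>2) < (1/4)^k"
    by metis
  \<comment> \<open>Adding all earlier thresholds makes the subsequence monotone, so that two
    consecutive indices lie beyond \<open>N k\<close>; the summand \<open>k\<close> makes it tend to
    infinity.\<close>
  define R where "R k = k + (\<Sum>i\<le>k. N i)" for k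
  have R: "R k \<ge> N k" "R (Suc k) \<ge> R k" for k
    using member_le_sum[of k "{..k}" N] by (auto simp: R_def)
  define h where "h k = f (R k)" for k
  define d where "d k x = h (Suc k) x - h k x" for k x
  have h: "h k \<in> square_integrable M" for k using f by (simp add: h_def)
  have d: "d k \<in> square_integrable M" for k using square_integrable_diff[OF h h] by (simp add: d_def[abs_def])
  note [measurable] = square_integrableD(1)[OF f] square_integrableD(1)[OF h] square_integrableD(1)[OF d]
  have dk: "(LINT x|M. (cmod (d k x))\<^sup>2) < (1/4)^k" for k
    unfolding d_def h_def using R[of k] by (intro N) auto
  have "(\<integral>\<^sup>+x. (\<Sum>k. ennreal (2^k * (cmod (d k x))\<^sup>2)) \<partial>M) = (\<Sum>k. \<integral>\<^sup>+x. ennreal (2^k * (cmod (d k x))\<^sup>2) \<partial>M)"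
    by (intro nn_integral_suminf) measurable
  also have "\<dots> \<le> (\<Sum>k. ennreal ((1/2)^k))"
  proof (intro suminf_le summableI)
    fix k
    have "(\<integral>\<^sup>+x. ennreal (2^k * (cmod (d k x))\<^sup>2) \<partial>M) = ennreal (2^k) * (\<integral>\<^sup>+x. ennreal ((cmod (d k x))\<^sup>2) \<partial>M)"
      by (subst nn_integral_cmult[symmetric]) (auto simp: ennreal_mult)
    also have "\<dots> = ennreal (2^k * (LINT x|M. (cmod (d k x))\<^sup>2))"
      by (simp add: nn[OF d] ennreal_mult)
    also have "\<dots> \<le> ennreal (2^k * (1/4)^k)"
      using dk[of k] by (intro ennreal_leI mult_left_mono) auto
    also have "(2::real)^k * (1/4)^k = (1/2)^k" by (simp flip: power_mult_distrib)
    finally show "(\<integral>\<^sup>+x. ennreal (2^k * (cmod (d k x))\<^sup>2) \<partial>M) \<le> ennreal ((1/2)^k)" .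
  qed
  also have "\<dots> = ennreal (\<Sum>k. (1/2)^k)" by (intro suminf_ennreal2) auto
  also have "\<dots> < \<infinity>" by simp
  finally have "AE x in M. (\<Sum>k. ennreal (2^k * (cmod (d k x))\<^sup>2)) \<noteq> \<infinity>"
    by (intro nn_integral_noteq_infinite) auto
  then have conv: "AE x in M. (\<lambda>k. h k x) \<longlonglongrightarrow> lim (\<lambda>k. h k x)"
  proof eventually_elim
    case (elim x)
    then have "summable (\<lambda>k. 2^k * (cmod (d k x))\<^sup>2)" by (intro summable_suminf_not_top) auto
    then have s: "summable (\<lambda>k. (1/2)^k + 2^k * (cmod (d k x))\<^sup>2)" by (intro summable_add) auto
    have "norm (d k x) \<le> (1/2)^k + 2^k * (cmod (d k x))\<^sup>2" for k
    proof -
      show ?thesis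
      proof (cases "cmod (d k x) \<le> (1/2)^k")
        case False
        then have "1 \<le> 2^k * cmod (d k x)" by (simp add: power_one_over field_simps)
        then have "cmod (d k x) * 1 \<le> cmod (d k x) * (2^k * cmod (d k x))" by (intro mult_left_mono) auto
        then have "cmod (d k x) \<le> 2^k * (cmod (d k x))\<^sup>2" by (simp add: power2_eq_square mult_ac)
        then show ?thesis by (simp add: add_increasing)
      qed (simp add: add_increasing2)
    qed
    then have "summable (\<lambda>k. d k x)" by (intro summable_comparison_test'[OF s, of 0]) auto
    then have "convergent (\<lambda>n. \<Sum>k<n. d k x)" by (simp add: summable_iff_convergent)
    moreover have "(\<Sum>k<n. d k x) = h n x - h 0 x" for n
      unfolding d_def by (rule sum_lessThan_telescope)
    ultimately have "convergent (\<lambda>n. (h n x - h 0 x) + h 0 x)" by (intro convergent_add convergent_const) simp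
    then show "(\<lambda>k. h k x) \<longlonglongrightarrow> lim (\<lambda>k. h k x)" by (simp add: convergent_LIMSEQ_iff)
  qed
  \<comment> \<open>On the null set without convergence \<open>lim\<close> is a default value, which
    does not disturb measurability.\<close>
  define g where "g x = lim (\<lambda>k. h k x)" for x
  have [measurable]: "g \<in> borel_measurable M" unfolding g_def by measurable
  \<comment> \<open>Fatou's lemma along the subsequence bounds the distance of every late
    \<open>f n\<close> to \<open>g\<close>, so the whole sequence converges and not only the
    subsequence.\<close>
  have fatou: "(\<integral>\<^sup>+x. ennreal ((cmod (f n x - g x))\<^sup>2) \<partial>M) \<le> ennreal e"
    if e: "e > 0" and n0: "\<And>m n. \<lbrakk>m \<ge> n0; n \<ge> n0\<rbrakk> \<Longrightarrow> (LINT x|M. (cmod (f m x - f n x))\<^sup>2) < e" and n: "n \<ge> n0" for e n n0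
  proof -
    have "(\<integral>\<^sup>+x. ennreal ((cmod (f n x - g x))\<^sup>2) \<partial>M) = (\<integral>\<^sup>+x. liminf (\<lambda>k. ennreal ((cmod (f n x - h k x))\<^sup>2)) \<partial>M)"
    proof (rule nn_integral_cong_AE)
      show "AE x in M. ennreal ((cmod (f n x - g x))\<^sup>2) = liminf (\<lambda>k. ennreal ((cmod (f n x - h k x))\<^sup>2))"
        using conv
      proof eventually_elim
        case (elim x)
        then have "(\<lambda>k. ennreal ((cmod (f n x - h k x))\<^sup>2)) \<longlonglongrightarrow> ennreal ((cmod (f n x - g x))\<^sup>2)"
          unfolding g_def by (intro tendsto_ennrealI tendsto_intros)
        then show ?case by (rule lim_imp_Liminf[OF sequentially_bot, symmetric])
      qed
    qed
    also have "\<dots> \<le> liminf (\<lambda>k. \<integral>\<^sup>+x. ennreal ((cmod (f n x - h k x))\<^sup>2) \<partial>M)"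
      by (intro nn_integral_liminf) measurable
    also have "\<dots> \<le> liminf (\<lambda>k. ennreal e)"
    proof (rule Liminf_mono)
      have "(\<integral>\<^sup>+x. ennreal ((cmod (f n x - h k x))\<^sup>2) \<partial>M) \<le> ennreal e" if "k \<ge> n0" for k
      proof -
        have "R k \<ge> n0" using that by (simp add: R_def)
        then have "(LINT x|M. (cmod (f n x - f (R k) x))\<^sup>2) < e" using n by (intro n0)
        then show ?thesis unfolding h_def nn[OF square_integrable_diff[OF f f]] by (intro ennreal_leI) simp
      qed
      then show "\<forall>\<^sub>F k in sequentially. (\<integral>\<^sup>+x. ennreal ((cmod (f n x - h k x))\<^sup>2) \<partial>M) \<le> ennreal e"
        unfolding eventually_sequentially by blast
    qed
    finally show ?thesis by (simp add: Liminf_const)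
  qed
  have diff: "(\<lambda>x. f n x - g x) \<in> square_integrable M" and le: "(LINT x|M. (cmod (f n x - g x))\<^sup>2) \<le> e"
    if e: "e > 0" and n0: "\<And>m n. \<lbrakk>m \<ge> n0; n \<ge> n0\<rbrakk> \<Longrightarrow> (LINT x|M. (cmod (f m x - f n x))\<^sup>2) < e" and n: "n \<ge> n0" for e n n0
  proof -
    have b: "(\<integral>\<^sup>+x. ennreal ((cmod (f n x - g x))\<^sup>2) \<partial>M) \<le> ennreal e"
      by (rule fatou[OF e n0 n])
    have "integrable M (\<lambda>x. (cmod (f n x - g x))\<^sup>2)"
      using order_le_less_trans[OF b ennreal_less_top] by (intro integrableI_nonneg) auto
    then show s: "(\<lambda>x. f n x - g x) \<in> square_integrable M" by (simp add: square_integrable_def)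
    show "(LINT x|M. (cmod (f n x - g x))\<^sup>2) \<le> e"
      using b unfolding nn[OF s] by (subst (asm) ennreal_le_iff) (use e in auto)
  qed
  obtain n1 where n1: "\<And>m n. \<lbrakk>m \<ge> n1; n \<ge> n1\<rbrakk> \<Longrightarrow> (LINT x|M. (cmod (f m x - f n x))\<^sup>2) < 1"
    using cauchy[of 1] by auto
  \<comment> \<open>Square integrability of \<open>g\<close> is not known directly, only that of its
    difference to a late member of the sequence.\<close>
  have "(\<lambda>x. f n1 x - (f n1 x - g x)) \<in> square_integrable M"
    by (intro square_integrable_diff f diff[OF zero_less_one n1]) auto
  then have "g \<in> square_integrable M" by simp
  moreover have "(\<lambda>n. LINT x|M. (cmod (f n x - g x))\<^sup>2) \<longlonglongrightarrow> 0"
  proof (rule LIMSEQ_I)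
    fix r :: real assume r: "r > 0"
    then obtain n0 where n0: "\<And>m n. \<lbrakk>m \<ge> n0; n \<ge> n0\<rbrakk> \<Longrightarrow> (LINT x|M. (cmod (f m x - f n x))\<^sup>2) < r/2"
      using cauchy[of "r/2"] by auto
    have "(LINT x|M. (cmod (f n x - g x))\<^sup>2) \<le> r/2" if "n \<ge> n0" for n
      by (rule le[OF _ n0 that]) (use r in auto)
    then show "\<exists>no. \<forall>n\<ge>no. norm ((LINT x|M. (cmod (f n x - g x))\<^sup>2) - 0) < r"
      using r by (intro exI[of _ n0]) force
  qed
  ultimately show ?thesis by (rule that)
qed

section \<open>The Hilbert space of square integrable functions\<close>

lemma L2_class_eqI:
  assumes "AE x in M. f x = g x" shows "L2_class M f = L2_class M g"
proof -
  have "(AE x in M. h x = f x) \<longleftrightarrow> (AE x in M. h x = g x)" for h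
  proof (rule eventually_subst)
    show "AE x in M. (h x = f x) = (h x = g x)" using assms by eventually_elim simp
  qed
  then show ?thesis by (simp add: L2_class_def)
qed

lemma L2_rep_class:
  assumes "f \<in> square_integrable M"
  shows "L2_rep (L2_class M f) \<in> square_integrable M" "AE x in M. L2_rep (L2_class M f) x = f x"
proof -
  have "f \<in> L2_class M f" using assms by (simp add: L2_class_def)
  then have "L2_rep (L2_class M f) \<in> L2_class M f" unfolding L2_rep_def by (rule someI[of "\<lambda>g. g \<in> L2_class M f"])
  then show "L2_rep (L2_class M f) \<in> square_integrable M" "AE x in M. L2_rep (L2_class M f) x = f x"
    by (auto simp: L2_class_def)
qed

lemma L2_carrierE:
  assumes "F \<in> carrier (L2 M)" obtains f where "f \<in> square_integrable M" "F = L2_class M f"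
  using assms by (auto simp: L2_def)

lemma L2_carrierI: "f \<in> square_integrable M \<Longrightarrow> L2_class M f \<in> carrier (L2 M)"
  by (auto simp: L2_def)

lemma L2_zero: "zero (L2 M) = L2_class M (\<lambda>x. 0)"
  by (simp add: L2_def)

lemma L2_add:
  assumes "f \<in> square_integrable M" "g \<in> square_integrable M"
  shows "add (L2 M) (L2_class M f) (L2_class M g) = L2_class M (\<lambda>x. f x + g x)"
proof -
  have "AE x in M. L2_rep (L2_class M f) x + L2_rep (L2_class M g) x = f x + g x"
    using L2_rep_class(2)[OF assms(1)] L2_rep_class(2)[OF assms(2)] by eventually_elim simp
  then show ?thesis by (simp add: L2_def L2_class_eqI)
qed

lemma L2_smult:
  assumes "f \<in> square_integrable M"
  shows "smult (L2 M) c (L2_class M f) = L2_class M (\<lambda>x. c * f x)"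
proof -
  have "AE x in M. c * L2_rep (L2_class M f) x = c * f x"
    using L2_rep_class(2)[OF assms(1)] by eventually_elim simp
  then show ?thesis by (simp add: L2_def L2_class_eqI)
qed

lemma L2_cinner:
  assumes f: "f \<in> square_integrable M" and g: "g \<in> square_integrable M"
  shows "cinner (L2 M) (L2_class M f) (L2_class M g) = (LINT x|M. f x * cnj (g x))"
proof -
  have "AE x in M. L2_rep (L2_class M f) x * cnj (L2_rep (L2_class M g) x) = f x * cnj (g x)"
    using L2_rep_class(2)[OF f] L2_rep_class(2)[OF g] by eventually_elim simp
  then have "(LINT x|M. L2_rep (L2_class M f) x * cnj (L2_rep (L2_class M g) x)) = (LINT x|M. f x * cnj (g x))"
    by (intro integral_cong_AE borel_measurable_integrable square_integrable_product L2_rep_class f g)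
  then show ?thesis by (simp add: L2_def)
qed

lemma L2_hnorm:
  assumes f: "f \<in> square_integrable M"
  shows "hnorm (L2 M) (L2_class M f) = sqrt (LINT x|M. (cmod (f x))\<^sup>2)"
proof -
  have "(LINT x|M. f x * cnj (f x)) = complex_of_real (LINT x|M. (cmod (f x))\<^sup>2)"
    by (simp only: complex_norm_square[symmetric] integral_complex_of_real)
  then show ?thesis by (simp add: hnorm_def L2_cinner[OF f f])
qed

lemma L2_module: "module complex_field (L2 M)"
proof (rule moduleI[OF cring_complex_field])
  note [simp] = L2_zero L2_add L2_smult
    square_integrable_zero square_integrable_add square_integrable_scale
  show "abelian_group (L2 M)"
  proof (rule abelian_groupI)
    fix F assume "F \<in> carrier (L2 M)"
    then obtain f where f: "f \<in> square_integrable M" "F = L2_class M f" by (rule L2_carrierE)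
    then show "\<zero>\<^bsub>L2 M\<^esub> \<oplus>\<^bsub>L2 M\<^esub> F = F" by simp
    have "(\<lambda>x. (-1) * f x) \<in> square_integrable M" using f(1) by (rule square_integrable_scale)
    then have "(\<lambda>x. - f x) \<in> square_integrable M" by simp
    then show "\<exists>G\<in>carrier (L2 M). G \<oplus>\<^bsub>L2 M\<^esub> F = \<zero>\<^bsub>L2 M\<^esub>"
      using f by (intro bexI[of _ "L2_class M (\<lambda>x. - f x)"]) (simp_all add: L2_carrierI)
  next
    fix F G K assume "F \<in> carrier (L2 M)" "G \<in> carrier (L2 M)" "K \<in> carrier (L2 M)"
    then obtain f g k where "f \<in> square_integrable M" "F = L2_class M f" "g \<in> square_integrable M" "G = L2_class M g"
      "k \<in> square_integrable M" "K = L2_class M k"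
      by (metis L2_carrierE)
    then show "F \<oplus>\<^bsub>L2 M\<^esub> G \<oplus>\<^bsub>L2 M\<^esub> K = F \<oplus>\<^bsub>L2 M\<^esub> (G \<oplus>\<^bsub>L2 M\<^esub> K)"
      by (simp add: add.assoc)
  next
    fix F G assume "F \<in> carrier (L2 M)" "G \<in> carrier (L2 M)"
    then obtain f g where f: "f \<in> square_integrable M" "F = L2_class M f" and g: "g \<in> square_integrable M" "G = L2_class M g"
      by (metis L2_carrierE)
    show "F \<oplus>\<^bsub>L2 M\<^esub> G = G \<oplus>\<^bsub>L2 M\<^esub> F" "F \<oplus>\<^bsub>L2 M\<^esub> G \<in> carrier (L2 M)"
      using f g by (simp_all add: add.commute L2_carrierI)
  qed (simp add: L2_carrierI)
next
  note [simp] = L2_add L2_smult square_integrable_add square_integrable_scale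
  fix F G :: "('a \<Rightarrow> complex) set" and a b assume FG: "F \<in> carrier (L2 M)" "G \<in> carrier (L2 M)"
  then obtain f g where f: "f \<in> square_integrable M" "F = L2_class M f" and g: "g \<in> square_integrable M" "G = L2_class M g"
    by (elim L2_carrierE) auto
  show "a \<odot>\<^bsub>L2 M\<^esub> (F \<oplus>\<^bsub>L2 M\<^esub> G) = a \<odot>\<^bsub>L2 M\<^esub> F \<oplus>\<^bsub>L2 M\<^esub> a \<odot>\<^bsub>L2 M\<^esub> G"
    using f g by (simp add: distrib_left)
next
  note [simp] = L2_add L2_smult square_integrable_add square_integrable_scale
  fix F :: "('a \<Rightarrow> complex) set" and a b assume "F \<in> carrier (L2 M)"
  then obtain f where f: "f \<in> square_integrable M" "F = L2_class M f" by (elim L2_carrierE) auto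
  show "a \<odot>\<^bsub>L2 M\<^esub> F \<in> carrier (L2 M)" using f by (simp add: L2_carrierI)
  show "(a \<oplus>\<^bsub>complex_field\<^esub> b) \<odot>\<^bsub>L2 M\<^esub> F = a \<odot>\<^bsub>L2 M\<^esub> F \<oplus>\<^bsub>L2 M\<^esub> b \<odot>\<^bsub>L2 M\<^esub> F"
    using f by (simp add: distrib_right)
  show "(a \<otimes>\<^bsub>complex_field\<^esub> b) \<odot>\<^bsub>L2 M\<^esub> F = a \<odot>\<^bsub>L2 M\<^esub> (b \<odot>\<^bsub>L2 M\<^esub> F)"
    using f by (simp add: mult.assoc)
  show "\<one>\<^bsub>complex_field\<^esub> \<odot>\<^bsub>L2 M\<^esub> F = F"
    using f by simp
qed

theorem complex_hilbert_space_L2: "complex_hilbert_space (L2 M)"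
proof -
  interpret module complex_field "L2 M" by (rule L2_module)
  have diff: "L2_class M f \<ominus>\<^bsub>L2 M\<^esub> L2_class M g = L2_class M (\<lambda>x. f x - g x)"
    if f: "f \<in> square_integrable M" and g: "g \<in> square_integrable M" for f g :: "'a \<Rightarrow> complex"
  proof -
    have g': "(\<lambda>x. - g x) \<in> square_integrable M" using square_integrable_scale[OF g, of "-1"] by simp
    have "\<ominus>\<^bsub>L2 M\<^esub> L2_class M g = L2_class M (\<lambda>x. - g x)"
      using g g' by (intro M.minus_equality) (auto simp: L2_add L2_zero intro: L2_carrierI)
    then show ?thesis using f g' by (simp add: a_minus_def L2_add)
  qed
  show ?thesis
  proof unfold_locales
    fix F G K assume "F \<in> carrier (L2 M)" "G \<in> carrier (L2 M)" "K \<in> carrier (L2 M)"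
    then obtain f g k where f: "f \<in> square_integrable M" "F = L2_class M f" and g: "g \<in> square_integrable M" "G = L2_class M g"
      and k: "k \<in> square_integrable M" "K = L2_class M k"
      by (elim L2_carrierE) auto
    have "(LINT x|M. (f x + g x) * cnj (k x)) = (LINT x|M. f x * cnj (k x)) + (LINT x|M. g x * cnj (k x))"
      using square_integrable_product[OF f(1) k(1)] square_integrable_product[OF g(1) k(1)]
      by (simp add: distrib_right)
    then show "cinner (L2 M) (F \<oplus>\<^bsub>L2 M\<^esub> G) K = cinner (L2 M) F K + cinner (L2 M) G K"
      using f g k by (simp add: L2_add L2_cinner square_integrable_add)
  next
    fix F G c assume "F \<in> carrier (L2 M)" "G \<in> carrier (L2 M)"
    then obtain f g where f: "f \<in> square_integrable M" "F = L2_class M f" and g: "g \<in> square_integrable M" "G = L2_class M g"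
      by (elim L2_carrierE) auto
    show "cinner (L2 M) (c \<odot>\<^bsub>L2 M\<^esub> F) G = c * cinner (L2 M) F G"
      using f g by (simp add: L2_smult L2_cinner square_integrable_scale mult.assoc)
  next
    fix F G assume "F \<in> carrier (L2 M)" "G \<in> carrier (L2 M)"
    then obtain f g where f: "f \<in> square_integrable M" "F = L2_class M f" and g: "g \<in> square_integrable M" "G = L2_class M g"
      by (elim L2_carrierE) auto
    have "cnj (LINT x|M. f x * cnj (g x)) = (LINT x|M. cnj (f x * cnj (g x)))"
      by (rule Bochner_Integration.integral_cnj[symmetric])
    then show "cinner (L2 M) G F = cnj (cinner (L2 M) F G)"
      using f g by (simp add: L2_cinner mult.commute)
  next
    fix F assume F: "F \<in> carrier (L2 M)" "F \<noteq> \<zero>\<^bsub>L2 M\<^esub>"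
    then obtain f where f: "f \<in> square_integrable M" "F = L2_class M f" by (elim L2_carrierE) auto
    \<comment> \<open>Definiteness is where classes modulo null sets are needed: a vanishing
      integral makes \<open>f\<close> zero almost everywhere, hence its class the zero
      class.\<close>
    have "(LINT x|M. (cmod (f x))\<^sup>2) \<noteq> 0"
    proof
      assume "(LINT x|M. (cmod (f x))\<^sup>2) = 0"
      then have "AE x in M. (cmod (f x))\<^sup>2 = 0"
        using integral_nonneg_eq_0_iff_AE[OF square_integrableD(2)[OF f(1)]] by simp
      then have "AE x in M. f x = 0" by eventually_elim simp
      then have "L2_class M f = L2_class M (\<lambda>x. 0)" by (rule L2_class_eqI)
      then show False using F(2) f(2) by (simp add: L2_zero)
    qed
    then have "(LINT x|M. (cmod (f x))\<^sup>2) > 0" by (simp add: order_less_le)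
    moreover have "cinner (L2 M) F F = complex_of_real (LINT x|M. (cmod (f x))\<^sup>2)"
      unfolding f(2) L2_cinner[OF f(1) f(1)]
      by (simp only: complex_norm_square[symmetric] integral_complex_of_real)
    ultimately show "0 < Re (cinner (L2 M) F F)" by simp
  next
    fix X :: "nat \<Rightarrow> ('a \<Rightarrow> complex) set"
    assume X: "\<And>n. X n \<in> carrier (L2 M)"
      and cauchy: "\<And>e. e > 0 \<Longrightarrow> \<exists>N. \<forall>m\<ge>N. \<forall>n\<ge>N. hnorm (L2 M) (X m \<ominus>\<^bsub>L2 M\<^esub> X n) < e"
    have "\<exists>f. f \<in> square_integrable M \<and> X n = L2_class M f" for n using X[of n] by (elim L2_carrierE) auto
    then obtain f where f: "\<And>n. f n \<in> square_integrable M" "\<And>n. X n = L2_class M (f n)" by metis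
    have norm: "hnorm (L2 M) (X n \<ominus>\<^bsub>L2 M\<^esub> L2_class M g) = sqrt (LINT x|M. (cmod (f n x - g x))\<^sup>2)"
      if "g \<in> square_integrable M" for n g
      using that f by (simp add: diff L2_hnorm square_integrable_diff)
    have "\<exists>N. \<forall>m\<ge>N. \<forall>n\<ge>N. (LINT x|M. (cmod (f m x - f n x))\<^sup>2) < e" if e: "e > 0" for e
      using cauchy[of "sqrt e"] e norm[OF f(1)] by (simp add: f(2))
    then obtain g where g: "g \<in> square_integrable M" "(\<lambda>n. LINT x|M. (cmod (f n x - g x))\<^sup>2) \<longlonglongrightarrow> 0"
      using riesz_fischer[of f M] f(1) by blast
    have "(\<lambda>n. sqrt (LINT x|M. (cmod (f n x - g x))\<^sup>2)) \<longlonglongrightarrow> 0"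
      using tendsto_real_sqrt[OF g(2)] by simp
    then show "\<exists>l\<in>carrier (L2 M). hlimit (L2 M) X l"
      using g(1) norm by (intro bexI[of _ "L2_class M g"]) (auto simp: hlimit_def intro: L2_carrierI)
  qed
qed

theorem theorem6p4:
  fixes S :: "real \<Rightarrow> 'x::euclidean_space \<Rightarrow> 'x"
    and D A :: "'x set"
    and \<mu> :: "'x measure"
    and VB :: "('x \<Rightarrow> complex) set"
    and ipB :: "('x \<Rightarrow> complex) \<Rightarrow> ('x \<Rightarrow> complex) \<Rightarrow> complex"
    and HA :: "('x \<Rightarrow> complex) set hilbert"
    and HB0 HB :: "('x \<Rightarrow> complex) hilbert"
    and UA :: "real \<Rightarrow> ('x \<Rightarrow> complex) set \<Rightarrow> ('x \<Rightarrow> complex) set"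
    and UB :: "real \<Rightarrow> ('x \<Rightarrow> complex) \<Rightarrow> ('x \<Rightarrow> complex)"
    and H :: "'h hilbert"
    and \<tau> :: "('x \<Rightarrow> complex) set \<Rightarrow> ('x \<Rightarrow> complex) \<Rightarrow> 'h"
    and U :: "real \<Rightarrow> 'h \<Rightarrow> 'h"
    and P :: "real set \<Rightarrow> ('x \<Rightarrow> complex) set \<Rightarrow> ('x \<Rightarrow> complex) set"
    and Q :: "complex set \<Rightarrow> ('x \<Rightarrow> complex) \<Rightarrow> ('x \<Rightarrow> complex)"
  defines "HA \<equiv> L2 (restrict_space \<mu> A)"
    and "HB0 \<equiv> function_space D ipB VB"
    and "HB \<equiv> function_space D ipB (adjoin_constants D VB)"
    and "UA \<equiv> \<lambda>t. koopman_L2 (restrict_space \<mu> A) (S t)"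
    and "UB \<equiv> \<lambda>t. koopman D (S t)"
  assumes flow: "is_flow S"
    and D: "compact D" "\<And>t. t \<ge> 0 \<Longrightarrow> S t ` D \<subseteq> D"
    and A: "milnor_attractor S D A" "A \<in> null_sets lebesgue"
    and \<mu>: "sets \<mu> = sets borel" "prob_space \<mu>" "invariant_measure S \<mu>"
      "physical_measure S D \<mu>" "emeasure \<mu> A = 1"
    and VB_cont: "\<And>f. f \<in> VB \<Longrightarrow> f \<in> extensional D \<and> continuous_on D f"
    and VB_orth: "\<And>f \<Phi> \<phi>. \<lbrakk>f \<in> VB; \<Phi> \<in> carrier HA; \<phi> \<in> \<Phi>; \<phi> \<in> borel_measurable \<mu>\<rbrakk>
        \<Longrightarrow> (LINT x:D|\<mu>. f x * \<phi> x) = 0"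
    and VB_inv: "\<And>t f. \<lbrakk>t \<ge> 0; f \<in> VB\<rbrakk> \<Longrightarrow> UB t f \<in> VB"
    and HB0: "complex_hilbert_space HB0"
    and HB: "complex_hilbert_space HB"
    and H: "hilbert_tensor_product HA HB H \<tau>"
    and U: "\<And>t. t \<ge> 0 \<Longrightarrow> tensor_operator HA HB H \<tau> (UA t) (UB t) (U t)"
    and H0_inv: "\<And>t. t \<ge> 0 \<Longrightarrow>
        U t ` closed_span H {\<tau> f g | f g. f \<in> carrier HA \<and> g \<in> carrier HB0}
          \<subseteq> closed_span H {\<tau> f g | f g. f \<in> carrier HA \<and> g \<in> carrier HB0}"
    and UB_scalar: "\<And>t. t \<ge> 0 \<Longrightarrow> scalar_type HB (UB t)"
    and P: "self_adjoint_resolution HA borel P"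
      "\<And>t. t \<ge> 0 \<Longrightarrow> has_spectral_integral HA borel P
         (\<lambda>\<omega>. exp (\<i> * complex_of_real (2 * pi * \<omega> * t))) (UA t)"
    and Q: "resolution_of_identity HB borel Q"
      "\<And>t. t \<ge> 0 \<Longrightarrow> has_spectral_integral HB borel Q
         (\<lambda>z. exp (z * complex_of_real t)) (UB t)"
  shows "(\<forall>t\<ge>0. spectrum H (U t)
             = closure (set_of_products (spectrum HA (UA t)) (spectrum HB (UB t)))) \<and>
         (\<exists>E. product_resolution HA HB H \<tau> borel borel P Q E \<and>
            (\<forall>t\<ge>0. has_spectral_integral H (borel \<Otimes>\<^sub>M borel) E
               (\<lambda>(\<omega>, z). exp (z * complex_of_real t) * exp (\<i> * complex_of_real (2 * pi * \<omega> * t)))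
               (U t)))"
proof -
  \<comment> \<open>\<open>HA\<close> is a concrete space of classes, so that it is a Hilbert space
    has to be proved, whereas for \<open>HB\<close> and \<open>H\<close> this is part of the
    hypotheses.\<close>
  have HA: "complex_hilbert_space HA"
    unfolding HA_def by (rule complex_hilbert_space_L2)
  obtain E where E: "product_resolution HA HB H \<tau> borel borel P Q E"
    and integral: "\<And>\<phi> \<psi> TA TB T. \<lbrakk>has_spectral_integral HA borel P \<phi> TA; has_spectral_integral HB borel Q \<psi> TB;
        tensor_operator HA HB H \<tau> TA TB T\<rbrakk>
      \<Longrightarrow> has_spectral_integral H (borel \<Otimes>\<^sub>M borel) E (\<lambda>w. \<phi> (fst w) * \<psi> (snd w)) T
        \<and> spectrum H T = closure (set_of_products (spectrum HA TA) (spectrum HB TB))"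
    using product_resolution_spectrum[OF HA HB H P(1) Q(1)] by blast
  show ?thesis
  proof (intro conjI exI[of _ E] allI impI E)
    fix t :: real assume t: "t \<ge> 0"
    note * = integral[OF P(2)[OF t] Q(2)[OF t] U[OF t]]
    show "spectrum H (U t) = closure (set_of_products (spectrum HA (UA t)) (spectrum HB (UB t)))"
      using * by blast
    have "(\<lambda>(\<omega>, z). exp (z * complex_of_real t) * exp (\<i> * complex_of_real (2 * pi * \<omega> * t)))
        = (\<lambda>w. exp (\<i> * complex_of_real (2 * pi * fst w * t)) * exp (snd w * complex_of_real t))"
      by (simp add: fun_eq_iff mult.commute)
    then show "has_spectral_integral H (borel \<Otimes>\<^sub>M borel) E
        (\<lambda>(\<omega>, z). exp (z * complex_of_real t) * exp (\<i> * complex_of_real (2 * pi * \<omega> * t))) (U t)"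
      using * by simp
  qed
qed

end
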